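(* The function $\mathcal{C}(\mu)$ decreases monotonically from $+\infty$ to $\ln 2$ on $\mu>0$, that is, $\mathcal{C}$ is decreasing on $(0,\infty)$ with $\mathcal{C}(\mu)\to+\infty$ as $\mu\to0^+$ and $\mathcal{C}(\mu)\to\ln2$ as $\mu\to+\infty$. Consequently, for fixed $\varepsilon>0$, the effective half-length $$\varepsilon^{\rm eff}(q)=\varepsilon\exp\bigl(\ln 2-\mathcal{C}(\varepsilon q)\bigr),\qquad q>0,$$ of a partially reactive patch of half-length $\varepsilon$ and reactivity $q$ decreases monotonically from $\varepsilon$ to $0$ as $q$ decreases from $+\infty$ to $0$.
   Context: $\mathbb{H}_2=\mathbb{R}\times(0,\infty)$ is the upper half-plane with points $\boldsymbol{y}=(y_1,y_2)$; $\partial_n=-\partial_{y_2}$ on $y_2=0$ is the outward normal derivative. For $\mu>0$, $\mathcal{C}(\mu)$ is the constant term in $g_\mu(\boldsymbol{y})=\ln|\boldsymbol{y}|+\mathcal{C}(\mu)+o(1)$ as $|\boldsymbol{y}|\to\infty$, where $g_\mu$ is the Robin Green's function: $\Delta g_\mu=0$ in $\mathbb{H}_2$; $\partial_n g_\mu=0$ on $y_2=0$, $|y_1|\ge1$; $\partial_n g_\mu+\mu g_\mu=0$ on $y_2=0$, $|y_1|<1$; $g_\mu\sim\ln|\boldsymbol{y}|+\mathcal{O}(1)$ as $|\boldsymbol{y}|\to\infty$. Solutions are understood to be continuous on $\overline{\mathbb{H}_2}$ with locally finite Dirichlet energy (so no singularities at $(\pm1,0)$). *)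

theory Defs
  imports "HOL-Analysis.Analysis" "HOL-Library.Landau_Symbols"
begin

definition partial_deriv :: "'a::euclidean_space \<Rightarrow> ('a \<Rightarrow> real) \<Rightarrow> 'a \<Rightarrow> real" where
  "partial_deriv b u y = frechet_derivative u (at y) b"

definition C1_on :: "'a::euclidean_space set \<Rightarrow> ('a \<Rightarrow> real) \<Rightarrow> bool" where
  "C1_on S u \<longleftrightarrow> (\<forall>y\<in>S. u differentiable (at y)) \<and>
     (\<forall>b\<in>Basis. continuous_on S (partial_deriv b u))"

definition C2_on :: "'a::euclidean_space set \<Rightarrow> ('a \<Rightarrow> real) \<Rightarrow> bool" where
  "C2_on S u \<longleftrightarrow> C1_on S u \<and> (\<forall>b\<in>Basis. C1_on S (partial_deriv b u))"

definition laplacian :: "('a::euclidean_space \<Rightarrow> real) \<Rightarrow> 'a \<Rightarrow> real" where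
  "laplacian u y = (\<Sum>b\<in>Basis. partial_deriv b (partial_deriv b u) y)"

definition grad_sq :: "('a::euclidean_space \<Rightarrow> real) \<Rightarrow> 'a \<Rightarrow> real" where
  "grad_sq u y = (\<Sum>b\<in>Basis. (partial_deriv b u y)\<^sup>2)"

definition upper_half_plane :: "(real \<times> real) set" where
  "upper_half_plane = {y. snd y > 0}"

(* Integrating over half-balls centred on the boundary makes the energy finite
   near every point of the closed half-plane, (1,0) and (-1,0) included. *)
definition locally_finite_energy :: "(real \<times> real \<Rightarrow> real) \<Rightarrow> bool" where
  "locally_finite_energy u \<longleftrightarrow>
     (\<forall>R>0. set_integrable lborel (upper_half_plane \<inter> ball 0 R) (grad_sq u))"

(* The outward normal derivative at (x,0) is minus the one-sided y2-derivative. *)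
definition has_normal_deriv :: "(real \<times> real \<Rightarrow> real) \<Rightarrow> real \<Rightarrow> real \<Rightarrow> bool" where
  "has_normal_deriv u d x \<longleftrightarrow> ((\<lambda>t. u (x, t)) has_real_derivative (- d)) (at 0 within {0..})"

definition at_infinity_half_plane :: "(real \<times> real) filter" where
  "at_infinity_half_plane = inf at_infinity (principal (closure upper_half_plane))"

(* No pointwise boundary condition is imposed at the endpoints (1,0) and (-1,0): the
   boundary flux of a solution jumps there from mu * g to 0, and its one-sided
   y2-derivative at an endpoint is mu * g / 2, not 0.  Singular behaviour at the endpoints
   is ruled out by continuity and local finiteness of the energy. *)
definition robin_green :: "real \<Rightarrow> (real \<times> real \<Rightarrow> real) \<Rightarrow> bool" where
  "robin_green \<mu> g \<longleftrightarrow>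
     continuous_on (closure upper_half_plane) g \<and>
     locally_finite_energy g \<and>
     C2_on upper_half_plane g \<and>
     (\<forall>y\<in>upper_half_plane. laplacian g y = 0) \<and>
     (\<forall>x. \<bar>x\<bar> > 1 \<longrightarrow> has_normal_deriv g 0 x) \<and>
     (\<forall>x. \<bar>x\<bar> < 1 \<longrightarrow> (\<exists>d. has_normal_deriv g d x \<and> d + \<mu> * g (x, 0) = 0)) \<and>
     (\<lambda>y. g y - ln (norm y)) \<in> O[at_infinity_half_plane](\<lambda>_. 1)"

(* The values of g outside the closed half-plane are irrelevant, so g itself is
   unique only on the closed half-plane; its constant term is unique. *)
definition robin_const :: "real \<Rightarrow> real" where
  "robin_const \<mu> = (THE c. \<exists>g. robin_green \<mu> g \<and>
     ((\<lambda>y. g y - ln (norm y)) \<longlongrightarrow> c) at_infinity_half_plane)"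

definition eff_half_length :: "real \<Rightarrow> real \<Rightarrow> real" where
  "eff_half_length \<epsilon> q = \<epsilon> * exp (ln 2 - robin_const (\<epsilon> * q))"

end

theory Submission
  imports Defs "HOL-Complex_Analysis.Complex_Analysis" "HOL-Real_Asymp.Real_Asymp"
begin

text \<open>With \<open>l = \<mu> / \<pi>\<close>, the Green's function is \<open>g y = C + \<integral> ln |y - s| \<phi> s ds\<close> over the
  segment \<open>[-1, 1]\<close>, where \<open>\<phi>\<close> has total mass 1 and \<open>\<pi> \<phi> = \<mu> g\<close> there. Up to normalisation \<open>\<phi>\<close>
  solves \<open>f + l L f = 1\<close>, where \<open>L\<close> has the kernel \<open>ln (2 / |x - s|)\<close>, and then
  \<open>C = 1 / m - ln 2\<close> with \<open>m = l \<integral> f\<close>. Since \<open>L\<close> is positive definite, the equation is solvable for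
  all \<open>l \<ge> 0\<close> by continuation in \<open>l\<close>, and \<open>m\<close> is the maximum of
  \<open>2 \<integral> q - (\<integral> q\<^sup>2) / l - \<integral> q L q\<close>, which increases strictly with \<open>l\<close>. Moreover \<open>m \<le> 2 l\<close>, and
  testing the equation against the equilibrium measure of the segment, which has constant potential
  \<open>2 ln 2\<close>, shows \<open>m \<longrightarrow> 1 / (2 ln 2)\<close> as \<open>l \<longrightarrow> \<infinity>\<close>. That \<open>C\<close> is well defined is a maximum principle
  of Phragmen-Lindelof type: logarithmic barriers with vanishing normal derivative make the two
  endpoints and infinity negligible.\<close>

section \<open>A maximum principle for the mixed Neumann-Robin problem\<close>

text \<open>On the segment the Green's function equals C + ln 2 - L phi, and the Robin condition
  makes it phi / l. So phi = l (C + ln 2) f, and mass 1 gives (C + ln 2) m = 1. Two obstacles shape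
  the rest. Continuation in l needs a bound on f in the sup norm, whereas positive definiteness
  bounds it only in L2; splitting the kernel at a small scale e gives a bounded part, which meets
  the L1 norm of f, and a part of integral at most 2 e, whose contribution can be absorbed. For
  large l, pairing with the equilibrium measure leaves the mean of f (cos eta) over 0 < eta < pi to
  be shown small. The integral of f squared over dx is O(1 / l), but dx = sin eta d eta degenerates
  at the endpoints, where the pointwise bound f <= 1 takes over. That bound rests on f >= 0, which
  comes not from the integral equation but from the maximum principle for the Green's function,
  whose boundary values are a positive multiple of f.\<close>

lemma closure_upper_half_plane: "closure upper_half_plane = {y. snd y \<ge> 0}"
proof -
  have "upper_half_plane = {y. (0::real, 1::real) \<bullet> y > 0}"
    by (auto simp: upper_half_plane_def inner_prod_def)
  moreover have "closure {y. (0::real, 1::real) \<bullet> y > 0} = {y. (0, 1) \<bullet> y \<ge> 0}"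
    by (rule closure_halfspace_gt) (simp add: zero_prod_def)
  ultimately show ?thesis by (auto simp: inner_prod_def)
qed

lemma open_upper_half_plane: "open upper_half_plane"
  unfolding upper_half_plane_def by (intro open_Collect_less continuous_intros)

text \<open>The first derivative vanishes at the maximum, so a positive D would make it positive
  just to the right of 0, and the mean value theorem would then put f above its value at 0.\<close>

lemma second_derivative_nonpos_at_local_max:
  fixes f :: "real \<Rightarrow> real"
  assumes f: "\<forall>\<^sub>F t in nhds 0. (f has_real_derivative f' t) (at t)"
    and D: "(f' has_real_derivative D) (at 0)"
    and mx: "\<forall>\<^sub>F t in nhds 0. f t \<le> f 0"
  shows "D \<le> 0"
proof (rule ccontr)
  assume "\<not> D \<le> 0"
  then obtain d1 where d1: "d1 > 0" "\<And>h. 0 < h \<Longrightarrow> h < d1 \<Longrightarrow> f' 0 < f' (0 + h)"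
    using has_real_derivative_pos_inc_right[of f' D 0 UNIV] D by auto
  obtain d2 where d2: "d2 > 0" "\<And>t. \<bar>t\<bar> < d2 \<Longrightarrow> (f has_real_derivative f' t) (at t) \<and> f t \<le> f 0"
    using eventually_conj[OF f mx] unfolding eventually_nhds_metric by (auto simp: dist_real_def)
  have "f' 0 = 0"
    by (rule DERIV_local_max[of f _ 0 d2]) (use d2 in auto)
  define h where "h = min d1 d2 / 2"
  have h: "0 < h" "h < d1" "h < d2" using d1(1) d2(1) by (auto simp: h_def)
  have "\<exists>z. z > 0 \<and> z < h \<and> f h - f 0 = (h - 0) * f' z"
  proof (rule MVT2)
    show "0 < h" by (fact h)
  next
    fix x assume "0 \<le> x" "x \<le> h"
    then show "(f has_real_derivative f' x) (at x)" using d2(2)[of x] h by auto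
  qed
  then obtain z where z: "0 < z" "z < h" "f h - f 0 = h * f' z" by auto
  have "f' z > 0" using d1(2)[of z] z h \<open>f' 0 = 0\<close> by auto
  then have "f h > f 0" using z h by (metis diff_gt_0_iff_gt mult_pos_pos)
  then show False using d2(2)[of h] h by auto
qed

text \<open>Pointwise second derivatives along coordinate lines suffice for the maximum principle
  and, unlike \<^const>\<open>C2_on\<close>, are stable under sums without any openness bookkeeping.\<close>

definition second_deriv ::
  "(real \<times> real \<Rightarrow> real) \<Rightarrow> real \<times> real \<Rightarrow> real \<times> real \<Rightarrow> real \<Rightarrow> bool" where
  "second_deriv u b y d \<longleftrightarrow> (\<exists>f'. (\<forall>\<^sub>F t in nhds 0.
      ((\<lambda>t. u (y + t *\<^sub>R b)) has_real_derivative f' t) (at t)) \<and> (f' has_real_derivative d) (at 0))"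

definition laplacian_at :: "(real \<times> real \<Rightarrow> real) \<Rightarrow> real \<times> real \<Rightarrow> real \<Rightarrow> bool" where
  "laplacian_at u y L \<longleftrightarrow>
     (\<exists>d1 d2. second_deriv u (1, 0) y d1 \<and> second_deriv u (0, 1) y d2 \<and> L = d1 + d2)"

lemma second_deriv_add:
  assumes "second_deriv u b y d" "second_deriv v b y e"
  shows "second_deriv (\<lambda>z. u z + v z) b y (d + e)"
proof -
  obtain f g where f: "\<forall>\<^sub>F t in nhds 0. ((\<lambda>t. u (y + t *\<^sub>R b)) has_real_derivative f t) (at t)"
    and f': "(f has_real_derivative d) (at 0)"
    and g: "\<forall>\<^sub>F t in nhds 0. ((\<lambda>t. v (y + t *\<^sub>R b)) has_real_derivative g t) (at t)"
    and g': "(g has_real_derivative e) (at 0)"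
    using assms unfolding second_deriv_def by auto
  show ?thesis unfolding second_deriv_def
    by (rule exI[of _ "\<lambda>t. f t + g t"], rule conjI, rule eventually_mono[OF eventually_conj[OF f g]])
       (auto intro!: derivative_intros f' g')
qed

lemma second_deriv_cmult:
  assumes "second_deriv u b y d"
  shows "second_deriv (\<lambda>z. c * u z) b y (c * d)"
proof -
  obtain f where f: "\<forall>\<^sub>F t in nhds 0. ((\<lambda>t. u (y + t *\<^sub>R b)) has_real_derivative f t) (at t)"
    and f': "(f has_real_derivative d) (at 0)"
    using assms unfolding second_deriv_def by auto
  show ?thesis unfolding second_deriv_def
    by (rule exI[of _ "\<lambda>t. c * f t"], rule conjI, rule eventually_mono[OF f])
       (auto intro!: DERIV_cmult f')
qed

lemma laplacian_at_add:
  "laplacian_at u y L \<Longrightarrow> laplacian_at v y M \<Longrightarrow> laplacian_at (\<lambda>z. u z + v z) y (L + M)"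
  unfolding laplacian_at_def
  by (elim exE conjE, intro exI conjI, (erule (1) second_deriv_add)+) simp

lemma laplacian_at_cmult:
  "laplacian_at u y L \<Longrightarrow> laplacian_at (\<lambda>z. c * u z) y (c * L)"
  unfolding laplacian_at_def
  by (elim exE conjE, intro exI conjI, (erule second_deriv_cmult)+) (simp add: distrib_left)

section \<open>Second derivatives of C2 functions and of the comparison functions\<close>

lemma has_real_derivative_line:
  fixes u :: "'a::euclidean_space \<Rightarrow> real"
  assumes "u differentiable (at (y + t *\<^sub>R b))"
  shows "((\<lambda>t. u (y + t *\<^sub>R b)) has_real_derivative partial_deriv b u (y + t *\<^sub>R b)) (at t)"
proof -
  let ?D = "frechet_derivative u (at (y + t *\<^sub>R b))"
  have D: "(u has_derivative ?D) (at (y + t *\<^sub>R b))"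
    using assms frechet_derivative_works by blast
  have line: "((\<lambda>t. y + t *\<^sub>R b) has_derivative (\<lambda>h. h *\<^sub>R b)) (at t)"
    by (auto intro!: derivative_eq_intros)
  have "(u \<circ> (\<lambda>t. y + t *\<^sub>R b) has_derivative (?D \<circ> (\<lambda>h. h *\<^sub>R b))) (at t)"
    by (rule diff_chain_at[OF line D])
  moreover have "?D \<circ> (\<lambda>h. h *\<^sub>R b) = (*) (partial_deriv b u (y + t *\<^sub>R b))"
    using linear_scale[OF has_derivative_linear[OF D]]
    by (auto simp: partial_deriv_def fun_eq_iff)
  ultimately show ?thesis unfolding has_field_derivative_def by (simp add: o_def)
qed

lemma second_deriv_C2_on:
  assumes "C2_on S u" "open S" "y \<in> S" "b \<in> Basis"
  shows "second_deriv u b y (partial_deriv b (partial_deriv b u) y)"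
proof -
  have ev: "\<forall>\<^sub>F t in nhds (0::real). y + t *\<^sub>R b \<in> S"
  proof -
    have "isCont (\<lambda>t::real. y + t *\<^sub>R b) 0" by (intro continuous_intros)
    then have "((\<lambda>t::real. y + t *\<^sub>R b) \<longlongrightarrow> y) (nhds 0)"
      by (simp add: isCont_def tendsto_nhds_iff)
    then show ?thesis using topological_tendstoD assms(2,3) by blast
  qed
  have 1: "u differentiable at z" "partial_deriv b u differentiable at z" if "z \<in> S" for z
    using assms(1,4) that unfolding C2_on_def C1_on_def by auto
  show ?thesis unfolding second_deriv_def
  proof (intro exI conjI)
    show "\<forall>\<^sub>F t in nhds 0. ((\<lambda>t. u (y + t *\<^sub>R b)) has_real_derivative partial_deriv b u (y + t *\<^sub>R b)) (at t)"
      using ev by eventually_elim (rule has_real_derivative_line, rule 1)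
    show "((\<lambda>t. partial_deriv b u (y + t *\<^sub>R b)) has_real_derivative partial_deriv b (partial_deriv b u) y) (at 0)"
      using has_real_derivative_line[of "partial_deriv b u" y 0 b] 1(2)[of y] assms(3) by simp
  qed
qed

lemma Basis_real_prod: "(Basis :: (real \<times> real) set) = {(1, 0), (0, 1)}"
  by (auto simp: Basis_prod_def)

lemma laplacian_real_prod:
  fixes u :: "real \<times> real \<Rightarrow> real"
  shows "laplacian u y = partial_deriv (1,0) (partial_deriv (1,0) u) y + partial_deriv (0,1) (partial_deriv (0,1) u) y"
  unfolding laplacian_def Basis_real_prod by simp

lemma laplacian_at_C2_on:
  assumes "C2_on S u" "open S" "y \<in> S"
  shows "laplacian_at u y (laplacian u y)"
  unfolding laplacian_at_def laplacian_real_prod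
  using second_deriv_C2_on[OF assms] Basis_real_prod by blast

lemma norm_minus_real_axis: "norm (y - (p, 0::real)) = sqrt ((fst y - p)\<^sup>2 + (snd y)\<^sup>2)"
  for y :: "real \<times> real"
  by (cases y) (simp add: norm_Pair)

lemma ln_norm_minus_real_axis:
  "y \<noteq> (p, 0) \<Longrightarrow> ln (norm (y - (p, 0::real))) = ln ((fst y - p)\<^sup>2 + (snd y)\<^sup>2) / 2"
  for y :: "real \<times> real"
  unfolding norm_minus_real_axis
  by (subst ln_sqrt) (cases y, auto simp: sum_power2_gt_zero_iff add_pos_nonneg add_nonneg_pos)

lemma laplacian_at_ln_norm:
  assumes y: "snd y > 0"
  shows "laplacian_at (\<lambda>z. ln (norm (z - (p, 0)))) y 0"
proof -
  obtain a b where yab: "y = (a, b)" and b: "b > 0" using y by (cases y) auto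
  define q where "q = (a - p)\<^sup>2 + b\<^sup>2"
  have q: "q > 0" using b by (auto simp: q_def sum_power2_gt_zero_iff)
  have 1: "second_deriv (\<lambda>z. ln (norm (z - (p, 0)))) (1, 0) y ((b\<^sup>2 - (a - p)\<^sup>2) / q\<^sup>2)"
    unfolding second_deriv_def
  proof (intro exI conjI)
    have *: "ln (norm (y + t *\<^sub>R (1,0) - (p,0))) = ln ((a + t - p)\<^sup>2 + b\<^sup>2) / 2" for t
      using ln_norm_minus_real_axis[of "y + t *\<^sub>R (1,0)" p] b by (auto simp: yab)
    have pos: "(a + t - p)\<^sup>2 + b\<^sup>2 > 0" for t using b by (auto simp: sum_power2_gt_zero_iff)
    have "((\<lambda>t. ln ((a + t - p)\<^sup>2 + b\<^sup>2) / 2) has_real_derivative (a + t - p) / ((a + t - p)\<^sup>2 + b\<^sup>2)) (at t)" for t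
    proof -
      have "((\<lambda>t. (a + t - p)\<^sup>2 + b\<^sup>2) has_real_derivative 2 * (a + t - p)) (at t)"
        by (auto intro!: derivative_eq_intros)
      note DERIV_cdivide[OF DERIV_chain2[OF DERIV_ln_divide[OF pos] this], of 2]
      moreover have "1 / q * (2 * u) / 2 = u / q" for q u :: real by simp
      ultimately show ?thesis by (simp only:)
    qed
    then show "\<forall>\<^sub>F t in nhds 0. ((\<lambda>t. ln (norm (y + t *\<^sub>R (1, 0) - (p, 0)))) has_real_derivative
        (\<lambda>t. (a + t - p) / ((a + t - p)\<^sup>2 + b\<^sup>2)) t) (at t)"
      unfolding * by (auto intro!: always_eventually)
    show "((\<lambda>t. (a + t - p) / ((a + t - p)\<^sup>2 + b\<^sup>2)) has_real_derivative (b\<^sup>2 - (a - p)\<^sup>2) / q\<^sup>2) (at 0)"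
      using q by (auto intro!: derivative_eq_intros simp: q_def power2_eq_square divide_simps)
  qed
  have 2: "second_deriv (\<lambda>z. ln (norm (z - (p, 0)))) (0, 1) y (((a - p)\<^sup>2 - b\<^sup>2) / q\<^sup>2)"
    unfolding second_deriv_def
  proof (intro exI conjI)
    have *: "ln (norm (y + t *\<^sub>R (0,1) - (p,0))) = ln ((a - p)\<^sup>2 + (b + t)\<^sup>2) / 2" if "b + t > 0" for t
      using ln_norm_minus_real_axis[of "y + t *\<^sub>R (0,1)" p] that by (auto simp: yab)
    have ev: "\<forall>\<^sub>F t in nhds 0. t \<in> {-b<..}" 
      using b by (intro eventually_nhds_in_open) auto
    show "\<forall>\<^sub>F t in nhds 0. ((\<lambda>t. ln (norm (y + t *\<^sub>R (0, 1) - (p, 0)))) has_real_derivative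
        (\<lambda>t. (b + t) / ((a - p)\<^sup>2 + (b + t)\<^sup>2)) t) (at t)"
      using ev
    proof eventually_elim
      case (elim t)
      then have pos: "(a - p)\<^sup>2 + (b + t)\<^sup>2 > 0" by (auto simp: sum_power2_gt_zero_iff)
      have "((\<lambda>t. ln ((a - p)\<^sup>2 + (b + t)\<^sup>2) / 2) has_real_derivative (b + t) / ((a - p)\<^sup>2 + (b + t)\<^sup>2)) (at t)"
      proof -
        have "((\<lambda>t. (a - p)\<^sup>2 + (b + t)\<^sup>2) has_real_derivative 2 * (b + t)) (at t)"
          by (auto intro!: derivative_eq_intros)
        note DERIV_cdivide[OF DERIV_chain2[OF DERIV_ln_divide[OF pos] this], of 2]
        moreover have "1 / q * (2 * u) / 2 = u / q" for q u :: real by simp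
        ultimately show ?thesis by (simp only:)
      qed
      then show ?case
        by (rule has_field_derivative_transform_within_open[of _ _ _ "{-b<..}"]) (use elim * in auto)
    qed
    show "((\<lambda>t. (b + t) / ((a - p)\<^sup>2 + (b + t)\<^sup>2)) has_real_derivative ((a - p)\<^sup>2 - b\<^sup>2) / q\<^sup>2) (at 0)"
      using q by (auto intro!: derivative_eq_intros simp: q_def power2_eq_square divide_simps)
  qed
  show ?thesis unfolding laplacian_at_def
    using 1 2 by (intro exI conjI) (auto simp: diff_divide_distrib)
qed

text \<open>A comparison function for strictness: the square contributes the positive Laplacian, the
  linear term the nonzero normal derivative on the boundary line, where the square is flat.\<close>

lemma laplacian_at_quadratic: "laplacian_at (\<lambda>z. snd z + (snd z)\<^sup>2) y 2"
proof -
  have 1: "second_deriv (\<lambda>z. snd z + (snd z)\<^sup>2) (1,0) y 0" unfolding second_deriv_def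
    by (rule exI[of _ "\<lambda>_. 0"]) simp
  have 2: "second_deriv (\<lambda>z. snd z + (snd z)\<^sup>2) (0,1) y 2" unfolding second_deriv_def
    by (rule exI[of _ "\<lambda>t. 1 + 2 * (snd y + t)"]) (auto intro!: derivative_eq_intros always_eventually)
  show ?thesis unfolding laplacian_at_def
    using 1 2 by (intro exI[of _ 0] exI[of _ 2]) simp
qed

lemma laplacian_at_nonpos_at_local_max:
  assumes "laplacian_at u y L" "\<forall>\<^sub>F z in nhds y. u z \<le> u y"
  shows "L \<le> 0"
proof -
  have "d \<le> 0" if d: "second_deriv u b y d" for b d
  proof -
    obtain f where f: "\<forall>\<^sub>F t in nhds 0. ((\<lambda>t. u (y + t *\<^sub>R b)) has_real_derivative f t) (at t)"
      and f': "(f has_real_derivative d) (at 0)"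
      using d unfolding second_deriv_def by auto
    have "isCont (\<lambda>t::real. y + t *\<^sub>R b) 0" by (intro continuous_intros)
    then have "filterlim (\<lambda>t::real. y + t *\<^sub>R b) (nhds y) (nhds 0)"
      by (simp add: isCont_def tendsto_nhds_iff)
    then have "\<forall>\<^sub>F t in nhds 0. u (y + t *\<^sub>R b) \<le> u (y + 0 *\<^sub>R b)"
      using eventually_compose_filterlim[OF assms(2)] by simp
    then show ?thesis by (rule second_derivative_nonpos_at_local_max[OF f f'])
  qed
  then show ?thesis using assms(1) unfolding laplacian_at_def by (metis add_nonpos_nonpos)
qed

section \<open>One-sided normal derivatives on the boundary line\<close>

lemma has_normal_deriv_add:
  "has_normal_deriv u d x \<Longrightarrow> has_normal_deriv v e x \<Longrightarrow> has_normal_deriv (\<lambda>z. u z + v z) (d + e) x"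
  unfolding has_normal_deriv_def by (auto intro!: derivative_eq_intros)

lemma has_normal_deriv_cmult:
  "has_normal_deriv u d x \<Longrightarrow> has_normal_deriv (\<lambda>z. c * u z) (c * d) x"
  unfolding has_normal_deriv_def by (auto intro!: derivative_eq_intros)

lemma has_normal_deriv_ln_norm:
  assumes "x \<noteq> p"
  shows "has_normal_deriv (\<lambda>z. ln (norm (z - (p, 0)))) 0 x"
proof -
  have *: "(\<lambda>t. ln (norm ((x,t) - (p, 0)))) = (\<lambda>t. ln ((x - p)\<^sup>2 + t\<^sup>2) / 2)"
    using ln_norm_minus_real_axis[of "(x,_)" p] assms by (auto simp: fun_eq_iff)
  have "(x - p)\<^sup>2 + 0\<^sup>2 > 0" using assms by simp
  then have "((\<lambda>t. ln ((x - p)\<^sup>2 + t\<^sup>2) / 2) has_real_derivative 0) (at 0)"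
    by (auto intro!: derivative_eq_intros)
  then show ?thesis unfolding has_normal_deriv_def * by (simp add: has_field_derivative_at_within)
qed

lemma has_normal_deriv_quadratic: "has_normal_deriv (\<lambda>z. snd z + (snd z)\<^sup>2) (- 1) x"
  unfolding has_normal_deriv_def by (auto intro!: derivative_eq_intros)

lemma has_normal_deriv_nonneg_at_local_max:
  assumes "has_normal_deriv u d x" "\<forall>\<^sub>F t in at_right 0. u (x, t) \<le> u (x, 0)"
  shows "d \<ge> 0"
proof (rule ccontr)
  assume "\<not> d \<ge> 0"
  then obtain e where e: "e > 0" "\<And>h. 0 < h \<Longrightarrow> h < e \<Longrightarrow> u (x, 0) < u (x, 0 + h)"
    using has_real_derivative_pos_inc_right[of "\<lambda>t. u (x,t)" "- d" 0 "{0..}"] assms(1)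
    unfolding has_normal_deriv_def by auto
  have "\<forall>\<^sub>F t in at_right 0. t \<in> {0<..<e}" using e(1) by (rule eventually_at_right_real)
  with assms(2) have "\<forall>\<^sub>F t in at_right (0::real). False"
    by eventually_elim (use e in force)
  then show False by simp
qed
text \<open>The barrier \<open>A\<close> below is harmonic with vanishing normal derivative, nonpositive outside the
  half-disc of radius \<open>r\<close>, and tends to \<open>-\<infinity>\<close> at both endpoints and at infinity; the quadratic term
  makes the inequalities at a maximum strict.\<close>

lemma barrier_annulus:
  fixes w :: "real \<times> real \<Rightarrow> real"
  assumes cont: "continuous_on (closure upper_half_plane) w"
    and lap: "\<And>y. y \<in> upper_half_plane \<Longrightarrow> laplacian_at w y 0"
    and outer: "\<And>x. \<bar>x\<bar> > 1 \<Longrightarrow> has_normal_deriv w 0 x"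
    and inner: "\<And>x. \<bar>x\<bar> < 1 \<Longrightarrow> \<exists>d. has_normal_deriv w d x \<and> d + \<mu> * w (x, 0) = 0"
    and mu: "\<mu> > 0"
    and bdd: "\<And>y. y \<in> closure upper_half_plane \<Longrightarrow> norm y \<ge> r \<Longrightarrow> w y \<le> B"
    and r: "0 < r" "r < 1" and m: "m \<ge> 0"
    and arc: "\<And>y. y \<in> closure upper_half_plane \<Longrightarrow> norm y = r \<Longrightarrow> w y \<le> m"
    and y0: "y0 \<in> closure upper_half_plane" "norm y0 \<ge> r" "y0 \<noteq> (1, 0)" "y0 \<noteq> (-1, 0)"
  shows "w y0 \<le> m"
proof (rule ccontr)
  assume neg: "\<not> w y0 \<le> m"
  let ?l = "\<lambda>p z. ln (norm (z - (p, 0::real)))"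
  \<comment> \<open>Outside the half-disc, norm z + 1 \<le> norm z * (1 + 1 / r), so with this
    constant \<open>A z\<close> is at most ln r - ln (norm z). The weight -3 at the origin outweighs
    the two unit weights at the endpoints, leaving - ln (norm z) at infinity; the pole it creates
    lies inside the half-disc.\<close>
  define K where "K = ln r - 2 * ln (1 + 1 / r)"
  define A where "A = (\<lambda>z::real\<times>real. ?l 1 z + ?l (-1) z + (-3) * ?l 0 z + K)"
  have n1: "norm ((1::real), (0::real)) = 1" "norm ((-1::real), (0::real)) = 1" by (simp_all add: norm_Pair)
  have tri: "norm (z - (1,0)) \<le> norm z + 1" "norm (z - (-1,0)) \<le> norm z + 1"
    "1 \<le> norm z + norm (z - (1,0))" "1 \<le> norm z + norm (z - (-1,0))" for z :: "real \<times> real"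
    using norm_triangle_ineq4[of z "(1,0)"] norm_triangle_ineq4[of z "(-1,0)"]
      norm_triangle_ineq2[of "(1,0)" z] norm_triangle_ineq2[of "(-1,0)" z] n1 norm_minus_commute[of z]
    by auto
  have l0: "?l 0 z = ln (norm z)" for z :: "real \<times> real"
    by (simp flip: zero_prod_def)
  have Abd: "A z \<le> - (ln (norm z) - ln r)" if z: "norm z \<ge> r" "z \<noteq> (1,0)" "z \<noteq> (-1,0)" for z
  proof -
    have "norm z + 1 \<le> norm z * (1 + 1 / r)" using z(1) r by (simp add: field_simps)
    then have "?l 1 z \<le> ln (norm z * (1 + 1 / r))" "?l (-1) z \<le> ln (norm z * (1 + 1 / r))"
      using z tri[of z] by (auto intro!: ln_mono)
    moreover have "ln (norm z * (1 + 1 / r)) = ln (norm z) + ln (1 + 1 / r)"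
      using z(1) r add_pos_pos[of 1 "1 / r"] by (subst ln_mult) auto
    ultimately show ?thesis unfolding A_def K_def l0 by simp
  qed
  have B: "w y0 \<le> B" using bdd y0 by auto
  \<comment> \<open>The penalty \<open>dl * A\<close> costs at most half of the excess of
    \<open>w y0\<close> over m, so M stays above m. The 1 in the denominator guards against
    \<open>A y0\<close> = 0.\<close>
  define dl where "dl = (w y0 - m) / (2 * (1 + \<bar>A y0\<bar>))"
  have dl: "dl > 0" using neg by (auto simp: dl_def)
  define M where "M = w y0 + dl * A y0"
  have "dl * \<bar>A y0\<bar> < w y0 - m"
  proof -
    have "dl * \<bar>A y0\<bar> \<le> dl * (1 + \<bar>A y0\<bar>)" using dl by (intro mult_left_mono) auto
    also have "\<dots> = (w y0 - m) / 2" by (simp add: dl_def field_simps)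
    also have "\<dots> < w y0 - m" using neg by simp
    finally show ?thesis .
  qed
  moreover have "dl * A y0 \<ge> - (dl * \<bar>A y0\<bar>)"
    using dl mult_left_mono[of "- \<bar>A y0\<bar>" "A y0" dl] by auto
  ultimately have M: "M > m" by (simp add: M_def)
  \<comment> \<open>So large that on norm z = R the penalty brings B below m, and that
    \<open>y0\<close> lies inside.\<close>
  define R where "R = norm y0 + 2 + exp ((B - m) / dl + ln r)"
  have R: "R > 1" "R > norm y0" "R > r" "(B - m) / dl + ln r < ln R"
  proof -
    show "R > 1" "R > norm y0" "R > r"
      using r exp_gt_zero[of "(B - m) / dl + ln r"] norm_ge_zero[of y0] unfolding R_def by linarith+
    have "exp ((B - m) / dl + ln r) < R" using norm_ge_zero[of y0] unfolding R_def by linarith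
    then show "(B - m) / dl + ln r < ln R"
      using \<open>R > 1\<close> by (metis exp_less_cancel_iff exp_ln less_trans zero_less_one)
  qed
  have R': "B - dl * (ln R - ln r) < m"
    using R(4) dl by (simp add: field_simps)
  define \<gamma> where "\<gamma> = M - m"
  \<comment> \<open>Points of D have height at most R, so the quadratic term is worth at most half
    of the gap between M and m.\<close>
  define \<eta> where "\<eta> = \<gamma> / (2 * (R + R\<^sup>2))"
  have gam: "\<gamma> > 0" using M by (simp add: \<gamma>_def)
  have RR: "R + R\<^sup>2 > 0" using R(1) by (simp add: add_pos_nonneg)
  have eta: "\<eta> > 0" using gam RR by (simp add: \<eta>_def)
  \<comment> \<open>Close to one endpoint, the other is at distance at most 3 and the origin at
    distance at least 1 / 2, so \<open>A z\<close> is at most ln \<rho> + L on the circle of radius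
    \<rho>.\<close>
  define L where "L = ln 3 + 3 * ln 2 + K"
  \<comment> \<open>So small that the penalty brings B down to m on the circles around both
    endpoints, and that \<open>y0\<close> is not inside them.\<close>
  define \<rho> where "\<rho> = Min {1/2, norm (y0 - (1,0)), norm (y0 - (-1,0)), exp ((m - B) / dl - L)}"
  have rho: "0 < \<rho>" "\<rho> \<le> 1/2" "\<rho> \<le> norm (y0 - (1,0))" "\<rho> \<le> norm (y0 - (-1,0))"
    and rho': "\<rho> \<le> exp ((m - B) / dl - L)"
    using y0 by (auto simp: \<rho>_def)
  have "ln \<rho> \<le> (m - B) / dl - L" using rho' rho(1) by (metis exp_le_cancel_iff exp_ln)
  then have rhoA: "B + dl * (ln \<rho> + L) \<le> m" using dl by (simp add: field_simps)
  define v where "v = (\<lambda>z. w z + dl * A z + \<eta> * (snd z + (snd z)\<^sup>2))"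
  define D where "D = {z. 0 \<le> snd z} \<inter> {z::real\<times>real. r \<le> norm z} \<inter> {z. norm z \<le> R} \<inter>
      {z. \<rho> \<le> norm (z - (1,0))} \<inter> {z. \<rho> \<le> norm (z - (-1,0))}"
  have "closed D" unfolding D_def
    by (intro closed_Int closed_Collect_le continuous_intros)
  moreover have "bounded D" unfolding D_def
    by (rule boundedI[of _ R]) auto
  ultimately have compD: "compact D" by (simp add: compact_eq_bounded_closed)
  have Dne: "z \<noteq> (1,0)" "z \<noteq> (-1,0)" "z \<noteq> 0" if "z \<in> D" for z
    using that rho(1) r by (auto simp: D_def)
  have cw: "continuous_on D w"
    by (rule continuous_on_subset[OF cont]) (auto simp: D_def closure_upper_half_plane)
  have cl: "continuous_on D (?l e)" if "(e, 0) \<notin> D" for e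
    using that by (intro continuous_intros) auto
  have "(1, 0) \<notin> D" "(-1, 0) \<notin> D" "(0, 0) \<notin> D" 
    using Dne(1)[of "(1, 0)"] Dne(2)[of "(-1, 0)"] Dne(3)[of "(0, 0)"] by (auto simp: zero_prod_def)
  then have "continuous_on D v" unfolding v_def A_def
    by (intro continuous_on_add continuous_on_mult_left continuous_on_power continuous_on_snd
        continuous_on_id continuous_on_const cl cw)
  moreover have y0D: "y0 \<in> D" using y0 R rho by (auto simp: D_def closure_upper_half_plane)
  ultimately have "\<exists>x\<in>D. \<forall>y\<in>D. v y \<le> v x"
    using continuous_attains_sup[OF compD, of v] by blast
  then obtain z where z: "z \<in> D" "\<And>u. u \<in> D \<Longrightarrow> v u \<le> v z"
    by blast
  have zH: "z \<in> closure upper_half_plane" "norm z \<ge> r" using z(1) by (auto simp: D_def closure_upper_half_plane)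
  have wB: "w z \<le> B" using bdd zH by auto
  have sz: "0 \<le> snd z" "snd z \<le> R"
    using z(1) norm_snd_le[of "snd z" "fst z"] by (auto simp: D_def)
  have h: "\<eta> * (snd z + (snd z)\<^sup>2) \<le> \<gamma> / 2"
  proof -
    have "\<eta> * (snd z + (snd z)\<^sup>2) \<le> \<eta> * (R + R\<^sup>2)"
      using sz eta by (intro mult_left_mono add_mono power_mono) auto
    also have "\<dots> = \<gamma> / 2" using RR by (simp add: \<eta>_def field_simps)
    finally show ?thesis .
  qed
  have Az: "A z \<le> - (ln (norm z) - ln r)" using Abd zH Dne[OF z(1)] by auto
  have "M \<le> v y0" using y0(1) eta by (auto simp: M_def v_def closure_upper_half_plane)
  also have "\<dots> \<le> v z" using z y0D by auto
  finally have vz: "M \<le> v z" .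
  have low: "M - \<gamma> / 2 \<le> w z + dl * A z" using vz h unfolding v_def by simp
  have "ln (norm z) \<ge> ln r" using zH r by (intro ln_mono) auto
  then have Az0: "dl * A z \<le> 0" using Az dl by (simp add: mult_nonneg_nonpos)
  \<comment> \<open>The maximum of v sits where w exceeds m. This rules out the arc norm z = r, and
    as m \<ge> 0 it forces a nonpositive normal derivative of w on the Robin part of the
    boundary.\<close>
  have wz: "w z > m" using low Az0 gam \<gamma>_def by linarith
  have s1: "norm z \<noteq> r" using arc[OF zH(1)] wz by auto
  have s2: "norm z \<noteq> R"
  proof
    assume "norm z = R"
    then have "dl * A z \<le> dl * - (ln R - ln r)" using Az dl by (intro mult_left_mono) auto
    then show False using low wB R' gam \<gamma>_def by linarith
  qed
  have near: False if e: "e = 1 \<or> e = -1" "norm (z - (e, 0)) = \<rho>" for e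
  proof -
    have nz: "norm z \<ge> 1/2" and lnr: "norm z \<le> 3/2" using tri[of z] e rho(2)
      norm_triangle_sub[of z "(e,0)"] n1 by auto
    have 1: "norm (z - (- e, 0)) \<le> 3" using tri[of z] e lnr by auto
    have "ln (norm (z - (- e, 0))) \<le> ln 3"
      using 1 Dne[OF z(1)] e by (intro ln_mono) auto
    moreover have "ln (norm z) \<ge> - ln 2"
    proof -
      have "ln (1/2) \<le> ln (norm z)" using nz by (intro ln_mono) auto
      then show ?thesis by (simp add: ln_div)
    qed
    ultimately have "A z \<le> ln \<rho> + L"
      using e unfolding A_def L_def l0 by auto
    then have "dl * A z \<le> dl * (ln \<rho> + L)" using dl by simp
    then show False using low wB rhoA gam \<gamma>_def by linarith
  qed
  define U where "U = {u::real\<times>real. r < norm u} \<inter> {u. norm u < R} \<inter>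
      {u. \<rho> < norm (u - (1,0))} \<inter> {u. \<rho> < norm (u - (-1,0))}"
  have "open U" unfolding U_def by (intro open_Int open_Collect_less continuous_intros)
  have zU: "z \<in> U" using z(1) s1 s2 near by (force simp: D_def U_def)
  have UD: "v u \<le> v z" if "u \<in> U" "0 \<le> snd u" for u
    using that z(2)[of u] by (auto simp: U_def D_def)
  show False
  proof (cases "snd z > 0")
    case True
    have "laplacian_at (\<lambda>z. K) z 0" unfolding laplacian_at_def second_deriv_def
      by (intro exI[of _ 0] conjI exI[of _ "\<lambda>_. 0"]) auto
    then have "laplacian_at v z (0 + dl * (0 + 0 + (-3) * 0 + 0) + \<eta> * 2)" unfolding v_def A_def
      using True by (intro laplacian_at_add laplacian_at_cmult laplacian_at_ln_norm lap laplacian_at_quadratic)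
        (auto simp: upper_half_plane_def)
    moreover have "\<forall>\<^sub>F u in nhds z. u \<in> U \<inter> upper_half_plane"
      using \<open>open U\<close> open_upper_half_plane zU True by (intro eventually_nhds_in_open) (auto simp: upper_half_plane_def)
    then have "\<forall>\<^sub>F u in nhds z. v u \<le> v z"
      by eventually_elim (use UD in \<open>auto simp: upper_half_plane_def\<close>)
    ultimately have "\<eta> * 2 \<le> 0" using laplacian_at_nonpos_at_local_max by fastforce
    then show False using eta by simp
  next
    case False
    then obtain x where zx: "z = (x, 0)" using sz by (cases z) auto
    have x: "x \<noteq> 0" "x \<noteq> 1" "x \<noteq> -1" using Dne[OF z(1)] zx by (auto simp: zero_prod_def)
    have "isCont (\<lambda>t. (x, t)) 0" by (intro continuous_intros)
    then have "((\<lambda>t. (x, t)) \<longlongrightarrow> z) (at_right 0)"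
      unfolding zx isCont_def by (rule filterlim_mono) (auto intro: at_le)
    then have "\<forall>\<^sub>F t in at_right 0. (x, t) \<in> U" using \<open>open U\<close> zU topological_tendstoD by blast
    moreover have "\<forall>\<^sub>F t in at_right (0::real). t > 0" by (simp add: eventually_at_right_less)
    ultimately have ev: "\<forall>\<^sub>F t in at_right 0. v (x, t) \<le> v (x, 0)"
      by eventually_elim (use UD zx in auto)
    obtain d where d: "has_normal_deriv w d x" "d \<le> 0"
    proof (cases "\<bar>x\<bar> < 1")
      case True
      then obtain d where "has_normal_deriv w d x" "d + \<mu> * w z = 0" using inner zx by blast
      moreover have "\<mu> * w z \<ge> 0" using mu wz m by simp
      ultimately show ?thesis using that by force
    next
      case False
      then show ?thesis using outer[of x] x that by force
    qed
    have "has_normal_deriv (\<lambda>z. K) 0 x" by (simp add: has_normal_deriv_def)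
    then have "has_normal_deriv v (d + dl * (0 + 0 + (-3) * 0 + 0) + \<eta> * (-1)) x" unfolding v_def A_def
      using x by (intro has_normal_deriv_add has_normal_deriv_cmult d has_normal_deriv_ln_norm has_normal_deriv_quadratic)
    then have "d - \<eta> \<ge> 0" using has_normal_deriv_nonneg_at_local_max[OF _ ev] by fastforce
    then show False using d eta by simp
  qed
qed

text \<open>The barrier has a pole at 0, so \<open>barrier_annulus\<close> first gives only w \<le>
  max 0 (w 0) away from the endpoints, continuity bounding w on a small arc around 0. If w 0 were
  positive, 0 would be a boundary maximum on the Robin part, where the normal derivative - \<mu> w 0
  is negative. The endpoints follow by continuity along vertical lines.\<close>

theorem robin_maximum_principle:
  fixes w :: "real \<times> real \<Rightarrow> real"
  assumes cont: "continuous_on (closure upper_half_plane) w"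
    and lap: "\<And>y. y \<in> upper_half_plane \<Longrightarrow> laplacian_at w y 0"
    and outer: "\<And>x. \<bar>x\<bar> > 1 \<Longrightarrow> has_normal_deriv w 0 x"
    and inner: "\<And>x. \<bar>x\<bar> < 1 \<Longrightarrow> \<exists>d. has_normal_deriv w d x \<and> d + \<mu> * w (x, 0) = 0"
    and mu: "\<mu> > 0"
    and bdd: "\<forall>\<^sub>F y in at_infinity_half_plane. w y \<le> B"
    and y: "y \<in> closure upper_half_plane"
  shows "w y \<le> 0"
proof -
  obtain b where b: "\<And>y. y \<in> closure upper_half_plane \<Longrightarrow> norm y \<ge> b \<Longrightarrow> w y \<le> B"
    using bdd unfolding at_infinity_half_plane_def eventually_inf_principal eventually_at_infinity by auto
  have "compact (closure upper_half_plane \<inter> cball 0 b)" by (intro closed_Int_compact) auto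
  then have "compact (w ` (closure upper_half_plane \<inter> cball 0 b))"
    by (rule compact_continuous_image[rotated]) (rule continuous_on_subset[OF cont], auto)
  then obtain B1 where B1: "\<And>y. y \<in> closure upper_half_plane \<Longrightarrow> norm y \<le> b \<Longrightarrow> \<bar>w y\<bar> \<le> B1"
    using compact_imp_bounded bounded_iff by (metis IntI image_eqI mem_cball_0 real_norm_def)
  have Bd: "w y \<le> max B B1" if "y \<in> closure upper_half_plane" for y
    using b[OF that] B1[OF that] by linarith
  have main: "w y \<le> max 0 (w 0)" if y: "y \<in> closure upper_half_plane" "y \<noteq> (1,0)" "y \<noteq> (-1,0)" for y
  proof (rule ccontr)
    assume neg: "\<not> w y \<le> max 0 (w 0)"
    define m where "m = (max 0 (w 0) + w y) / 2"
    have m: "m > max 0 (w 0)" "m < w y" using neg by (auto simp: m_def field_simps)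
    have "0 \<in> closure upper_half_plane" by (simp add: closure_upper_half_plane)
    then obtain d where d: "d > 0" "\<And>u. u \<in> closure upper_half_plane \<Longrightarrow> dist u 0 < d \<Longrightarrow> dist (w u) (w 0) < m - w 0"
      using cont m unfolding continuous_on_iff by (metis diff_gt_0_iff_gt max_less_iff_conj)
    have y0: "norm y > 0" using m by auto
    define r where "r = min (min (1/2) (d/2)) (norm y)"
    have r: "0 < r" "r < 1" "r < d" "r \<le> norm y" using y0 d(1) by (auto simp: r_def)
    have "w y \<le> m"
    proof (rule barrier_annulus[OF cont lap outer inner mu Bd r(1,2)])
      show "m \<ge> 0" using m by simp
      fix u assume "u \<in> closure upper_half_plane" "norm u = r"
      then show "w u \<le> m" using d(2)[of u] r by (auto simp: dist_real_def)
    qed (use y r in auto)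
    then show False using m by simp
  qed
  have w0: "w 0 \<le> 0"
  proof (rule ccontr)
    assume neg: "\<not> w 0 \<le> 0"
    obtain d where d: "has_normal_deriv w d 0" "d + \<mu> * w (0, 0) = 0" using inner[of 0] by auto
    have "\<forall>\<^sub>F t in at_right (0::real). t > 0" by (simp add: eventually_at_right_less)
    then have "\<forall>\<^sub>F t in at_right 0. w (0, t) \<le> w (0, 0)"
    proof eventually_elim
      case (elim t)
      then show ?case using main[of "(0,t)"] neg by (auto simp: closure_upper_half_plane zero_prod_def)
    qed
    then have "d \<ge> 0" using has_normal_deriv_nonneg_at_local_max d(1) by blast
    moreover have "\<mu> * w (0, 0) > 0" using neg mu by (simp add: zero_prod_def)
    ultimately show False using d by simp
  qed
  have end_pt: "w (e, 0) \<le> 0" if e: "e = 1 \<or> e = -1" for e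
  proof -
    have "((\<lambda>t. w (e, t)) \<longlongrightarrow> w (e, 0)) (at 0 within {0..})"
    proof -
      have "continuous_on {0..} (\<lambda>t. w (e, t))"
        by (rule continuous_on_compose2[OF cont, of _ "\<lambda>t. (e, t)"])
          (auto intro!: continuous_on_Pair continuous_on_const continuous_on_id simp: closure_upper_half_plane)
      then show ?thesis by (simp add: continuous_on_def)
    qed
    then have "((\<lambda>t. w (e, t)) \<longlongrightarrow> w (e, 0)) (at_right 0)"
      by (rule filterlim_mono) (auto intro: at_le)
    moreover have "\<forall>\<^sub>F t in at_right (0::real). t > 0" by (simp add: eventually_at_right_less)
    then have "\<forall>\<^sub>F t in at_right (0::real). w (e, t) \<le> 0"
    proof eventually_elim
      case (elim t)
      then show ?case using main[of "(e,t)"] w0 by (auto simp: closure_upper_half_plane)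
    qed
    ultimately show ?thesis by (rule tendsto_upperbound) simp
  qed
  show ?thesis using main[OF y] end_pt w0 by (cases "y = (1,0) \<or> y = (-1,0)") auto
qed

section \<open>The logarithmic kernel on the segment\<close>

text \<open>The a priori bound makes the solution operator at every solvable l0 Lipschitz with one
  and the same constant. Hence contraction extends solvability by a step d independent of l0, and
  finitely many steps lead from the trivial case l = 0 to any l up to L.\<close>

lemma continuity_method:
  fixes T :: "'a::{real_normed_vector,complete_space} \<Rightarrow> 'a"
  assumes T: "bounded_linear T"
    and ap: "\<And>l x. 0 \<le> l \<Longrightarrow> l \<le> L \<Longrightarrow> norm x \<le> B * norm (x + l *\<^sub>R T x)"
    and l: "0 \<le> l" "l \<le> L"
  shows "\<exists>x. x + l *\<^sub>R T x = f"
proof -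
  interpret bounded_linear T by (fact T)
  obtain K where K: "K > 0" "\<And>x. norm (T x) \<le> norm x * K" using pos_bounded by blast
  define C where "C = max B 1"
  have C: "C > 0" by (simp add: C_def)
  have apC: "norm x \<le> C * norm (x + l *\<^sub>R T x)" if "0 \<le> l" "l \<le> L" for l x
  proof -
    have "B * norm (x + l *\<^sub>R T x) \<le> C * norm (x + l *\<^sub>R T x)"
      by (intro mult_right_mono) (auto simp: C_def)
    then show ?thesis using ap[OF that, of x] by linarith
  qed
  \<comment> \<open>Moving l by at most d perturbs by at most d K in operator norm, which the
    Lipschitz constant C of the solution operator turns into the contraction factor 1 / 2.\<close>
  define d where "d = 1 / (2 * C * K)"
  have d: "d > 0" using C K by (simp add: d_def)
  have dCK: "d * C * K = 1 / 2" using C K by (simp add: d_def)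
  have step: "\<exists>x. x + l *\<^sub>R T x = f"
    if l0: "0 \<le> l0" "l0 \<le> l" "l \<le> L" "l - l0 \<le> d" and solv: "\<And>f. \<exists>x. x + l0 *\<^sub>R T x = f" for l0 l f
  proof -
    obtain R where R: "\<And>f. R f + l0 *\<^sub>R T (R f) = f" using solv by metis
    have Rlip: "norm (R f - R g) \<le> C * norm (f - g)" for f g
    proof -
      have "(R f - R g) + l0 *\<^sub>R T (R f - R g) = (R f + l0 *\<^sub>R T (R f)) - (R g + l0 *\<^sub>R T (R g))"
        by (simp add: diff scaleR_diff_right)
      then show ?thesis using apC[of l0 "R f - R g"] l0 R by simp
    qed
    \<comment> \<open>The equation at l, read as the equation at l0 with
      \<open>(l - l0) *\<^sub>R T x\<close> moved to the right-hand side.\<close>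
    define \<Phi> where "\<Phi> x = R (f - (l - l0) *\<^sub>R T x)" for x
    have "\<exists>!x. \<Phi> x = x"
    proof (rule banach_fix_type)
      show "\<forall>x y. dist (\<Phi> x) (\<Phi> y) \<le> 1/2 * dist x y"
      proof (intro allI)
        fix x y
        have "dist (\<Phi> x) (\<Phi> y) \<le> C * norm ((f - (l - l0) *\<^sub>R T x) - (f - (l - l0) *\<^sub>R T y))"
          unfolding \<Phi>_def dist_norm by (rule Rlip)
        also have "(f - (l - l0) *\<^sub>R T x) - (f - (l - l0) *\<^sub>R T y) = (l - l0) *\<^sub>R T (y - x)"
          by (simp add: diff scaleR_diff_right)
        also have "C * norm \<dots> \<le> C * (d * (norm (y - x) * K))"
          using l0 K C d by (auto intro!: mult_left_mono mult_mono)
        also have "\<dots> = (d * C * K) * dist x y" by (simp add: dist_norm norm_minus_commute)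
        finally show "dist (\<Phi> x) (\<Phi> y) \<le> 1/2 * dist x y" by (simp add: dCK)
      qed
    qed auto
    then obtain x where x: "R (f - (l - l0) *\<^sub>R T x) = x" by (auto simp: \<Phi>_def)
    have "x + l0 *\<^sub>R T x = f - (l - l0) *\<^sub>R T x" using R[of "f - (l - l0) *\<^sub>R T x"] x by simp
    then have "x + l *\<^sub>R T x = f" by (simp add: algebra_simps)
    then show ?thesis by blast
  qed
  have "\<forall>l f. 0 \<le> l \<longrightarrow> l \<le> L \<longrightarrow> l \<le> real n * d \<longrightarrow> (\<exists>x. x + l *\<^sub>R T x = f)" for n
  proof (induction n)
    case 0
    then show ?case by (auto simp: order_antisym)
  next
    case (Suc n)
    show ?case
    proof (intro allI impI)
      fix l f assume l: "0 \<le> l" "l \<le> L" "l \<le> real (Suc n) * d"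
      show "\<exists>x. x + l *\<^sub>R T x = f"
        by (rule step[of "max 0 (l - d)"]) (use l d Suc.IH in \<open>auto simp: algebra_simps\<close>)
    qed
  qed
  moreover obtain n :: nat where "l \<le> real n * d" using d by (metis reals_Archimedean3 less_imp_le)
  ultimately show ?thesis using l by blast
qed

section \<open>Lebesgue measure on the segment\<close>

definition seg :: "real measure" where
  "seg = density lborel (indicator {-1..1})"

lemma sets_seg [measurable_cong, simp]: "sets seg = sets borel" and space_seg [simp]: "space seg = UNIV"
  by (simp_all add: seg_def)

lemma emeasure_seg_UNIV: "emeasure seg UNIV = 2"
  by (simp add: seg_def emeasure_density)

lemma measure_seg_UNIV [simp]: "measure seg UNIV = 2"
  by (simp add: measure_def emeasure_seg_UNIV)

interpretation seg: finite_measure seg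
  by standard (simp add: emeasure_seg_UNIV)

lemma AE_seg: "AE s in seg. -1 \<le> s \<and> s \<le> 1"
  unfolding seg_def by (subst AE_density) (auto simp: indicator_def)

lemma AE_seg_neq: "AE s in seg. s \<noteq> x"
  unfolding seg_def by (subst AE_density) (auto intro: AE_mp[OF AE_lborel_singleton[of x]])

lemma nn_integral_seg:
  assumes [measurable]: "f \<in> borel_measurable borel"
  shows "(\<integral>\<^sup>+ s. f s \<partial>seg) = (\<integral>\<^sup>+ s. f s * indicator {-1..1} s \<partial>lborel)"
  unfolding seg_def by (subst nn_integral_density) (auto simp: mult.commute)

lemma nn_integral_seg_le:
  assumes [measurable]: "f \<in> borel_measurable borel"
  shows "(\<integral>\<^sup>+ s. f s \<partial>seg) \<le> (\<integral>\<^sup>+ s. f s \<partial>lborel)"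
  unfolding nn_integral_seg[OF assms] by (intro nn_integral_mono) (auto simp: indicator_def)

lemma integrable_seg_bounded:
  fixes f :: "real \<Rightarrow> real"
  assumes "f \<in> borel_measurable borel" "\<And>s. s \<in> {-1..1} \<Longrightarrow> \<bar>f s\<bar> \<le> B"
  shows "integrable seg f"
  by (rule seg.integrable_const_bound[of _ B]) (use assms AE_seg in \<open>auto elim: eventually_mono\<close>)

lemma integral_seg_continuous:
  fixes f :: "real \<Rightarrow> real"
  assumes m: "f \<in> borel_measurable borel" and c: "continuous_on {-1..1} f"
  shows "integrable seg f" "(\<integral>s. f s \<partial>seg) = integral {-1..1} f"
proof -
  have "compact (f ` {-1..1})" using c by (intro compact_continuous_image) auto
  then obtain B where "\<And>s. s \<in> {-1..1} \<Longrightarrow> \<bar>f s\<bar> \<le> B"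
    using compact_imp_bounded bounded_iff by (metis image_eqI real_norm_def)
  then show "integrable seg f" by (rule integrable_seg_bounded[OF m])
  have "(\<integral>s. f s \<partial>seg) = (\<integral>s. indicator {-1..1} s *\<^sub>R f s \<partial>lborel)"
    unfolding seg_def using integral_density[of f lborel "indicator {-1..1}"] m by (simp add: ennreal_indicator)
  also have "\<dots> = integral {-1..1} f"
    using set_borel_integral_eq_integral(2)[OF borel_integrable_atLeastAtMost'[OF c]]
    by (simp add: set_lebesgue_integral_def)
  finally show "(\<integral>s. f s \<partial>seg) = integral {-1..1} f" .
qed

lemma abs_integral_le_integral_norm:
  fixes f :: "'a \<Rightarrow> real"
  shows "\<bar>\<integral>s. f s \<partial>M\<bar> \<le> (\<integral>s. norm (f s) \<partial>M)"
  using integral_norm_bound[of M f] by simp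

text \<open>The excess of - ln \<bar>t\<bar> over its truncation at scale e. The value at 0 is set
  separately because \<open>ln 0\<close> = 0 would give ln e there, which is negative for e <
  1.\<close>

definition log_cut :: "real \<Rightarrow> real \<Rightarrow> real" where
  "log_cut e t = (if t \<noteq> 0 \<and> \<bar>t\<bar> \<le> e then ln e - ln \<bar>t\<bar> else 0)"

lemma log_cut_measurable [measurable]: "log_cut e \<in> borel_measurable borel"
  unfolding log_cut_def[abs_def] by measurable

lemma log_cut_nonneg: "log_cut e t \<ge> 0"
  by (auto simp: log_cut_def)

lemma tendsto_mult_ln_abs_0: "((\<lambda>t::real. t * ln \<bar>t\<bar>) \<longlongrightarrow> 0) (at 0)"
  by real_asymp

text \<open>The antiderivative F is continuous across the singularity, so the fundamental theorem of
  calculus applies with 0 as an exceptional point. That the mass tends to 0 with e, independently of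
  x, makes the truncations below uniform.\<close>

lemma nn_integral_log_cut:
  assumes e: "e > 0"
  shows "(\<integral>\<^sup>+ s. ennreal (log_cut e (s - x)) \<partial>lborel) = ennreal (2 * e)"
proof -
  define F where "F t = t * ln e - (t * ln \<bar>t\<bar> - t)" for t :: real
  have cont: "isCont (\<lambda>t::real. t * ln \<bar>t\<bar>) t" for t
  proof (cases "t = 0")
    case True
    then show ?thesis using tendsto_mult_ln_abs_0 by (simp add: isCont_def)
  next
    case False
    then show ?thesis by (intro continuous_intros) auto
  qed
  have "(log_cut e has_integral (F e - F (- e))) {-e..e}"
  proof (rule fundamental_theorem_of_calculus_interior_strong[of "{0}"])
    show "continuous_on {- e..e} F" unfolding F_def
      by (intro continuous_intros continuous_at_imp_continuous_on ballI cont)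
    fix t assume t: "t \<in> {- e<..<e} - {0}"
    have "((\<lambda>t. ln \<bar>t\<bar>) has_real_derivative 1 / t) (at t)"
    proof (cases "t > 0")
      case True
      show ?thesis
        by (rule has_field_derivative_transform_within_open[of ln _ _ "{0<..}"])
           (use True in \<open>auto intro!: derivative_eq_intros\<close>)
    next
      case False
      show ?thesis
        by (rule has_field_derivative_transform_within_open[of "\<lambda>t. ln (- t)" _ _ "{..<0}"])
           (use False t in \<open>auto intro!: derivative_eq_intros\<close>)
    qed
    moreover have "((\<lambda>t. t * c - (t * g t - t)) has_real_derivative c - g t) (at t)"
      if "(g has_real_derivative 1 / t) (at t)" for g c
      using that t by (auto intro!: derivative_eq_intros)
    ultimately have "(F has_real_derivative ln e - ln \<bar>t\<bar>) (at t)" unfolding F_def by blast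
    moreover have "ln e - ln \<bar>t\<bar> = log_cut e t" using t by (auto simp: log_cut_def)
    ultimately have "(F has_real_derivative log_cut e t) (at t)" by simp
    then show "(F has_vector_derivative log_cut e t) (at t)"
      by (simp add: has_real_derivative_iff_has_vector_derivative)
  qed (use e in auto)
  moreover have "F e - F (- e) = 2 * e" using e by (simp add: F_def)
  ultimately have "(log_cut e has_integral 2 * e) {-e..e}" by simp
  then have "(\<integral>\<^sup>+ s. ennreal (log_cut e s) * indicator {-e..e} s \<partial>lborel) = ennreal (2 * e)"
    by (rule nn_integral_has_integral_lebesgue'[rotated]) (rule log_cut_nonneg)
  moreover have "ennreal (log_cut e s) * indicator {-e..e} s = ennreal (log_cut e s)" for s
    by (auto simp: indicator_def log_cut_def)
  ultimately have "(\<integral>\<^sup>+ s. ennreal (log_cut e s) \<partial>lborel) = ennreal (2 * e)" by simp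
  then show ?thesis
    using nn_integral_real_affine[of "\<lambda>s. ennreal (log_cut e s)" 1 "- x"] by simp
qed

lemma log_cut_seg:
  assumes e: "e > 0"
  shows "integrable seg (\<lambda>s. log_cut e (s - x))" "(\<integral>s. log_cut e (s - x) \<partial>seg) \<le> 2 * e"
proof -
  have le: "(\<integral>\<^sup>+ s. ennreal (log_cut e (s - x)) \<partial>seg) \<le> ennreal (2 * e)"
    using nn_integral_seg_le[of "\<lambda>s. ennreal (log_cut e (s - x))"] nn_integral_log_cut[OF e, of x] by simp
  then show int: "integrable seg (\<lambda>s. log_cut e (s - x))"
    by (intro integrableI_nonneg) (auto simp: log_cut_nonneg le_less_trans)
  show "(\<integral>s. log_cut e (s - x) \<partial>seg) \<le> 2 * e"
    using le nn_integral_eq_integral[OF int] e log_cut_nonneg by simp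
qed

text \<open>The distance from y to (s, 0) is at least its horizontal part, so the truncation error
  is controlled through \<open>fst y\<close> alone, uniformly up to the boundary line.\<close>

lemma ln_max_diff_le_log_cut:
  fixes y :: "real \<times> real"
  assumes e: "e > 0" and s: "s \<noteq> fst y"
  shows "\<bar>ln (norm (y - (s, 0))) - ln (max e (norm (y - (s, 0))))\<bar> \<le> log_cut e (s - fst y)"
proof -
  let ?r = "norm (y - (s, 0))"
  have "\<bar>s - fst y\<bar> \<le> ?r" using norm_fst_le[of "fst y - s" "snd y"] by (cases y) auto
  moreover have "\<bar>s - fst y\<bar> > 0" using s by simp
  ultimately have "?r < e \<Longrightarrow> ln ?r \<ge> ln \<bar>s - fst y\<bar>" "?r < e \<Longrightarrow> \<bar>s - fst y\<bar> \<le> e" "?r > 0"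
    by (auto intro!: ln_mono)
  then show ?thesis
    using s log_cut_nonneg[of e "s - fst y"] e
    by (cases "?r < e") (auto simp: log_cut_def max_def)
qed

section \<open>Logarithmic potentials and the integral operator\<close>

definition log_potential :: "(real \<Rightarrow> real) \<Rightarrow> real \<times> real \<Rightarrow> real" where
  "log_potential f y = (\<integral>s. ln (norm (y - (s, 0))) * f s \<partial>seg)"

text \<open>Truncating the kernel at scale e leaves a continuous integrand, and what is removed is
  dominated by M times \<open>log_cut e\<close>, of mass at most 2 e.\<close>

lemma integrable_log_potential:
  assumes f: "continuous_on UNIV f" "\<And>s. \<bar>f s\<bar> \<le> M"
  shows "integrable seg (\<lambda>s. ln (norm (y - (s, 0))) * f s)"
    and "e > 0 \<Longrightarrow> integrable seg (\<lambda>s. ln (max e (norm (y - (s, 0)))) * f s)"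
    and "e > 0 \<Longrightarrow> \<bar>log_potential f y - (\<integral>s. ln (max e (norm (y - (s, 0)))) * f s \<partial>seg)\<bar> \<le> 2 * e * M"
proof -
  have [measurable]: "f \<in> borel_measurable borel" using f(1) by (rule borel_measurable_continuous_onI)
  have [measurable]: "(\<lambda>s. norm (y - (s, 0))) \<in> borel_measurable borel"
    by (intro borel_measurable_continuous_onI continuous_intros)
  have M: "M \<ge> 0" using f(2)[of 0] by linarith
  have mx: "max e u \<noteq> 0" if "e > 0" for e u :: real using that by linarith
  have I2: "integrable seg (\<lambda>s. ln (max e (norm (y - (s, 0)))) * f s)" if e: "e > 0" for e
    by (rule integral_seg_continuous(1))
       (auto intro!: continuous_intros continuous_on_max continuous_on_subset[OF f(1)] simp: mx[OF e])
  have bd: "AE s in seg. norm (ln (norm (y - (s, 0))) * f s - ln (max e (norm (y - (s, 0)))) * f s)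
      \<le> log_cut e (s - fst y) * M" if e: "e > 0" for e
    using AE_seg_neq[of "fst y"]
  proof eventually_elim
    case (elim s)
    have "norm (ln (norm (y - (s, 0))) * f s - ln (max e (norm (y - (s, 0)))) * f s)
        = \<bar>ln (norm (y - (s, 0))) - ln (max e (norm (y - (s, 0))))\<bar> * \<bar>f s\<bar>"
      by (simp add: abs_mult flip: left_diff_distrib)
    also have "\<dots> \<le> log_cut e (s - fst y) * M"
      using ln_max_diff_le_log_cut[OF e elim] f(2)[of s] log_cut_nonneg M by (intro mult_mono) auto
    finally show ?case .
  qed
  have I3: "integrable seg (\<lambda>s. ln (norm (y - (s, 0))) * f s - ln (max e (norm (y - (s, 0)))) * f s)"
    if e: "e > 0" for e
  proof (rule Bochner_Integration.integrable_bound)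
    show "integrable seg (\<lambda>s. log_cut e (s - fst y) * M)" using log_cut_seg(1)[OF e] by simp
    show "AE s in seg. norm (ln (norm (y - (s, 0))) * f s - ln (max e (norm (y - (s, 0)))) * f s)
      \<le> norm (log_cut e (s - fst y) * M)"
      using bd[OF e] by eventually_elim (use log_cut_nonneg M in auto)
  qed measurable
  show I1: "integrable seg (\<lambda>s. ln (norm (y - (s, 0))) * f s)"
    using Bochner_Integration.integrable_add[OF I3[of 1] I2[of 1]] by simp
  show "integrable seg (\<lambda>s. ln (max e (norm (y - (s, 0)))) * f s)" if "e > 0" using I2 that .
  show "\<bar>log_potential f y - (\<integral>s. ln (max e (norm (y - (s, 0)))) * f s \<partial>seg)\<bar> \<le> 2 * e * M" if e: "e > 0"
  proof -
    have "log_potential f y - (\<integral>s. ln (max e (norm (y - (s, 0)))) * f s \<partial>seg) =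
        (\<integral>s. ln (norm (y - (s, 0))) * f s - ln (max e (norm (y - (s, 0)))) * f s \<partial>seg)"
      unfolding log_potential_def by (rule Bochner_Integration.integral_diff[symmetric]) (use I1 I2 e in auto)
    also have "\<bar>\<dots>\<bar> \<le> (\<integral>s. norm (ln (norm (y - (s, 0))) * f s - ln (max e (norm (y - (s, 0)))) * f s) \<partial>seg)"
      by (rule abs_integral_le_integral_norm)
    also have "\<dots> \<le> (\<integral>s. log_cut e (s - fst y) * M \<partial>seg)"
      by (rule integral_mono_AE) (use I3[OF e] log_cut_seg(1)[OF e] bd[OF e] in auto)
    also have "\<dots> \<le> 2 * e * M" using log_cut_seg(2)[OF e, of "fst y"] M by (simp add: mult_right_mono)
    finally show ?thesis .
  qed
qed

text \<open>With the kernel truncated at 1 / (n + 1) the potential is a continuous parameter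
  integral. The truncation error does not depend on y, so the convergence is uniform.\<close>

lemma continuous_log_potential:
  assumes f: "continuous_on UNIV f" "\<And>s. \<bar>f s\<bar> \<le> M"
  shows "continuous_on UNIV (log_potential f)"
proof -
  define e where "e n = 1 / (real n + 1)" for n
  have e: "e n > 0" for n by (simp add: e_def)
  have mx: "max (e n) u \<noteq> 0" for n u using e[of n] by linarith
  let ?V = "\<lambda>n (y::real\<times>real). \<integral>s. ln (max (e n) (norm (y - (s, 0)))) * f s \<partial>seg"
  have V: "?V n y = integral (cbox (-1) 1) (\<lambda>s. ln (max (e n) (norm (y - (s, 0)))) * f s)" for n y
  proof -
    have "continuous_on UNIV (\<lambda>s. ln (max (e n) (norm (y - (s, 0)))) * f s)"
      using e[of n] by (intro continuous_intros continuous_on_max f(1)) (auto simp: mx)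
    then show ?thesis
      by (subst integral_seg_continuous(2)) (auto intro!: borel_measurable_continuous_onI elim: continuous_on_subset)
  qed
  have c: "continuous_on UNIV (?V n)" for n
  proof -
    have "continuous_on UNIV (\<lambda>(y::real\<times>real, s). ln (max (e n) (norm (y - (s, 0)))) * f s)"
      unfolding case_prod_unfold using e[of n]
      by (intro continuous_intros continuous_on_max continuous_on_compose2[OF f(1)])
         (auto simp: mx)
    then have "continuous_on (UNIV \<times> cbox (-1) 1) (\<lambda>(y::real\<times>real, s). ln (max (e n) (norm (y - (s, 0)))) * f s)"
      by (rule continuous_on_subset) simp
    then show ?thesis unfolding V by (rule integral_continuous_on_param)
  qed
  have lim: "(\<lambda>n. 2 * e n * M) \<longlonglongrightarrow> 0" unfolding e_def by real_asymp
  have "uniform_limit UNIV ?V (log_potential f) sequentially"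
  proof (rule uniform_limitI)
    fix d :: real assume d: "d > 0"
    from order_tendstoD(2)[OF lim d] show "\<forall>\<^sub>F n in sequentially. \<forall>y\<in>UNIV. dist (?V n y) (log_potential f y) < d"
    proof eventually_elim
      case (elim n)
      show ?case
      proof
        fix y :: "real \<times> real"
        show "dist (?V n y) (log_potential f y) < d"
          using integrable_log_potential(3)[OF f e[of n], of y] elim
          unfolding dist_real_def abs_minus_commute[of "?V n y"] by linarith
      qed
    qed
  qed
  then show ?thesis by (rule uniform_limit_theorem[rotated]) (auto simp: c)
qed

text \<open>The summand ln 2 makes the kernel nonnegative on the segment, whose diameter is
  2.\<close>

definition log_op :: "(real \<Rightarrow> real) \<Rightarrow> real \<Rightarrow> real" where
  "log_op f x = (\<integral>s. (ln 2 - ln \<bar>x - s\<bar>) * f s \<partial>seg)"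

lemma norm_diff_real_axis: "norm ((x, 0::real) - (s, 0::real)) = \<bar>x - s\<bar>" for x s :: real
  by (simp add: norm_Pair)

lemma log_kernel_bounds:
  fixes x s :: real
  assumes "x \<in> {-1..1}" "s \<in> {-1..1}" "s \<noteq> x" 
  shows "0 \<le> ln 2 - ln \<bar>x - s\<bar>"
    and "0 < e \<Longrightarrow> e \<le> 1 \<Longrightarrow> ln 2 - ln \<bar>x - s\<bar> \<le> (ln 2 - ln e) + log_cut e (s - x)"
proof -
  have "ln \<bar>x - s\<bar> \<le> ln 2" using assms by (intro ln_mono) auto
  then show "0 \<le> ln 2 - ln \<bar>x - s\<bar>" by simp
  assume e: "0 < e" "e \<le> 1"
  show "ln 2 - ln \<bar>x - s\<bar> \<le> (ln 2 - ln e) + log_cut e (s - x)"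
  proof (cases "\<bar>s - x\<bar> \<le> e")
    case True
    then show ?thesis using assms by (auto simp: log_cut_def abs_minus_commute)
  next
    case False
    then have "ln e \<le> ln \<bar>x - s\<bar>" using e assms by (intro ln_mono) auto
    then show ?thesis using log_cut_nonneg[of e "s - x"] by simp
  qed
qed

lemma log_op:
  assumes f: "continuous_on UNIV f" "\<And>s. \<bar>f s\<bar> \<le> M"
  shows integrable_log_op: "integrable seg (\<lambda>s. (ln 2 - ln \<bar>x - s\<bar>) * f s)"
    and log_op_eq: "log_op f x = ln 2 * (\<integral>s. f s \<partial>seg) - log_potential f (x, 0)"
    and continuous_log_op: "continuous_on UNIV (log_op f)"
proof -
  have [measurable]: "f \<in> borel_measurable borel" using f(1) by (rule borel_measurable_continuous_onI)
  have If: "integrable seg f" using f(2) by (intro integrable_seg_bounded) auto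
  have I1: "integrable seg (\<lambda>s. ln \<bar>x - s\<bar> * f s)" for x
    using integrable_log_potential(1)[OF f, of "(x,0)"] unfolding norm_diff_real_axis .
  show "integrable seg (\<lambda>s. (ln 2 - ln \<bar>x - s\<bar>) * f s)"
    using If I1 by (simp add: left_diff_distrib)
  have eq: "log_op f x = ln 2 * (\<integral>s. f s \<partial>seg) - log_potential f (x, 0)" for x
    using If I1 by (simp add: log_op_def log_potential_def left_diff_distrib norm_diff_real_axis)
  show "log_op f x = ln 2 * (\<integral>s. f s \<partial>seg) - log_potential f (x, 0)" by (fact eq)
  show "continuous_on UNIV (log_op f)"
    unfolding eq by (intro continuous_intros continuous_on_compose2[OF continuous_log_potential[OF f]]) auto
qed

text \<open>The kernel is at most the constant ln 2 - ln e plus \<open>log_cut e\<close>. The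
  constant meets the L1 norm of f, the singular part its sup norm M, with a factor 2 e that can be
  made small at the expense of the constant.\<close>

lemma log_op_abs_le:
  assumes f: "continuous_on UNIV f" "\<And>s. \<bar>f s\<bar> \<le> M" and x: "x \<in> {-1..1}" and e: "0 < e" "e \<le> 1"
  shows "\<bar>log_op f x\<bar> \<le> (ln 2 - ln e) * (\<integral>s. \<bar>f s\<bar> \<partial>seg) + 2 * e * M"
proof -
  have M: "M \<ge> 0" using f(2)[of 0] by linarith
  have [measurable]: "f \<in> borel_measurable borel" using f(1) by (rule borel_measurable_continuous_onI)
  have If: "integrable seg (\<lambda>s. \<bar>f s\<bar>)" using f(2) by (intro integrable_seg_bounded) auto
  have "\<bar>log_op f x\<bar> \<le> (\<integral>s. norm ((ln 2 - ln \<bar>x - s\<bar>) * f s) \<partial>seg)"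
    unfolding log_op_def by (rule abs_integral_le_integral_norm)
  also have "\<dots> \<le> (\<integral>s. (ln 2 - ln e) * \<bar>f s\<bar> + log_cut e (s - x) * M \<partial>seg)"
  proof (rule integral_mono_AE)
    show "integrable seg (\<lambda>s. norm ((ln 2 - ln \<bar>x - s\<bar>) * f s))"
      using integrable_log_op[OF f] by (rule integrable_norm)
    show "integrable seg (\<lambda>s. (ln 2 - ln e) * \<bar>f s\<bar> + log_cut e (s - x) * M)"
      using If log_cut_seg(1)[OF e(1)] by simp
    show "AE s in seg. norm ((ln 2 - ln \<bar>x - s\<bar>) * f s) \<le> (ln 2 - ln e) * \<bar>f s\<bar> + log_cut e (s - x) * M"
      using AE_seg AE_seg_neq[of x]
    proof eventually_elim
      case (elim s)
      then have k: "0 \<le> ln 2 - ln \<bar>x - s\<bar>" "ln 2 - ln \<bar>x - s\<bar> \<le> (ln 2 - ln e) + log_cut e (s - x)"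
        using log_kernel_bounds(1)[of x s] log_kernel_bounds(2)[of x s e] x e by auto
      have "norm ((ln 2 - ln \<bar>x - s\<bar>) * f s) = (ln 2 - ln \<bar>x - s\<bar>) * \<bar>f s\<bar>"
        using k by (simp add: abs_mult)
      also have "\<dots> \<le> ((ln 2 - ln e) + log_cut e (s - x)) * \<bar>f s\<bar>" using k by (intro mult_right_mono) auto
      also have "\<dots> \<le> (ln 2 - ln e) * \<bar>f s\<bar> + log_cut e (s - x) * M"
        using f(2)[of s] log_cut_nonneg[of e "s - x"] by (simp add: distrib_right mult_left_mono)
      finally show ?case .
    qed
  qed
  also have "\<dots> = (ln 2 - ln e) * (\<integral>s. \<bar>f s\<bar> \<partial>seg) + (\<integral>s. log_cut e (s - x) \<partial>seg) * M"
    using If log_cut_seg(1)[OF e(1)] by simp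
  also have "\<dots> \<le> (ln 2 - ln e) * (\<integral>s. \<bar>f s\<bar> \<partial>seg) + 2 * e * M"
    using log_cut_seg(2)[OF e(1), of x] M by (simp add: mult_right_mono)
  finally show ?thesis .
qed

section \<open>Positive definiteness of the logarithmic kernel\<close>

interpretation seg_pair: pair_sigma_finite seg seg ..

section \<open>Bounded continuous densities, Fubini and symmetry\<close>

definition bounded_cont :: "(real \<Rightarrow> real) \<Rightarrow> bool" where
  "bounded_cont f \<longleftrightarrow> continuous_on UNIV f \<and> bounded (range f)"

lemma bounded_contD:
  assumes "bounded_cont f"
  shows "continuous_on UNIV f" and "\<exists>M. \<forall>s. \<bar>f s\<bar> \<le> M"
  using assms unfolding bounded_cont_def bounded_iff by auto

lemma bounded_contI: "continuous_on UNIV f \<Longrightarrow> (\<And>s. \<bar>f s\<bar> \<le> M) \<Longrightarrow> bounded_cont f"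
  unfolding bounded_cont_def bounded_iff by auto

lemma bounded_cont_const [simp]: "bounded_cont (\<lambda>_. c)"
  by (rule bounded_contI[of _ "\<bar>c\<bar>"]) auto

lemma bounded_cont_add:
  assumes "bounded_cont f" "bounded_cont g"
  shows "bounded_cont (\<lambda>x. f x + g x)"
proof -
  obtain M where f: "continuous_on UNIV f" "\<And>s. \<bar>f s\<bar> \<le> M" using bounded_contD[OF assms(1)] by blast
  obtain N where g: "continuous_on UNIV g" "\<And>s. \<bar>g s\<bar> \<le> N" using bounded_contD[OF assms(2)] by blast
  have "\<bar>f s + g s\<bar> \<le> M + N" for s using f(2)[of s] g(2)[of s] by linarith
  then show ?thesis by (intro bounded_contI[of _ "M + N"] continuous_intros f(1) g(1))
qed

lemma bounded_cont_mult:
  assumes "bounded_cont f" "bounded_cont g"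
  shows "bounded_cont (\<lambda>x. f x * g x)"
proof -
  obtain M where f: "continuous_on UNIV f" "\<And>s. \<bar>f s\<bar> \<le> M" using bounded_contD[OF assms(1)] by blast
  obtain N where g: "continuous_on UNIV g" "\<And>s. \<bar>g s\<bar> \<le> N" using bounded_contD[OF assms(2)] by blast
  have "\<bar>f s * g s\<bar> \<le> M * N" for s using f(2)[of s] g(2)[of s] unfolding abs_mult by (intro mult_mono) auto
  then show ?thesis by (intro bounded_contI[of _ "M * N"] continuous_intros f(1) g(1))
qed

lemma bounded_cont_cmult: "bounded_cont f \<Longrightarrow> bounded_cont (\<lambda>x. c * f x)"
  by (rule bounded_cont_mult) auto

lemma bounded_cont_diff: "bounded_cont f \<Longrightarrow> bounded_cont g \<Longrightarrow> bounded_cont (\<lambda>x. f x - g x)"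
  using bounded_cont_add[of f "\<lambda>x. (-1) * g x"] bounded_cont_cmult[of g "-1"] by simp

lemma bounded_cont_abs: "bounded_cont f \<Longrightarrow> bounded_cont (\<lambda>x. \<bar>f x\<bar>)"
  using bounded_contD[of f] by (auto intro!: bounded_contI continuous_intros)

lemma bounded_cont_measurable [measurable_dest]: "bounded_cont f \<Longrightarrow> f \<in> borel_measurable borel"
  by (auto simp: bounded_cont_def intro: borel_measurable_continuous_onI)

lemma bounded_cont_integrable: "bounded_cont f \<Longrightarrow> integrable seg f"
  using bounded_contD[of f] by (auto intro!: integrable_seg_bounded borel_measurable_continuous_onI)

text \<open>As the kernel is nonnegative on the segment, the inner integral of the absolute value is
  \<bar>p x\<bar> times the operator applied to \<bar>q\<bar>, which is bounded there. This supplies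
  the hypothesis of Fubini's theorem.\<close>

lemma integrable_log_kernel:
  assumes p: "bounded_cont p" and q: "bounded_cont q"
  shows "integrable (seg \<Otimes>\<^sub>M seg) (\<lambda>(x, s). p x * ((ln 2 - ln \<bar>x - s\<bar>) * q s))"
proof -
  obtain P where P: "continuous_on UNIV p" "\<And>s. \<bar>p s\<bar> \<le> P" using bounded_contD[OF p] by blast
  obtain M where M: "continuous_on UNIV q" "\<And>s. \<bar>q s\<bar> \<le> M" using bounded_contD[OF q] by blast
  have aq: "continuous_on UNIV (\<lambda>s. \<bar>q s\<bar>)" "\<And>s. \<bar>\<bar>q s\<bar>\<bar> \<le> M" using M by (auto intro: continuous_intros)
  note [measurable] = bounded_cont_measurable[OF p] bounded_cont_measurable[OF q]
  have [measurable]: "(\<lambda>x. abs (ln 2 - ln \<bar>x\<bar>) :: real) \<in> borel_measurable borel" by measurable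
  have inner: "(\<integral>s. norm (p x * ((ln 2 - ln \<bar>x - s\<bar>) * q s)) \<partial>seg) = \<bar>p x\<bar> * log_op (\<lambda>s. \<bar>q s\<bar>) x"
    if x: "x \<in> {-1..1}" for x
  proof -
    have "(\<integral>s. norm (p x * ((ln 2 - ln \<bar>x - s\<bar>) * q s)) \<partial>seg) =
        (\<integral>s. \<bar>p x\<bar> * ((ln 2 - ln \<bar>x - s\<bar>) * \<bar>q s\<bar>) \<partial>seg)"
    proof (rule integral_cong_AE)
      show "AE s in seg. norm (p x * ((ln 2 - ln \<bar>x - s\<bar>) * q s)) = \<bar>p x\<bar> * ((ln 2 - ln \<bar>x - s\<bar>) * \<bar>q s\<bar>)"
        using AE_seg AE_seg_neq[of x]
      proof eventually_elim
        case (elim s)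
        then show ?case using log_kernel_bounds(1)[of x s] x by (simp add: abs_mult)
      qed
    qed measurable
    then show ?thesis by (simp add: log_op_def)
  qed
  have "integrable seg (\<lambda>x. \<integral>s. norm (p x * ((ln 2 - ln \<bar>x - s\<bar>) * q s)) \<partial>seg)"
  proof (rule seg.integrable_const_bound)
    show "AE x in seg. norm (\<integral>s. norm (p x * ((ln 2 - ln \<bar>x - s\<bar>) * q s)) \<partial>seg)
        \<le> P * (ln 2 * (\<integral>s. \<bar>q s\<bar> \<partial>seg) + 2 * M)"
      using AE_seg
    proof eventually_elim
      case (elim x)
      have "\<bar>log_op (\<lambda>s. \<bar>q s\<bar>) x\<bar> \<le> ln 2 * (\<integral>s. \<bar>q s\<bar> \<partial>seg) + 2 * M"
        using log_op_abs_le[OF aq, of x 1] elim by simp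
      then have "\<bar>p x\<bar> * \<bar>log_op (\<lambda>s. \<bar>q s\<bar>) x\<bar> \<le> P * (ln 2 * (\<integral>s. \<bar>q s\<bar> \<partial>seg) + 2 * M)"
        using P(2)[of x] by (intro mult_mono) auto
      moreover have "x \<in> {-1..1}" using elim by simp
      ultimately show ?case unfolding inner[OF \<open>x \<in> {-1..1}\<close>] by (simp add: abs_mult)
    qed
  qed measurable
  then have "integrable (seg \<Otimes>\<^sub>M seg) (\<lambda>z. case z of (x, s) \<Rightarrow> p x * ((ln 2 - ln \<bar>x - s\<bar>) * q s))"
    by (intro seg_pair.Fubini_integrable) (auto intro!: integrable_mult_right integrable_log_op[OF M])
  then show ?thesis .
qed

lemma integrable_mult_log_op:
  assumes p: "bounded_cont p" and q: "bounded_cont q"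
  shows "integrable seg (\<lambda>x. p x * log_op q x)"
proof -
  have "integrable seg (\<lambda>x. \<integral>s. p x * ((ln 2 - ln \<bar>x - s\<bar>) * q s) \<partial>seg)"
    using seg_pair.integrable_fst[OF integrable_log_kernel[OF p q]] by simp
  then show ?thesis by (simp add: log_op_def)
qed

lemma log_op_symmetric:
  assumes p: "bounded_cont p" and q: "bounded_cont q"
  shows "(\<integral>x. p x * log_op q x \<partial>seg) = (\<integral>x. q x * log_op p x \<partial>seg)"
proof -
  have "(\<integral>x. p x * log_op q x \<partial>seg) = (\<integral>x. (\<integral>s. p x * ((ln 2 - ln \<bar>x - s\<bar>) * q s) \<partial>seg) \<partial>seg)"
    by (simp add: log_op_def)
  also have "\<dots> = (\<integral>s. (\<integral>x. p x * ((ln 2 - ln \<bar>x - s\<bar>) * q s) \<partial>seg) \<partial>seg)"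
    using seg_pair.Fubini_integral[OF integrable_log_kernel[OF p q]] by simp
  also have "\<dots> = (\<integral>s. (\<integral>x. q s * ((ln 2 - ln \<bar>s - x\<bar>) * p x) \<partial>seg) \<partial>seg)"
    by (simp add: mult_ac abs_minus_commute)
  also have "\<dots> = (\<integral>s. q s * log_op p s \<partial>seg)"
    by (simp add: log_op_def)
  finally show ?thesis .
qed

lemma AE_seg_pair: "AE z in seg \<Otimes>\<^sub>M seg. fst z \<noteq> snd z \<and> fst z \<in> {-1..1} \<and> snd z \<in> {-1..1}"
proof -
  have "AE x in seg. AE s in seg. fst (x, s) \<noteq> snd (x, s) \<and> fst (x, s) \<in> {-1..1} \<and> snd (x, s) \<in> {-1..1}"
    using AE_seg
  proof eventually_elim
    case (elim x)
    show ?case using AE_seg AE_seg_neq[of x] by eventually_elim (use elim in auto)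
  qed
  then show ?thesis by (rule seg_pair.AE_pair_measure[rotated]) measurable
qed

text \<open>A kernel \<open>K x s = \<integral> A x w * A s w\<close> is positive definite, the quadratic form being
  \<open>\<integral> (\<integral> A x w * f x)\<^sup>2\<close>.\<close>

lemma feature_kernel_nonneg:
  fixes A :: "real \<Rightarrow> 'b \<Rightarrow> real" and K :: "real \<Rightarrow> real \<Rightarrow> real"
  assumes M: "sigma_finite_measure M"
    and A [measurable]: "(\<lambda>(x, w). A x w) \<in> borel_measurable (borel \<Otimes>\<^sub>M M)" and A0: "\<And>x w. A x w \<ge> 0"
    and K: "\<And>x s. x \<in> {-1..1} \<Longrightarrow> s \<in> {-1..1} \<Longrightarrow> x \<noteq> s \<Longrightarrow>
      (\<integral>\<^sup>+ w. ennreal (A x w * A s w) \<partial>M) = ennreal (K x s)"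
    and K0: "\<And>x s. x \<in> {-1..1} \<Longrightarrow> s \<in> {-1..1} \<Longrightarrow> x \<noteq> s \<Longrightarrow> 0 \<le> K x s"
    and Kint: "integrable (seg \<Otimes>\<^sub>M seg) (\<lambda>(x, s). K x s)"
    and f: "bounded_cont f"
  shows "0 \<le> (\<integral>z. K (fst z) (snd z) * (f (fst z) * f (snd z)) \<partial>(seg \<Otimes>\<^sub>M seg))"
proof -
  interpret M: sigma_finite_measure M by (fact M)
  interpret PM: pair_sigma_finite "seg \<Otimes>\<^sub>M seg" M
    by (intro pair_sigma_finite.intro M seg_pair.P.sigma_finite_measure_axioms)
  note [measurable] = bounded_cont_measurable[OF f]
  have [measurable]: "(\<lambda>(x, w). A x w) \<in> borel_measurable (seg \<Otimes>\<^sub>M M)"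
    using A by (simp cong: measurable_cong_sets)
  have [measurable]: "(\<lambda>z. K (fst z) (snd z)) \<in> borel_measurable (seg \<Otimes>\<^sub>M seg)"
    using borel_measurable_integrable[OF Kint] by (simp add: case_prod_unfold)
  obtain B where B: "\<And>s. \<bar>f s\<bar> \<le> B" using bounded_contD(2)[OF f] by blast
  define h where "h = (\<lambda>(z, w). (A (fst z) w * A (snd z) w) * (f (fst z) * f (snd z)))"
  have [measurable]: "h \<in> borel_measurable ((seg \<Otimes>\<^sub>M seg) \<Otimes>\<^sub>M M)"
    unfolding h_def by measurable
  have inner_nn: "(\<integral>\<^sup>+ w. ennreal (norm (h (z, w))) \<partial>M) = ennreal (K (fst z) (snd z) * \<bar>f (fst z) * f (snd z)\<bar>)"
    if z: "fst z \<noteq> snd z \<and> fst z \<in> {-1..1} \<and> snd z \<in> {-1..1}" for z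
  proof -
    have "(\<integral>\<^sup>+ w. ennreal (norm (h (z, w))) \<partial>M) =
        (\<integral>\<^sup>+ w. ennreal (A (fst z) w * A (snd z) w) * ennreal \<bar>f (fst z) * f (snd z)\<bar> \<partial>M)"
      using A0 by (intro nn_integral_cong) (auto simp: h_def abs_mult simp flip: ennreal_mult)
    also have "\<dots> = (\<integral>\<^sup>+ w. ennreal (A (fst z) w * A (snd z) w) \<partial>M) * ennreal \<bar>f (fst z) * f (snd z)\<bar>"
      by (rule nn_integral_multc) measurable
    finally show ?thesis using K K0 z by (simp add: ennreal_mult)
  qed
  \<comment> \<open>For Fubini: since A is nonnegative, integrating out w in the absolute value
    gives K back, up to the bounded factor from f, and K is integrable.\<close>
  have hint: "integrable ((seg \<Otimes>\<^sub>M seg) \<Otimes>\<^sub>M M) h"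
  proof (rule integrableI_bounded)
    have "(\<integral>\<^sup>+ u. ennreal (norm (h u)) \<partial>((seg \<Otimes>\<^sub>M seg) \<Otimes>\<^sub>M M)) =
        (\<integral>\<^sup>+ z. (\<integral>\<^sup>+ w. ennreal (norm (h (z, w))) \<partial>M) \<partial>(seg \<Otimes>\<^sub>M seg))"
      by (rule M.nn_integral_fst[symmetric]) measurable
    also have "\<dots> \<le> (\<integral>\<^sup>+ z. ennreal (norm (K (fst z) (snd z) * (B * B))) \<partial>(seg \<Otimes>\<^sub>M seg))"
    proof (rule nn_integral_mono_AE)
      show "AE z in seg \<Otimes>\<^sub>M seg. (\<integral>\<^sup>+ w. ennreal (norm (h (z, w))) \<partial>M) \<le> ennreal (norm (K (fst z) (snd z) * (B * B)))"
        using AE_seg_pair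
      proof eventually_elim
        case (elim z)
        have "\<bar>f (fst z) * f (snd z)\<bar> \<le> B * B"
          unfolding abs_mult using B[of "fst z"] B[of "snd z"] by (intro mult_mono) auto
        then show ?case using inner_nn[OF elim] K0[of "fst z" "snd z"] elim
          by (auto intro!: ennreal_leI simp: abs_mult mult_left_mono)
      qed
    qed
    also have "\<dots> < \<infinity>"
    proof -
      have "integrable (seg \<Otimes>\<^sub>M seg) (\<lambda>z. K (fst z) (snd z) * (B * B))"
        using Kint by (simp add: case_prod_unfold)
      then show ?thesis unfolding integrable_iff_bounded by blast
    qed
    finally show "(\<integral>\<^sup>+ u. ennreal (norm (h u)) \<partial>((seg \<Otimes>\<^sub>M seg) \<Otimes>\<^sub>M M)) < \<infinity>" .
  qed measurable
  have "(\<integral>z. K (fst z) (snd z) * (f (fst z) * f (snd z)) \<partial>(seg \<Otimes>\<^sub>M seg)) =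
      (\<integral>z. (\<integral>w. h (z, w) \<partial>M) \<partial>(seg \<Otimes>\<^sub>M seg))"
  proof (rule integral_cong_AE)
    show "AE z in seg \<Otimes>\<^sub>M seg. K (fst z) (snd z) * (f (fst z) * f (snd z)) = (\<integral>w. h (z, w) \<partial>M)"
      using AE_seg_pair
    proof eventually_elim
      case (elim z)
      have "(\<integral>w. A (fst z) w * A (snd z) w \<partial>M) = K (fst z) (snd z)"
        using K K0 A0 elim by (subst integral_eq_nn_integral) auto
      then show ?case by (simp add: h_def)
    qed
  qed measurable
  also have "\<dots> = (\<integral>w. (\<integral>z. h (z, w) \<partial>(seg \<Otimes>\<^sub>M seg)) \<partial>M)"
    using PM.Fubini_integral[of "\<lambda>z w. h (z, w)"] hint by simp
  also have "\<dots> \<ge> 0"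
  proof (rule integral_nonneg_AE)
    have "AE w in M. integrable (seg \<Otimes>\<^sub>M seg) (\<lambda>z. h (z, w))"
      using PM.AE_integrable_snd[of "\<lambda>z w. h (z, w)"] hint by simp
    then show "AE w in M. 0 \<le> (\<integral>z. h (z, w) \<partial>(seg \<Otimes>\<^sub>M seg))"
    proof eventually_elim
      case (elim w)
      have "(\<integral>z. h (z, w) \<partial>(seg \<Otimes>\<^sub>M seg)) = (\<integral>x. (\<integral>s. h ((x, s), w) \<partial>seg) \<partial>seg)"
        using seg_pair.integral_fst[of "\<lambda>x s. h ((x, s), w)"] elim by (simp add: case_prod_unfold)
      \<comment> \<open>For fixed w the double integral factors into two equal integrals, hence is a
        square.\<close>
      also have "\<dots> = (\<integral>x. (\<integral>s. (A x w * f x) * (A s w * f s) \<partial>seg) \<partial>seg)"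
        by (simp add: h_def mult_ac)
      also have "\<dots> = (\<integral>x. A x w * f x \<partial>seg) * (\<integral>s. A s w * f s \<partial>seg)" by simp
      finally show ?case by simp
    qed
  qed
  finally show ?thesis .
qed

text \<open>The identity \<open>ln (2 / t) = (1 - t / 2) + \<integral>\<^sub>t\<^sup>2 (1 - t / r) / r dr\<close> writes the logarithmic
  kernel as a mixture of tents, each of which is the overlap length of two intervals.\<close>

lemma log_op_nonneg:
  assumes f: "bounded_cont f"
  shows "0 \<le> (\<integral>x. f x * log_op f x \<partial>seg)"
proof -
  note [measurable] = bounded_cont_measurable[OF f]
  let ?K1 = "\<lambda>x s::real. 1 - \<bar>x - s\<bar> / 2"
  let ?k = "\<lambda>x s::real. ln 2 - ln \<bar>x - s\<bar>"
  let ?K2 = "\<lambda>x s::real. ?k x s - ?K1 x s"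
  have fin: "finite_measure (seg \<Otimes>\<^sub>M seg)"
    by (intro finite_measure_pair_measure seg.finite_measure_axioms)
  interpret PP: finite_measure "seg \<Otimes>\<^sub>M seg" by (fact fin)
  have i1: "integrable (seg \<Otimes>\<^sub>M seg) (\<lambda>(x, s). ?K1 x s)"
  proof (rule PP.integrable_const_bound[of _ 1])
    show "AE z in seg \<Otimes>\<^sub>M seg. norm (case z of (x, s) \<Rightarrow> ?K1 x s) \<le> 1"
      using AE_seg_pair by eventually_elim auto
  qed measurable
  have ik: "integrable (seg \<Otimes>\<^sub>M seg) (\<lambda>(x, s). ?k x s)"
    using integrable_log_kernel[of "\<lambda>_. 1" "\<lambda>_. 1"] by simp
  have i2: "integrable (seg \<Otimes>\<^sub>M seg) (\<lambda>(x, s). ?K2 x s)"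
    using Bochner_Integration.integrable_diff[OF ik i1] by (simp add: case_prod_unfold)
  have p1: "0 \<le> (\<integral>z. ?K1 (fst z) (snd z) * (f (fst z) * f (snd z)) \<partial>(seg \<Otimes>\<^sub>M seg))"
  \<comment> \<open>The windows [z, z + 2] that contain both x and s form an interval of z of length
    2 - \<bar>x - s\<bar>; the weight 1 / sqrt 2 in each factor turns this into the tent.\<close>
  proof (rule feature_kernel_nonneg[of lborel "\<lambda>x z. if z \<le> x \<and> x \<le> z + 2 then 1 / sqrt 2 else 0"])
    fix x s :: real assume xs: "x \<in> {-1..1}" "s \<in> {-1..1}" "x \<noteq> s"
    have "(\<integral>\<^sup>+ w. ennreal ((if w \<le> x \<and> x \<le> w + 2 then 1 / sqrt 2 else 0) *
        (if w \<le> s \<and> s \<le> w + 2 then 1 / sqrt 2 else 0)) \<partial>lborel)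
      = (\<integral>\<^sup>+ w. ennreal (1/2) * indicator {max x s - 2..min x s} w \<partial>lborel)"
      by (intro nn_integral_cong) (auto simp: indicator_def)
    also have "\<dots> = ennreal (1/2) * ennreal (min x s - (max x s - 2))"
    proof -
      have "max x s - 2 \<le> min x s" using xs by auto
      then show ?thesis by (subst nn_integral_cmult_indicator) auto
    qed
    also have "\<dots> = ennreal (?K1 x s)"
      using xs by (subst ennreal_mult[symmetric]) (auto simp: min_def max_def abs_if field_simps)
    finally show "(\<integral>\<^sup>+ w. ennreal ((if w \<le> x \<and> x \<le> w + 2 then 1 / sqrt 2 else 0) *
        (if w \<le> s \<and> s \<le> w + 2 then 1 / sqrt 2 else 0)) \<partial>lborel) = ennreal (?K1 x s)" .
    show "0 \<le> ?K1 x s" using xs by auto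
  qed (use i1 f in \<open>auto intro: lborel.sigma_finite_measure_axioms\<close>)
  \<comment> \<open>Here w = (r, z) stands for the window [z, z + r] with r \<le> 2, and each factor
    has weight 1 / r. Integrating over z leaves \<open>(r - t) / r\<^sup>2\<close> for t \<le> r
    \<le> 2, where t = \<bar>x - s\<bar>, with antiderivative ln r + t / r.\<close>
  have K2: "(\<integral>\<^sup>+ w. ennreal ((if 0 < fst w \<and> fst w \<le> 2 \<and> snd w \<le> x \<and> x \<le> snd w + fst w then 1 / fst w else 0) *
        (if 0 < fst w \<and> fst w \<le> 2 \<and> snd w \<le> s \<and> s \<le> snd w + fst w then 1 / fst w else 0)) \<partial>lborel) = ennreal (?K2 x s)"
    "0 \<le> ?K2 x s"
    if xs: "x \<in> {-1..1}" "s \<in> {-1..1}" "x \<noteq> s" for x s :: real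
  proof -
    let ?t = "\<bar>x - s\<bar>"
    let ?h = "\<lambda>w::real\<times>real. ennreal ((if 0 < fst w \<and> fst w \<le> 2 \<and> snd w \<le> x \<and> x \<le> snd w + fst w then 1 / fst w else 0) *
        (if 0 < fst w \<and> fst w \<le> 2 \<and> snd w \<le> s \<and> s \<le> snd w + fst w then 1 / fst w else 0))"
    have t: "?t > 0" "?t \<le> 2" using xs by auto
    have "(\<integral>\<^sup>+ w. ?h w \<partial>lborel) = (\<integral>\<^sup>+ r. (\<integral>\<^sup>+ z. ?h (r, z) \<partial>lborel) \<partial>lborel)"
      by (subst lborel_prod[symmetric], rule lborel.nn_integral_fst[symmetric]) measurable
    also have "\<dots> = (\<integral>\<^sup>+ r. ennreal ((r - ?t) / r\<^sup>2) * indicator {?t..2} r \<partial>lborel)"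
    proof (rule nn_integral_cong)
      fix r :: real
      have "(\<integral>\<^sup>+ z. ?h (r, z) \<partial>lborel) = (\<integral>\<^sup>+ z. ennreal (if 0 < r \<and> r \<le> 2 then 1 / r\<^sup>2 else 0) *
          indicator {max x s - r..min x s} z \<partial>lborel)"
        by (intro nn_integral_cong) (auto simp: indicator_def power2_eq_square)
      also have "\<dots> = ennreal (if 0 < r \<and> r \<le> 2 then 1 / r\<^sup>2 else 0) * emeasure lborel {max x s - r..min x s}"
        by (subst nn_integral_cmult_indicator) auto
      also have "\<dots> = ennreal ((r - ?t) / r\<^sup>2) * indicator {?t..2} r"
      proof (cases "?t \<le> r \<and> r \<le> 2")
        case True
        then have "emeasure lborel {max x s - r..min x s} = ennreal (r - ?t)"
          by (auto simp: min_def max_def abs_if)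
        then show ?thesis using True t by (auto simp: ennreal_mult[symmetric])
      next
        case False
        then have "\<not> (0 < r \<and> r \<le> 2) \<or> {max x s - r..min x s} = {}"
          by (auto simp: min_def max_def abs_if split: if_splits)
        then show ?thesis using False by (auto simp: indicator_def)
      qed
      finally show "(\<integral>\<^sup>+ z. ?h (r, z) \<partial>lborel) = ennreal ((r - ?t) / r\<^sup>2) * indicator {?t..2} r" .
    qed
    also have "\<dots> = ennreal ((ln 2 + ?t / 2) - (ln ?t + ?t / ?t))"
    proof (rule nn_integral_FTC_Icc[of "\<lambda>r. (r - ?t) / r\<^sup>2" ?t 2 "\<lambda>r. ln r + ?t / r"])
      fix r :: real assume "r \<in> {?t..2}"
      then have r: "?t \<le> r" "r \<le> 2" by auto
      have "r > 0" using r t by linarith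
      then show "((\<lambda>r. ln r + ?t / r) has_real_derivative (r - ?t) / r\<^sup>2) (at r)"
        by (auto intro!: derivative_eq_intros simp: field_simps power2_eq_square)
      show "0 \<le> (r - ?t) / r\<^sup>2" using r by simp
    qed (use t in auto)
    also have "(ln 2 + ?t / 2) - (ln ?t + ?t / ?t) = ?K2 x s" using t by simp
    finally show "(\<integral>\<^sup>+ w. ?h w \<partial>lborel) = ennreal (?K2 x s)" .
    have "ln (?t / 2) \<le> ?t / 2 - 1" using t by (intro ln_le_minus_one) auto
    moreover have "ln (?t / 2) = ln ?t - ln 2" using t by (simp add: ln_div)
    ultimately show "0 \<le> ?K2 x s" by simp
  qed
  have [measurable]: "(fst :: real \<times> real \<Rightarrow> real) \<in> borel_measurable borel"
    "(snd :: real \<times> real \<Rightarrow> real) \<in> borel_measurable borel"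
    by (intro borel_measurable_continuous_onI continuous_intros)+
  have meas: "(\<lambda>(x, w :: real \<times> real). if 0 < fst w \<and> fst w \<le> 2 \<and> snd w \<le> x \<and> x \<le> snd w + fst w then 1 / fst w else 0)
      \<in> borel_measurable (borel \<Otimes>\<^sub>M lborel)"
    unfolding case_prod_unfold by measurable
  have p2: "0 \<le> (\<integral>z. ?K2 (fst z) (snd z) * (f (fst z) * f (snd z)) \<partial>(seg \<Otimes>\<^sub>M seg))"
    by (rule feature_kernel_nonneg[of "lborel :: (real \<times> real) measure"
          "\<lambda>x w. if 0 < fst w \<and> fst w \<le> 2 \<and> snd w \<le> x \<and> x \<le> snd w + fst w then 1 / fst w else 0"])
       (use K2 i2 f meas in \<open>auto intro: lborel.sigma_finite_measure_axioms\<close>)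
  obtain B where B: "\<And>s. \<bar>f s\<bar> \<le> B" using bounded_contD(2)[OF f] by blast
  have bd: "integrable (seg \<Otimes>\<^sub>M seg) (\<lambda>z. K (fst z) (snd z) * (f (fst z) * f (snd z)))"
    if "integrable (seg \<Otimes>\<^sub>M seg) (\<lambda>(x, s). K x s)" for K
  proof (rule Bochner_Integration.integrable_bound)
    show "integrable (seg \<Otimes>\<^sub>M seg) (\<lambda>z. K (fst z) (snd z) * (B * B))"
      using that by (simp add: case_prod_unfold)
    have [measurable]: "(\<lambda>z. K (fst z) (snd z)) \<in> borel_measurable (seg \<Otimes>\<^sub>M seg)"
      using borel_measurable_integrable[OF that] by (simp add: case_prod_unfold)
    show "(\<lambda>z. K (fst z) (snd z) * (f (fst z) * f (snd z))) \<in> borel_measurable (seg \<Otimes>\<^sub>M seg)"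
      by measurable
    have "\<bar>f (fst z) * f (snd z)\<bar> \<le> B * B" for z :: "real \<times> real"
      unfolding abs_mult using B[of "fst z"] B[of "snd z"] by (intro mult_mono) auto
    then show "AE z in seg \<Otimes>\<^sub>M seg. norm (K (fst z) (snd z) * (f (fst z) * f (snd z))) \<le> norm (K (fst z) (snd z) * (B * B))"
      by (intro AE_I2) (simp add: abs_mult mult_left_mono order_trans[OF _ abs_ge_self])
  qed
  have "(\<integral>x. f x * log_op f x \<partial>seg) = (\<integral>x. (\<integral>s. f x * (?k x s * f s) \<partial>seg) \<partial>seg)"
    by (simp add: log_op_def)
  also have "\<dots> = (\<integral>z. f (fst z) * (?k (fst z) (snd z) * f (snd z)) \<partial>(seg \<Otimes>\<^sub>M seg))"
    using seg_pair.integral_fst[OF integrable_log_kernel[OF f f]] by (simp add: case_prod_unfold)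
  also have "\<dots> = (\<integral>z. ?K1 (fst z) (snd z) * (f (fst z) * f (snd z)) + ?K2 (fst z) (snd z) * (f (fst z) * f (snd z)) \<partial>(seg \<Otimes>\<^sub>M seg))"
    by (rule Bochner_Integration.integral_cong) (auto simp: algebra_simps)
  also have "\<dots> = (\<integral>z. ?K1 (fst z) (snd z) * (f (fst z) * f (snd z)) \<partial>(seg \<Otimes>\<^sub>M seg)) +
      (\<integral>z. ?K2 (fst z) (snd z) * (f (fst z) * f (snd z)) \<partial>(seg \<Otimes>\<^sub>M seg))"
    by (rule Bochner_Integration.integral_add) (use bd[OF i1] bd[OF i2] in auto)
  finally show ?thesis using p1 p2 by simp
qed

section \<open>The integral equation on the segment\<close>

text \<open>Cauchy-Schwarz for total mass 2, obtained by expanding the square of \<bar>f\<bar> minus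
  its mean c.\<close>

lemma seg_L1_power2_le_L2:
  assumes f: "bounded_cont f"
  shows "(\<integral>x. \<bar>f x\<bar> \<partial>seg)\<^sup>2 \<le> 2 * (\<integral>x. (f x)\<^sup>2 \<partial>seg)"
proof -
  define c where "c = (\<integral>x. \<bar>f x\<bar> \<partial>seg) / 2"
  have a: "integrable seg (\<lambda>x. \<bar>f x\<bar>)" and q: "integrable seg (\<lambda>x. (f x)\<^sup>2)"
    using bounded_cont_integrable bounded_cont_abs[OF f] bounded_cont_mult[OF f f] by (auto simp: power2_eq_square)
  have "0 \<le> (\<integral>x. (\<bar>f x\<bar> - c)\<^sup>2 \<partial>seg)" by simp
  also have "\<dots> = (\<integral>x. (f x)\<^sup>2 - 2 * c * \<bar>f x\<bar> + c\<^sup>2 \<partial>seg)"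
    by (rule Bochner_Integration.integral_cong) (auto simp: power2_diff)
  also have "\<dots> = (\<integral>x. (f x)\<^sup>2 \<partial>seg) - 2 * c * (2 * c) + c\<^sup>2 * 2"
    using a q by (simp add: c_def)
  finally show ?thesis unfolding c_def by (simp add: power2_eq_square field_simps)
qed

text \<open>Pair f + l L f with f: the quadratic form of L is nonnegative and may be dropped, and
  Young's inequality absorbs half of f squared. The resulting bound does not depend on l.\<close>

lemma log_equation_L2_bound:
  assumes f: "bounded_cont f" and l: "l \<ge> 0"
    and a: "\<And>x. x \<in> {-1..1} \<Longrightarrow> \<bar>f x + l * log_op f x\<bar> \<le> a"
  shows "(\<integral>x. (f x)\<^sup>2 \<partial>seg) \<le> 2 * a\<^sup>2"
proof -
  have q: "integrable seg (\<lambda>x. (f x)\<^sup>2)"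
    using bounded_cont_integrable bounded_cont_mult[OF f f] by (auto simp: power2_eq_square)
  note lo = integrable_mult_log_op[OF f f]
  have "(\<integral>x. (f x)\<^sup>2 \<partial>seg) \<le> (\<integral>x. (f x)\<^sup>2 \<partial>seg) + l * (\<integral>x. f x * log_op f x \<partial>seg)"
    using log_op_nonneg[OF f] l by simp
  also have "\<dots> = (\<integral>x. (f x)\<^sup>2 + l * (f x * log_op f x) \<partial>seg)"
    using q lo by simp
  also have "\<dots> \<le> (\<integral>x. a\<^sup>2 / 2 + (f x)\<^sup>2 / 2 \<partial>seg)"
  proof (rule integral_mono_AE)
    show "AE x in seg. (f x)\<^sup>2 + l * (f x * log_op f x) \<le> a\<^sup>2 / 2 + (f x)\<^sup>2 / 2"
      using AE_seg
    proof eventually_elim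
      case (elim x)
      let ?g = "f x + l * log_op f x"
      have "?g\<^sup>2 \<le> a\<^sup>2" using a[of x] elim by (metis abs_le_square_iff abs_ge_zero abs_of_nonneg atLeastAtMost_iff order_trans)
      moreover have "2 * f x * ?g \<le> (f x)\<^sup>2 + ?g\<^sup>2" by (rule sum_squares_bound)
      moreover have "(f x)\<^sup>2 + l * (f x * log_op f x) = f x * ?g" by (simp add: power2_eq_square algebra_simps)
      ultimately show ?case by linarith
    qed
  qed (use q lo in auto)
  also have "\<dots> = a\<^sup>2 + (\<integral>x. (f x)\<^sup>2 \<partial>seg) / 2" using q by simp
  finally show ?thesis by simp
qed

text \<open>\<open>log_op f\<close> sees f only on the segment but may grow logarithmically far away
  from it. Composing with this retraction keeps the operator within the bounded continuous functions
  and does not change it on the segment.\<close>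

definition clamp1 :: "real \<Rightarrow> real" where "clamp1 x = max (-1) (min 1 x)"

lemma clamp1: "clamp1 x \<in> {-1..1}" "x \<in> {-1..1} \<Longrightarrow> clamp1 x = x"
  by (auto simp: clamp1_def)

lemma continuous_clamp1: "continuous_on UNIV clamp1"
  unfolding clamp1_def[abs_def] by (intro continuous_intros continuous_on_max continuous_on_min)

definition log_opC :: "(real \<Rightarrow>\<^sub>C real) \<Rightarrow> (real \<Rightarrow>\<^sub>C real)" where
  "log_opC f = Bcontfun (\<lambda>x. log_op (apply_bcontfun f) (clamp1 x))"

lemma bounded_cont_apply_bcontfun: "bounded_cont (apply_bcontfun f)"
  using norm_bounded[of f] by (intro bounded_contI[of _ "norm f"]) auto

lemma abs_integral_bcontfun_le: "(\<integral>s. \<bar>apply_bcontfun f s\<bar> \<partial>seg) \<le> 2 * norm f"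
proof -
  have "(\<integral>s. \<bar>apply_bcontfun f s\<bar> \<partial>seg) \<le> (\<integral>s. norm f \<partial>seg)"
    using norm_bounded[of f] bounded_cont_integrable[OF bounded_cont_abs[OF bounded_cont_apply_bcontfun]]
    by (intro integral_mono) auto
  then show ?thesis by simp
qed

lemma apply_log_opC: "apply_bcontfun (log_opC f) x = log_op (apply_bcontfun f) (clamp1 x)"
proof -
  have M: "continuous_on UNIV (apply_bcontfun f)" "\<And>s. \<bar>apply_bcontfun f s\<bar> \<le> norm f"
    using norm_bounded[of f] by auto
  have "(\<lambda>x. log_op (apply_bcontfun f) (clamp1 x)) \<in> bcontfun"
  proof (rule bcontfun_normI)
    show "continuous_on UNIV (\<lambda>x. log_op (apply_bcontfun f) (clamp1 x))"
      by (rule continuous_on_compose2[OF continuous_log_op[OF M] continuous_clamp1]) auto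
    show "norm (log_op (apply_bcontfun f) (clamp1 x)) \<le> ln 2 * (\<integral>s. \<bar>apply_bcontfun f s\<bar> \<partial>seg) + 2 * norm f" for x
      using log_op_abs_le[OF M clamp1(1), of 1 x] by simp
  qed
  then show ?thesis by (simp add: log_opC_def Bcontfun_inverse)
qed

lemma bounded_linear_log_opC: "bounded_linear log_opC"
proof (rule bounded_linear_intro)
  fix f g :: "real \<Rightarrow>\<^sub>C real" and c :: real
  have I: "integrable seg (\<lambda>s. (ln 2 - ln \<bar>x - s\<bar>) * apply_bcontfun f s)" for x and f :: "real \<Rightarrow>\<^sub>C real"
    using norm_bounded[of f] by (intro integrable_log_op[of _ "norm f"]) auto
  show "log_opC (f + g) = log_opC f + log_opC g"
    using I by (intro bcontfun_eqI) (simp add: apply_log_opC log_op_def distrib_left)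
  have "log_op (\<lambda>x. c * apply_bcontfun f x) x = c * log_op (apply_bcontfun f) x" for x
    unfolding log_op_def by (simp add: mult.left_commute)
  then show "log_opC (c *\<^sub>R f) = c *\<^sub>R log_opC f"
    by (intro bcontfun_eqI) (simp add: apply_log_opC)
  have M: "continuous_on UNIV (apply_bcontfun f)" "\<And>s. \<bar>apply_bcontfun f s\<bar> \<le> norm f"
    using norm_bounded[of f] by auto
  show "norm (log_opC f) \<le> norm f * (2 * ln 2 + 2)"
  proof (rule norm_bound)
    fix x
    have "\<bar>log_op (apply_bcontfun f) (clamp1 x)\<bar> \<le> ln 2 * (\<integral>s. \<bar>apply_bcontfun f s\<bar> \<partial>seg) + 2 * norm f"
      using log_op_abs_le[OF M clamp1(1), of 1 x] by simp
    also have "\<dots> \<le> ln 2 * (2 * norm f) + 2 * norm f"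
      using abs_integral_bcontfun_le[of f] by (intro add_right_mono mult_left_mono) auto
    finally show "norm (apply_bcontfun (log_opC f) x) \<le> norm f * (2 * ln 2 + 2)"
      by (simp add: apply_log_opC algebra_simps)
  qed
qed

text \<open>The L2 bound controls the L1 norm of f; fed into the equation through
  \<open>log_op_abs_le\<close>, it bounds the sup norm up to a fraction of itself.\<close>

lemma log_equation_sup_bound:
  assumes l: "0 \<le> l" "l \<le> L"
  shows "norm f \<le> (2 + 4 * L * (ln 2 - ln (1 / (4 * (1 + L))))) * norm (f + l *\<^sub>R log_opC f)"
proof -
  \<comment> \<open>Makes L * e \<le> 1 / 4, so that the term 2 L e S is at most S / 2 and is
    absorbed on the left.\<close>
  define e where "e = 1 / (4 * (1 + L))"
  define a where "a = norm (f + l *\<^sub>R log_opC f)"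
  define S where "S = norm f"
  have e: "0 < e" "e \<le> 1" using l by (auto simp: e_def)
  have a0: "a \<ge> 0" by (simp add: a_def)
  have M: "continuous_on UNIV (apply_bcontfun f)" "\<And>s. \<bar>apply_bcontfun f s\<bar> \<le> S"
    using norm_bounded[of f] by (auto simp: S_def)
  have S: "S \<ge> 0" by (simp add: S_def)
  have eq: "\<bar>apply_bcontfun f x + l * log_op (apply_bcontfun f) (clamp1 x)\<bar> \<le> a" for x
    using norm_bounded[of "f + l *\<^sub>R log_opC f" x] by (simp add: apply_log_opC a_def)
  have "(\<integral>x. (apply_bcontfun f x)\<^sup>2 \<partial>seg) \<le> 2 * a\<^sup>2"
  proof (rule log_equation_L2_bound[OF bounded_cont_apply_bcontfun l(1)])
    fix x :: real assume "x \<in> {-1..1}"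
    then show "\<bar>apply_bcontfun f x + l * log_op (apply_bcontfun f) x\<bar> \<le> a" using eq[of x] clamp1(2)[of x] by simp
  qed
  then have "(\<integral>x. \<bar>apply_bcontfun f x\<bar> \<partial>seg)\<^sup>2 \<le> (2 * a)\<^sup>2"
    using seg_L1_power2_le_L2[OF bounded_cont_apply_bcontfun[of f]] by (simp add: power2_eq_square)
  then have I: "(\<integral>x. \<bar>apply_bcontfun f x\<bar> \<partial>seg) \<le> 2 * a" by (rule power2_le_imp_le) (use a0 in simp)
  have "ln e \<le> ln 2" using e by (intro ln_mono) auto
  define G where "G = ln 2 - ln e"
  have G: "G \<ge> 0" using \<open>ln e \<le> ln 2\<close> by (simp add: G_def)
  have Le: "L * e \<le> 1 / 4" using l by (simp add: e_def field_simps)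
  have "norm f \<le> a + L * (G * (2 * a) + 2 * e * S)"
  proof (rule norm_bound)
    fix x
    have "\<bar>log_op (apply_bcontfun f) (clamp1 x)\<bar> \<le> G * (\<integral>s. \<bar>apply_bcontfun f s\<bar> \<partial>seg) + 2 * e * S"
      using log_op_abs_le[OF M clamp1(1) e, of x] by (simp add: G_def)
    also have "\<dots> \<le> G * (2 * a) + 2 * e * S" using I G by (intro add_right_mono mult_left_mono) auto
    finally have "l * \<bar>log_op (apply_bcontfun f) (clamp1 x)\<bar> \<le> L * (G * (2 * a) + 2 * e * S)"
      using l by (intro mult_mono) auto
    moreover have "\<bar>apply_bcontfun f x\<bar> \<le> a + l * \<bar>log_op (apply_bcontfun f) (clamp1 x)\<bar>"
      using eq[of x] abs_mult[of l "log_op (apply_bcontfun f) (clamp1 x)"] l(1) by linarith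
    ultimately show "norm (apply_bcontfun f x) \<le> a + L * (G * (2 * a) + 2 * e * S)" by simp
  qed
  then have "S \<le> a + 2 * L * G * a + 2 * (L * e) * S" by (simp add: S_def algebra_simps)
  also have "2 * (L * e) * S \<le> 2 * (1 / 4) * S" using Le S by (intro mult_right_mono mult_left_mono) auto
  finally have "S \<le> 2 * a + 4 * L * G * a" by (simp add: algebra_simps)
  then show ?thesis by (simp add: S_def a_def G_def e_def algebra_simps)
qed

theorem log_equation_solvable:
  assumes l: "l \<ge> 0"
  shows "\<exists>f. bounded_cont f \<and> (\<forall>x\<in>{-1..1}. f x + l * log_op f x = 1)"
proof -
  have "\<exists>f. f + l *\<^sub>R log_opC f = const_bcontfun 1"
    using l by (intro continuity_method[OF bounded_linear_log_opC, where L = l and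
        B = "2 + 4 * l * (ln 2 - ln (1 / (4 * (1 + l))))"] log_equation_sup_bound) auto
  then obtain f where f: "f + l *\<^sub>R log_opC f = const_bcontfun 1" by blast
  have "apply_bcontfun f x + l * log_op (apply_bcontfun f) x = 1" if x: "x \<in> {-1..1}" for x
  proof -
    have "apply_bcontfun (f + l *\<^sub>R log_opC f) x = 1" unfolding f by simp
    then show ?thesis using clamp1(2)[OF x] by (simp add: apply_log_opC)
  qed
  then show ?thesis using bounded_cont_apply_bcontfun by blast
qed

section \<open>Logarithmic potentials in the half-plane\<close>

definition cpt :: "real \<times> real \<Rightarrow> complex" where "cpt y = Complex (fst y) (snd y)"

lemma bounded_linear_cpt: "bounded_linear cpt"
proof -
  have "cpt = (\<lambda>y. of_real (fst y) + \<i> * of_real (snd y))"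
    by (auto simp: cpt_def fun_eq_iff complex_eq_iff)
  moreover have "bounded_linear (\<lambda>y::real\<times>real. complex_of_real (fst y) + \<i> * of_real (snd y))"
    by (intro bounded_linear_add bounded_linear_const_mult bounded_linear_compose[OF bounded_linear_of_real]
        bounded_linear_fst bounded_linear_snd)
  ultimately show ?thesis by simp
qed

lemma Re_cpt [simp]: "Re (cpt y) = fst y" and Im_cpt [simp]: "Im (cpt y) = snd y"
  and cpt_Basis [simp]: "cpt (1, 0) = 1" "cpt (0, 1) = \<i>"
  by (auto simp: cpt_def complex_eq_iff)

lemma open_Im_pos: "open {z. Im z > 0}"
  by (rule open_halfspace_Im_gt)

lemma convex_Im_pos: "convex {z. Im z > 0}"
  by (rule convex_halfspace_Im_gt)

lemma partial_deriv_Re_holomorphic: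
  assumes F: "F holomorphic_on {z. Im z > 0}" and u: "\<And>y. y \<in> upper_half_plane \<Longrightarrow> u y = Re (F (cpt y))"
    and y: "y \<in> upper_half_plane"
  shows "u differentiable (at y)" "partial_deriv b u y = Re (deriv F (cpt y) * cpt b)"
proof -
  have "(F has_field_derivative deriv F (cpt y)) (at (cpt y))"
    using F open_Im_pos y by (intro holomorphic_derivI) (auto simp: upper_half_plane_def)
  then have "(F has_derivative (*) (deriv F (cpt y))) (at (cpt y))"
    by (simp add: has_field_derivative_def)
  from diff_chain_at[OF bounded_linear.has_derivative[OF bounded_linear_cpt has_derivative_ident] this]
  have "((\<lambda>y. F (cpt y)) has_derivative (\<lambda>h. deriv F (cpt y) * cpt h)) (at y)" by (simp add: o_def)
  from bounded_linear.has_derivative[OF bounded_linear_Re this]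
  have "((\<lambda>y. Re (F (cpt y))) has_derivative (\<lambda>h. Re (deriv F (cpt y) * cpt h))) (at y)" .
  then have D: "(u has_derivative (\<lambda>h. Re (deriv F (cpt y) * cpt h))) (at y)"
    by (rule has_derivative_transform_within_open[OF _ open_upper_half_plane y]) (simp add: u)
  then show "u differentiable (at y)" by (rule differentiableI)
  show "partial_deriv b u y = Re (deriv F (cpt y) * cpt b)"
    unfolding partial_deriv_def frechet_derivative_at[OF D, symmetric] by simp
qed

lemma C1_on_Re_holomorphic:
  assumes F: "F holomorphic_on {z. Im z > 0}" and u: "\<And>y. y \<in> upper_half_plane \<Longrightarrow> u y = Re (F (cpt y))"
  shows "C1_on upper_half_plane u"
  unfolding C1_on_def
proof (intro conjI ballI)
  fix y assume "y \<in> upper_half_plane" then show "u differentiable (at y)"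
    using partial_deriv_Re_holomorphic[OF F u] by blast
next
  fix b :: "real \<times> real"
  have "continuous_on {z. Im z > 0} (deriv F)"
    using F open_Im_pos by (intro holomorphic_on_imp_continuous_on holomorphic_deriv)
  then have "continuous_on upper_half_plane (\<lambda>y. deriv F (cpt y))"
    by (rule continuous_on_compose2) (auto simp: upper_half_plane_def intro: bounded_linear.continuous_on[OF bounded_linear_cpt])
  then have "continuous_on upper_half_plane (\<lambda>y. Re (deriv F (cpt y) * cpt b))"
    by (intro continuous_intros)
  then show "continuous_on upper_half_plane (partial_deriv b u)"
    by (rule continuous_on_eq) (simp add: partial_deriv_Re_holomorphic(2)[OF F u])
qed

text \<open>The partial derivatives of Re F are Re F' and Re (i F'), again real parts of holomorphic
  functions, so the first-order lemmas iterate. The Laplacian vanishes because the squares of 1 and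
  i add up to 0.\<close>

lemma C2_on_Re_holomorphic:
  assumes F: "F holomorphic_on {z. Im z > 0}" and u: "\<And>y. y \<in> upper_half_plane \<Longrightarrow> u y = Re (F (cpt y))"
  shows "C2_on upper_half_plane u" and "y \<in> upper_half_plane \<Longrightarrow> laplacian u y = 0"
    and "y \<in> upper_half_plane \<Longrightarrow> grad_sq u y = (cmod (deriv F (cpt y)))\<^sup>2"
proof -
  have G: "(\<lambda>z. deriv F z * cpt b) holomorphic_on {z. Im z > 0}" for b
    using F open_Im_pos by (intro holomorphic_intros holomorphic_deriv)
  have pd: "partial_deriv b u y = Re (deriv F (cpt y) * cpt b)" if "y \<in> upper_half_plane" for b y
    using partial_deriv_Re_holomorphic(2)[OF F u that] .
  show "C2_on upper_half_plane u"
    unfolding C2_on_def using C1_on_Re_holomorphic[OF F u] C1_on_Re_holomorphic[OF G pd] by blast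
  assume y: "y \<in> upper_half_plane"
  have dG: "deriv (\<lambda>z. deriv F z * cpt b) (cpt y) = deriv (deriv F) (cpt y) * cpt b" for b
  proof (rule DERIV_imp_deriv)
    have "(deriv F has_field_derivative deriv (deriv F) (cpt y)) (at (cpt y))"
      using F open_Im_pos y by (intro holomorphic_derivI holomorphic_deriv) (auto simp: upper_half_plane_def)
    then show "((\<lambda>z. deriv F z * cpt b) has_field_derivative deriv (deriv F) (cpt y) * cpt b) (at (cpt y))"
      by (rule DERIV_cmult_right)
  qed
  have "partial_deriv b (partial_deriv b u) y = Re (deriv (deriv F) (cpt y) * cpt b * cpt b)" for b
    using partial_deriv_Re_holomorphic(2)[OF G pd y, of b b] dG[of b] by simp
  then show "laplacian u y = 0" unfolding laplacian_real_prod by simp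
  show "grad_sq u y = (cmod (deriv F (cpt y)))\<^sup>2"
    unfolding grad_sq_def Basis_real_prod using y by (simp add: pd cmod_power2)
qed

text \<open>For Im z > 0 the difference z - s stays off the branch cut of the principal logarithm,
  so the logarithmic potential is the real part of a holomorphic function on the whole
  half-plane.\<close>

definition complex_potential :: "(real \<Rightarrow> real) \<Rightarrow> complex \<Rightarrow> complex" where
  "complex_potential f z = integral (cbox (-1) 1) (\<lambda>s. of_real (f s) * Ln (z - of_real s))"

definition cauchy_transform :: "(real \<Rightarrow> real) \<Rightarrow> complex \<Rightarrow> complex" where
  "cauchy_transform f z = integral (cbox (-1) 1) (\<lambda>s. of_real (f s) / (z - of_real s))"

lemma Im_pos_notin_nonpos_Reals: "Im z > 0 \<Longrightarrow> z - of_real s \<notin> \<real>\<^sub>\<le>\<^sub>0" "Im z > 0 \<Longrightarrow> z \<noteq> of_real s"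
  by (auto simp: complex_nonpos_Reals_iff)

lemma complex_potential_has_field_derivative:
  assumes f: "continuous_on UNIV f" and z: "Im z > 0"
  shows "(complex_potential f has_field_derivative cauchy_transform f z) (at z)"
proof -
  let ?U = "{z. Im z > 0}"
  have "((\<lambda>z. integral (cbox (-1) 1) (\<lambda>s. of_real (f s) * Ln (z - of_real s))) has_field_derivative
      integral (cbox (-1) 1) (\<lambda>s. of_real (f s) / (z - of_real s))) (at z within ?U)"
  proof (rule leibniz_rule_field_derivative)
    fix w :: complex and s :: real assume "w \<in> ?U" "s \<in> cbox (-1) 1"
    then show "((\<lambda>w. of_real (f s) * Ln (w - of_real s)) has_field_derivative of_real (f s) / (w - of_real s)) (at w within ?U)"
      using Im_pos_notin_nonpos_Reals[of w s]
      by (auto intro!: derivative_eq_intros simp: divide_inverse)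
  next
    fix w :: complex assume w: "w \<in> ?U"
    have "continuous_on (cbox (-1) 1) (\<lambda>s. complex_of_real (f s) * Ln (w - of_real s))"
      using Im_pos_notin_nonpos_Reals(1)[of w] w
      by (intro continuous_intros continuous_on_subset[OF f]) auto
    then show "(\<lambda>s. complex_of_real (f s) * Ln (w - of_real s)) integrable_on cbox (-1) 1"
      by (rule integrable_continuous)
  next
    show "continuous_on (?U \<times> cbox (-1) 1) (\<lambda>(w, s). complex_of_real (f s) / (w - of_real s))"
      unfolding case_prod_unfold
      using Im_pos_notin_nonpos_Reals(2)
      by (intro continuous_intros continuous_on_compose2[OF f]) auto
  qed (use z convex_Im_pos in auto)
  then show ?thesis
    unfolding complex_potential_def[abs_def] cauchy_transform_def
    using at_within_open[of z ?U] open_Im_pos z by simp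
qed

lemma complex_potential_holomorphic:
  assumes f: "continuous_on UNIV f"
  shows "complex_potential f holomorphic_on {z. Im z > 0}"
  unfolding holomorphic_on_def
  using complex_potential_has_field_derivative[OF f]
  by (auto simp: field_differentiable_def intro: has_field_derivative_at_within)

lemma deriv_complex_potential:
  "continuous_on UNIV f \<Longrightarrow> Im z > 0 \<Longrightarrow> deriv (complex_potential f) z = cauchy_transform f z"
  by (rule DERIV_imp_deriv) (rule complex_potential_has_field_derivative)

lemma log_potential_eq_Re:
  assumes f: "bounded_cont f" and y: "y \<in> upper_half_plane"
  shows "log_potential f y = Re (complex_potential f (cpt y))"
proof -
  note f' = bounded_contD(1)[OF f]
  have y2: "snd y > 0" using y by (simp add: upper_half_plane_def)
  have nz: "cpt y - of_real s \<noteq> 0" for s using Im_pos_notin_nonpos_Reals(2)[of "cpt y" s] y2 by simp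
  have *: "norm (y - (s, 0)) = cmod (cpt y - of_real s)" for s
    unfolding norm_minus_real_axis by (simp add: cmod_def)
  have "y \<noteq> (s, 0)" for s using y2 by auto
  then have c: "continuous_on A (\<lambda>s. ln (norm (y - (s, 0))) * f s)" for A
    by (intro continuous_intros continuous_on_subset[OF f']) auto
  have "log_potential f y = integral {-1..1} (\<lambda>s. ln (norm (y - (s, 0))) * f s)"
    unfolding log_potential_def
    by (rule integral_seg_continuous(2)) (auto intro!: borel_measurable_continuous_onI c)
  also have "\<dots> = integral (cbox (-1) 1) (\<lambda>s. Re (of_real (f s) * Ln (cpt y - of_real s)))"
    using nz unfolding box_real
    by (intro Henstock_Kurzweil_Integration.integral_cong) (auto simp: * mult.commute)
  also have "\<dots> = Re (complex_potential f (cpt y))"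
  proof -
    have "continuous_on (cbox (-1) 1) (\<lambda>s. complex_of_real (f s) * Ln (cpt y - of_real s))"
      using Im_pos_notin_nonpos_Reals(1)[of "cpt y"] y2
      by (intro continuous_intros continuous_on_subset[OF f']) auto
    then have "(\<lambda>s. complex_of_real (f s) * Ln (cpt y - of_real s)) integrable_on cbox (-1) 1"
      by (rule integrable_continuous)
    from integral_unique[OF has_integral_Re[OF integrable_integral[OF this]]]
    show ?thesis unfolding complex_potential_def .
  qed
  finally show ?thesis .
qed

text \<open>Logarithmic growth is traded for a fourth root by ln X = 4 ln (sqrt (sqrt X)). With this
  exponent the squared gradient is bounded by the inverse square root of the height, which is
  integrable down to 0.\<close>

lemma arsinh_le_root4:
  fixes u :: real
  assumes u: "\<bar>u\<bar> \<le> v"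
  shows "\<bar>arsinh u\<bar> \<le> 4 * sqrt (sqrt (2 * v + 1))"
proof -
  have v: "v \<ge> 0" using u by linarith
  have bound: "arsinh w \<le> 4 * sqrt (sqrt (2 * v + 1))" if w: "\<bar>w\<bar> \<le> v" for w :: real
  proof -
    have "arsinh w \<le> arsinh v" using w by (simp add: not_less flip: linorder_not_less)
    also have "\<dots> = ln (v + sqrt (v\<^sup>2 + 1))" by (rule arsinh_real_def)
    also have "\<dots> \<le> ln (2 * v + 1)"
    proof (rule ln_mono)
      have "sqrt (v\<^sup>2 + 1) \<le> v + 1" using v by (intro real_le_lsqrt) (auto simp: power2_sum)
      then show "v + sqrt (v\<^sup>2 + 1) \<le> 2 * v + 1" by simp
      show "0 < v + sqrt (v\<^sup>2 + 1)" using v by (intro add_nonneg_pos) (auto simp: add_nonneg_pos)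
    qed
    also have "\<dots> = 4 * ln (sqrt (sqrt (2 * v + 1)))" using v by (simp add: ln_sqrt)
    also have "\<dots> \<le> 4 * sqrt (sqrt (2 * v + 1))"
      using v ln_le_minus_one[of "sqrt (sqrt (2 * v + 1))"] by simp
    finally show ?thesis .
  qed
  show ?thesis using bound[of u] bound[of "- u"] u by (auto simp: arsinh_minus_real)
qed

text \<open>Bounding \<bar>f\<bar> by M leaves the integral of the inverse distance from y to (s,
  0), a difference of arsinh values that grows only logarithmically as the height tends to
  0.\<close>

lemma cauchy_transform_bound:
  assumes f: "continuous_on UNIV f" "\<And>s. \<bar>f s\<bar> \<le> M" and R: "\<bar>fst y\<bar> \<le> R" "0 < snd y" "snd y \<le> R"
  shows "cmod (cauchy_transform f (cpt y)) \<le> M * (8 * sqrt (sqrt ((3 * R + 2) / snd y)))"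
proof -
  define x t where "x = fst y" and "t = snd y"
  have t: "t > 0" using R by (simp add: t_def)
  have M: "M \<ge> 0" using f(2)[of 0] by linarith
  let ?g = "\<lambda>s. 1 / sqrt ((s - x)\<^sup>2 + t\<^sup>2)"
  have nz: "cpt y - of_real s \<noteq> 0" for s using Im_pos_notin_nonpos_Reals(2)[of "cpt y" s] R by simp
  have pos: "(s - x)\<^sup>2 + t\<^sup>2 > 0" for s using t by (auto simp: sum_power2_gt_zero_iff)
  have g: "(?g has_integral arsinh ((1 - x) / t) - arsinh ((- 1 - x) / t)) {-1..1}"
  proof (rule fundamental_theorem_of_calculus)
    fix s :: real
    have "sqrt (((s - x) / t)\<^sup>2 + 1) = sqrt ((s - x)\<^sup>2 + t\<^sup>2) / t"
    proof -
      have "((s - x) / t)\<^sup>2 + 1 = ((s - x)\<^sup>2 + t\<^sup>2) / t\<^sup>2"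
        using t by (simp add: power_divide add_divide_distrib)
      then show ?thesis using t by (simp add: real_sqrt_divide)
    qed
    moreover have "((\<lambda>s. arsinh ((s - x) / t)) has_real_derivative 1 / sqrt (((s - x) / t)\<^sup>2 + 1) * (1 / t)) (at s within {-1..1})"
    proof -
      have "((\<lambda>s. (s - x) / t) has_real_derivative 1 / t) (at s)"
        using t by (auto intro!: derivative_eq_intros)
      from DERIV_chain2[OF arsinh_real_has_field_derivative this] show ?thesis
        by (rule has_field_derivative_at_within)
    qed
    ultimately have "((\<lambda>s. arsinh ((s - x) / t)) has_real_derivative ?g s) (at s within {-1..1})"
      using t by simp
    then show "((\<lambda>s. arsinh ((s - x) / t)) has_vector_derivative ?g s) (at s within {-1..1})"
      by (simp add: has_real_derivative_iff_has_vector_derivative)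
  qed simp
  have "cmod (cauchy_transform f (cpt y)) \<le> integral (cbox (-1) 1) (\<lambda>s. M * ?g s)"
    unfolding cauchy_transform_def
  proof (rule integral_norm_bound_integral)
    show "(\<lambda>s. complex_of_real (f s) / (cpt y - of_real s)) integrable_on cbox (-1) 1"
      using nz by (intro integrable_continuous continuous_intros continuous_on_subset[OF f(1)]) auto
    show "(\<lambda>s. M * ?g s) integrable_on cbox (-1) 1"
      unfolding box_real by (rule has_integral_integrable[OF has_integral_mult_right[OF g]])
    fix s :: real
    have "cmod (cpt y - of_real s) = sqrt ((s - x)\<^sup>2 + t\<^sup>2)"
      by (simp add: cmod_def x_def t_def power2_commute)
    then show "norm (complex_of_real (f s) / (cpt y - of_real s)) \<le> M * ?g s"
      using f(2)[of s] pos[of s] by (simp add: norm_divide divide_right_mono)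
  qed
  also have "\<dots> = M * (arsinh ((1 - x) / t) - arsinh ((- 1 - x) / t))"
    using integral_unique[OF has_integral_mult_right[OF g, of M]] by simp
  also have "\<dots> \<le> M * (8 * sqrt (sqrt ((3 * R + 2) / t)))"
  proof (rule mult_left_mono[OF _ M])
    have "\<bar>1 - x\<bar> \<le> 1 + R" "\<bar>- 1 - x\<bar> \<le> 1 + R" using R by (auto simp: x_def)
    then have "\<bar>(1 - x) / t\<bar> \<le> (1 + R) / t" "\<bar>(- 1 - x) / t\<bar> \<le> (1 + R) / t"
      using t by (auto simp: abs_divide divide_right_mono)
    then have "\<bar>arsinh ((1 - x) / t)\<bar> + \<bar>arsinh ((- 1 - x) / t)\<bar> \<le> 2 * (4 * sqrt (sqrt (2 * ((1 + R) / t) + 1)))"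
      using arsinh_le_root4[of "(1 - x) / t" "(1 + R) / t"] arsinh_le_root4[of "(- 1 - x) / t" "(1 + R) / t"] by linarith
    \<comment> \<open>The summand 1 goes over the common denominator because t \<le> R.\<close>
    moreover have "sqrt (sqrt (2 * ((1 + R) / t) + 1)) \<le> sqrt (sqrt ((3 * R + 2) / t))"
      using R t by (intro real_sqrt_le_mono) (auto simp: t_def field_simps)
    ultimately show "arsinh ((1 - x) / t) - arsinh ((- 1 - x) / t) \<le> 8 * sqrt (sqrt ((3 * R + 2) / t))" by linarith
  qed
  finally show ?thesis by (simp add: t_def)
qed

lemma nn_integral_inverse_sqrt:
  assumes R: "R > 0"
  shows "(\<integral>\<^sup>+ t. ennreal (1 / sqrt t) * indicator {0..R} t \<partial>lborel) = ennreal (2 * sqrt R)"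
proof (rule nn_integral_has_integral_lebesgue')
  have "((\<lambda>t. 1 / sqrt t) has_integral 2 * sqrt R - 2 * sqrt 0) {0..R}"
  proof (rule fundamental_theorem_of_calculus_interior)
    fix t assume "t \<in> {0<..<R}"
    then have "((\<lambda>t. 2 * sqrt t) has_real_derivative 1 / sqrt t) (at t)"
      by (auto intro!: derivative_eq_intros simp: field_simps)
    then show "((\<lambda>t. 2 * sqrt t) has_vector_derivative 1 / sqrt t) (at t)"
      by (simp add: has_real_derivative_iff_has_vector_derivative)
  qed (use R in \<open>auto intro!: continuous_intros\<close>)
  then show "((\<lambda>t. 1 / sqrt t) has_integral 2 * sqrt R) {0..R}" by simp
qed auto

text \<open>The gradient has the modulus of the Cauchy transform, so its square is at most a
  constant over the square root of the height, uniformly in the horizontal coordinate and hence also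
  near the endpoints of the segment.\<close>

lemma locally_finite_energy_potential:
  assumes f: "bounded_cont f" and u: "\<And>y. y \<in> upper_half_plane \<Longrightarrow> u y = C + log_potential f y"
  shows "locally_finite_energy u"
  unfolding locally_finite_energy_def
proof (intro allI impI)
  fix R :: real assume R: "R > 0"
  note f' = bounded_contD(1)[OF f]
  obtain M where M: "\<And>s. \<bar>f s\<bar> \<le> M" using bounded_contD(2)[OF f] by blast
  have M0: "M \<ge> 0" using M[of 0] by linarith
  let ?D = "upper_half_plane \<inter> ball 0 R"
  have hol: "(\<lambda>z. of_real C + complex_potential f z) holomorphic_on {z. Im z > 0}"
    by (intro holomorphic_intros complex_potential_holomorphic f')
  have u': "u y = Re (of_real C + complex_potential f (cpt y))" if "y \<in> upper_half_plane" for y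
    using u[OF that] log_potential_eq_Re[OF f that] by simp
  have dF: "deriv (\<lambda>z. of_real C + complex_potential f z) z = cauchy_transform f z" if "Im z > 0" for z
    by (rule DERIV_imp_deriv) (use complex_potential_has_field_derivative[OF f' that] in \<open>auto intro!: derivative_eq_intros\<close>)
  have gs: "grad_sq u y = (cmod (cauchy_transform f (cpt y)))\<^sup>2" if "y \<in> upper_half_plane" for y
    using C2_on_Re_holomorphic(3)[OF hol u' that] dF[of "cpt y"] that by (simp add: upper_half_plane_def)
  have "C1_on upper_half_plane u" by (rule C1_on_Re_holomorphic[OF hol u'])
  then have "continuous_on upper_half_plane (grad_sq u)"
    unfolding grad_sq_def[abs_def] C1_on_def by (intro continuous_intros) auto
  then have "(\<lambda>y. indicator ?D y *\<^sub>R grad_sq u y) \<in> borel_measurable borel"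
    using open_upper_half_plane
    by (intro borel_measurable_continuous_on_indicator) (auto intro: borel_open open_Int continuous_on_subset)
  then have meas: "set_borel_measurable lborel ?D (grad_sq u)"
    unfolding set_borel_measurable_def by simp
  define K where "K = M\<^sup>2 * 64 * sqrt (3 * R + 2)"
  have K: "K \<ge> 0" using R by (simp add: K_def)
  have bound: "grad_sq u y \<le> K * (1 / sqrt (snd y))" if y: "y \<in> ?D" for y
  proof -
    have y2: "snd y > 0" using y by (simp add: upper_half_plane_def)
    have n: "norm y < R" using y by simp
    have "\<bar>fst y\<bar> \<le> R" "snd y \<le> R"
      using n norm_fst_le[of "fst y" "snd y"] norm_snd_le[of "snd y" "fst y"] by auto
    then have "cmod (cauchy_transform f (cpt y)) \<le> M * (8 * sqrt (sqrt ((3 * R + 2) / snd y)))"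
      using cauchy_transform_bound[OF f' M, of y R] y2 by simp
    then have "(cmod (cauchy_transform f (cpt y)))\<^sup>2 \<le> (M * (8 * sqrt (sqrt ((3 * R + 2) / snd y))))\<^sup>2"
      by (intro power_mono) auto
    also have "\<dots> = M\<^sup>2 * 64 * sqrt ((3 * R + 2) / snd y)"
      using R y2 by (simp add: power_mult_distrib)
    also have "\<dots> = K * (1 / sqrt (snd y))" by (simp add: K_def real_sqrt_divide)
    finally show ?thesis using gs y by simp
  qed
  have [measurable]: "(fst :: real \<times> real \<Rightarrow> real) \<in> borel_measurable borel"
    "(snd :: real \<times> real \<Rightarrow> real) \<in> borel_measurable borel"
    by (intro borel_measurable_continuous_onI continuous_intros)+
  let ?h = "\<lambda>y::real\<times>real. ennreal (indicator {-R..R} (fst y)) * (ennreal K * (ennreal (1 / sqrt (snd y)) * indicator {0..R} (snd y)))"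
  have "(\<integral>\<^sup>+ y. ennreal (norm (indicator ?D y *\<^sub>R grad_sq u y)) \<partial>lborel) \<le> (\<integral>\<^sup>+ y. ?h y \<partial>lborel)"
  proof (rule nn_integral_mono)
    fix y :: "real \<times> real"
    show "ennreal (norm (indicator ?D y *\<^sub>R grad_sq u y)) \<le> ?h y"
    proof (cases "y \<in> ?D")
      case True
      then have "- R \<le> fst y" "fst y \<le> R" "snd y \<le> R" "snd y > 0"
        using norm_fst_le[of "fst y" "snd y"] norm_snd_le[of "snd y" "fst y"] by (auto simp: upper_half_plane_def)
      moreover have "grad_sq u y \<ge> 0" by (simp add: grad_sq_def sum_nonneg)
      ultimately show ?thesis using bound[OF True] True K by (simp add: ennreal_leI indicator_def flip: ennreal_mult)
    qed simp
  qed
  also have "\<dots> = (\<integral>\<^sup>+ x. (\<integral>\<^sup>+ t. ?h (x, t) \<partial>lborel) \<partial>lborel)"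
    by (subst lborel_prod[symmetric], rule lborel.nn_integral_fst[symmetric]) measurable
  also have "\<dots> = (\<integral>\<^sup>+ x. ennreal (K * (2 * sqrt R)) * indicator {-R..R} x \<partial>lborel)"
  proof (rule nn_integral_cong)
    fix x :: real
    have "(\<integral>\<^sup>+ t. ?h (x, t) \<partial>lborel) =
        ennreal (indicator {-R..R} x) * (ennreal K * (\<integral>\<^sup>+ t. ennreal (1 / sqrt t) * indicator {0..R} t \<partial>lborel))"
      by (simp add: nn_integral_cmult)
    then show "(\<integral>\<^sup>+ t. ?h (x, t) \<partial>lborel) = ennreal (K * (2 * sqrt R)) * indicator {-R..R} x"
      using nn_integral_inverse_sqrt[OF R] K R by (simp add: ennreal_mult[symmetric] indicator_def)
  qed
  also have "\<dots> < \<infinity>"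
    using R by (subst nn_integral_cmult_indicator) (auto simp: ennreal_mult_less_top)
  finally have "(\<integral>\<^sup>+ y. ennreal (norm (indicator ?D y *\<^sub>R grad_sq u y)) \<partial>lborel) < \<infinity>" .
  then show "set_integrable lborel ?D (grad_sq u)"
    unfolding set_integrable_def using meas
    by (intro integrableI_bounded) (auto simp: set_borel_measurable_def)
qed

section \<open>Boundary behaviour of logarithmic potentials\<close>

text \<open>By the mean value theorem the difference quotient at 0 is the value of D at an
  intermediate point, which tends to 0 as well. The normal derivative can thus be computed inside
  the open half-plane.\<close>

lemma has_right_derivative_limit:
  fixes h :: "real \<Rightarrow> real"
  assumes c: "continuous_on {0..} h"
    and d: "\<And>t. t > 0 \<Longrightarrow> (h has_real_derivative D t) (at t)"
    and lim: "(D \<longlongrightarrow> L) (at_right 0)"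
  shows "(h has_real_derivative L) (at 0 within {0..})"
proof -
  have "((\<lambda>t. (h t - h 0) / (t - 0)) \<longlongrightarrow> L) (at_right 0)"
  proof (rule tendstoI)
    fix e :: real assume "e > 0"
    then have "\<forall>\<^sub>F t in at_right 0. dist (D t) L < e" by (rule tendstoD[OF lim])
    then obtain b where b: "b > 0" "\<And>t. 0 < t \<Longrightarrow> t < b \<Longrightarrow> dist (D t) L < e"
      unfolding eventually_at_right_field by auto
    show "\<forall>\<^sub>F t in at_right 0. dist ((h t - h 0) / (t - 0)) L < e"
      unfolding eventually_at_right_field
    proof (intro exI[of _ b] conjI allI impI)
      fix t :: real assume t: "0 < t" "t < b"
      have "\<exists>l z. 0 < z \<and> z < t \<and> (h has_real_derivative l) (at z) \<and> h t - h 0 = (t - 0) * l"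
        using d by (intro MVT t(1) continuous_on_subset[OF c]) (auto simp: real_differentiable_def)
      then obtain l z where z: "0 < z" "z < t" "(h has_real_derivative l) (at z)" "h t - h 0 = t * l" by auto
      moreover have "l = D z" using z d DERIV_unique by blast
      ultimately have z: "0 < z" "z < t" "h t - h 0 = t * D z" by auto
      then show "dist ((h t - h 0) / (t - 0)) L < e" using b(2)[of z] t by simp
    qed (use b in simp)
  qed
  then show ?thesis
    unfolding has_field_derivative_iff by (simp add: at_within_Ici_at_right)
qed

lemma poisson_integral:
  fixes x t :: real
  assumes t: "t > 0"
  shows "((\<lambda>s. t / ((s - x)\<^sup>2 + t\<^sup>2)) has_integral arctan ((1 - x) / t) - arctan ((- 1 - x) / t)) {-1..1}"
proof (rule fundamental_theorem_of_calculus)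
  fix s :: real
  have "((\<lambda>s. (s - x) / t) has_real_derivative 1 / t) (at s)"
    using t by (auto intro!: derivative_eq_intros)
  from DERIV_chain2[OF DERIV_arctan this]
  have "((\<lambda>s. arctan ((s - x) / t)) has_real_derivative inverse (1 + ((s - x) / t)\<^sup>2) * (1 / t)) (at s)" .
  moreover have "inverse (1 + ((s - x) / t)\<^sup>2) * (1 / t) = t / ((s - x)\<^sup>2 + t\<^sup>2)"
  proof -
    have "1 + ((s - x) / t)\<^sup>2 = ((s - x)\<^sup>2 + t\<^sup>2) / t\<^sup>2" using t by (simp add: power_divide add_divide_distrib)
    then show ?thesis using t by (simp add: power2_eq_square)
  qed
  ultimately show "((\<lambda>s. arctan ((s - x) / t)) has_vector_derivative t / ((s - x)\<^sup>2 + t\<^sup>2)) (at s within {-1..1})"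
    by (metis has_field_derivative_at_within has_real_derivative_iff_has_vector_derivative)
qed simp

lemma arctan_divide_tendsto:
  fixes a :: real
  shows "a > 0 \<Longrightarrow> ((\<lambda>t. arctan (a / t)) \<longlongrightarrow> pi / 2) (at_right 0)"
    and "a < 0 \<Longrightarrow> ((\<lambda>t. arctan (a / t)) \<longlongrightarrow> - (pi / 2)) (at_right 0)"
proof -
  show 1: "((\<lambda>t. arctan (a / t)) \<longlongrightarrow> pi / 2) (at_right 0)" if "a > 0" for a :: real
  proof -
    have "filterlim (\<lambda>t. a / t) at_top (at_right 0)"
      using that by real_asymp
    then show ?thesis by (rule filterlim_compose[OF tendsto_arctan_at_top])
  qed
  show "((\<lambda>t. arctan (a / t)) \<longlongrightarrow> - (pi / 2)) (at_right 0)" if "a < 0"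
    using tendsto_minus[OF 1[of "- a"]] that by (simp add: arctan_minus)
qed

text \<open>Minus the imaginary part of 1 / (z - s) is the Poisson kernel. As the direction (0, 1)
  is multiplication by i, this is the derivative of the potential in the second coordinate.\<close>

lemma Im_cauchy_transform:
  assumes f: "continuous_on UNIV f" and t: "t > 0"
  shows "- Im (cauchy_transform f (cpt (x, t))) = integral {-1..1} (\<lambda>s. f s * (t / ((s - x)\<^sup>2 + t\<^sup>2)))"
proof -
  have nz: "cpt (x, t) - of_real s \<noteq> 0" for s
    using Im_pos_notin_nonpos_Reals(2)[of "cpt (x, t)" s] t by simp
  have "(\<lambda>s. complex_of_real (f s) / (cpt (x, t) - of_real s)) integrable_on cbox (-1) 1"
    using nz by (intro integrable_continuous continuous_intros continuous_on_subset[OF f]) auto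
  from integral_unique[OF has_integral_neg[OF has_integral_Im[OF integrable_integral[OF this]]]]
  have "- Im (cauchy_transform f (cpt (x, t))) =
      integral {-1..1} (\<lambda>s. - Im (complex_of_real (f s) / (cpt (x, t) - of_real s)))"
    unfolding cauchy_transform_def by simp
  also have "\<dots> = integral {-1..1} (\<lambda>s. f s * (t / ((s - x)\<^sup>2 + t\<^sup>2)))"
    by (intro Henstock_Kurzweil_Integration.integral_cong)
      (simp add: Im_divide power2_commute[of x])
  finally show ?thesis .
qed

text \<open>The Poisson kernel is an approximate identity whose mass over the segment tends to pi at
  inner points and to 0 at outer ones. At x = 1 and x = -1 the mass tends to pi / 2, hence the
  restriction on x.\<close>

lemma poisson_limit:
  assumes f: "continuous_on UNIV f" "\<And>s. \<bar>f s\<bar> \<le> M" and x: "\<bar>x\<bar> \<noteq> 1"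
  shows "((\<lambda>t. integral {-1..1} (\<lambda>s. f s * (t / ((s - x)\<^sup>2 + t\<^sup>2)))) \<longlongrightarrow> (if \<bar>x\<bar> < 1 then pi * f x else 0)) (at_right 0)"
proof -
  let ?P = "\<lambda>t s. t / ((s - x)\<^sup>2 + t\<^sup>2)"
  let ?A = "\<lambda>t. arctan ((1 - x) / t) - arctan ((- 1 - x) / t)"
  have M: "M \<ge> 0" using f(2)[of 0] by linarith
  have A: "(?A \<longlongrightarrow> (if \<bar>x\<bar> < 1 then pi else 0)) (at_right 0)"
  proof -
    consider "\<bar>x\<bar> < 1" | "x > 1" | "x < -1" using x by linarith
    then show ?thesis
    proof cases
      case 1
      then have "(?A \<longlongrightarrow> pi / 2 - (- (pi / 2))) (at_right 0)"
        by (intro tendsto_diff arctan_divide_tendsto) auto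
      then show ?thesis using 1 by simp
    next
      case 2
      then have "(?A \<longlongrightarrow> - (pi / 2) - (- (pi / 2))) (at_right 0)"
        by (intro tendsto_diff arctan_divide_tendsto) auto
      then show ?thesis using 2 by simp
    next
      case 3
      then have "(?A \<longlongrightarrow> pi / 2 - pi / 2) (at_right 0)"
        by (intro tendsto_diff arctan_divide_tendsto) auto
      then show ?thesis using 3 by simp
    qed
  qed
  have pos: "(s - x)\<^sup>2 + t\<^sup>2 > 0" if "t > 0" for s t :: real using that by (auto simp: sum_power2_gt_zero_iff)
  have cP: "continuous_on S (?P t)" if "t > 0" for t S
    using pos[OF that] by (intro continuous_intros) (metis less_irrefl)
  have small: "((\<lambda>t. integral {-1..1} (\<lambda>s. (f s - f x) * ?P t s)) \<longlongrightarrow> 0) (at_right 0)"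
  proof (rule tendstoI)
    fix e :: real assume e: "e > 0"
    \<comment> \<open>The kernel has mass at most pi, so the part of the integral close to x
      contributes at most e / 2.\<close>
    define e' where "e' = e / (2 * pi)"
    have e': "e' > 0" using e by (simp add: e'_def)
    obtain d where d: "d > 0" "\<And>s. \<bar>s - x\<bar> < d \<Longrightarrow> \<bar>f s - f x\<bar> < e'"
      using f(1) e' unfolding continuous_on_iff dist_real_def by (metis UNIV_I)
    \<comment> \<open>The tail: at distance at least d from x the kernel is at most
      \<open>t / d\<^sup>2\<close>, and \<bar>f s - f x\<bar> \<le> 2 M is integrated over length
      2.\<close>
    have "((\<lambda>t. 4 * M * t / d\<^sup>2) \<longlongrightarrow> 4 * M * 0 / d\<^sup>2) (at_right 0)"
      by (intro tendsto_intros) (use d in auto)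
    then have "\<forall>\<^sub>F t in at_right 0. 4 * M * t / d\<^sup>2 < e / 2"
      using e by (intro order_tendstoD(2)) auto
    moreover have "\<forall>\<^sub>F t in at_right (0::real). t > 0" by (simp add: eventually_at_right_less)
    ultimately show "\<forall>\<^sub>F t in at_right 0. dist (integral {-1..1} (\<lambda>s. (f s - f x) * ?P t s)) 0 < e"
    proof eventually_elim
      case (elim t)
      have "norm (integral {-1..1} (\<lambda>s. (f s - f x) * ?P t s)) \<le> integral {-1..1} (\<lambda>s. e' * ?P t s + 2 * M * t / d\<^sup>2)"
      proof (rule integral_norm_bound_integral)
        show "(\<lambda>s. (f s - f x) * ?P t s) integrable_on {-1..1}"
          by (intro integrable_continuous_interval continuous_intros continuous_on_subset[OF f(1)] cP elim) auto
        show "(\<lambda>s. e' * ?P t s + 2 * M * t / d\<^sup>2) integrable_on {-1..1}"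
          by (intro integrable_continuous_interval continuous_intros cP elim)
        fix s :: real
        have P0: "?P t s \<ge> 0" using elim pos[of t s] by simp
        have nrm: "norm ((f s - f x) * ?P t s) = \<bar>f s - f x\<bar> * ?P t s"
          unfolding real_norm_def abs_mult using P0 by (simp only: abs_of_nonneg)
        show "norm ((f s - f x) * ?P t s) \<le> e' * ?P t s + 2 * M * t / d\<^sup>2"
        proof (cases "\<bar>s - x\<bar> < d")
          case True
          then have "\<bar>f s - f x\<bar> * ?P t s \<le> e' * ?P t s" using d(2)[of s] P0 by (intro mult_right_mono) auto
          moreover have "2 * M * t / d\<^sup>2 \<ge> 0" using M elim by simp
          ultimately show ?thesis unfolding nrm by linarith
        next
          case False
          then have "d\<^sup>2 \<le> (s - x)\<^sup>2" using d(1) abs_le_square_iff[of d "s - x"] by simp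
          then have "?P t s \<le> t / d\<^sup>2" 
            using elim d(1) pos[of t s] by (intro divide_left_mono add_increasing2) auto
          moreover have "\<bar>f s - f x\<bar> \<le> 2 * M" using f(2)[of s] f(2)[of x] by linarith
          ultimately have "\<bar>f s - f x\<bar> * ?P t s \<le> 2 * M * (t / d\<^sup>2)" using P0 M by (intro mult_mono) auto
          then have "\<bar>f s - f x\<bar> * ?P t s \<le> 2 * M * t / d\<^sup>2" by simp
          moreover have "e' * ?P t s \<ge> 0" using e' P0 by (intro mult_nonneg_nonneg) auto
          ultimately show ?thesis unfolding nrm by linarith
        qed
      qed
      also have "\<dots> = e' * ?A t + 4 * M * t / d\<^sup>2"
      proof -
        have "((\<lambda>s. e' * ?P t s + 2 * M * t / d\<^sup>2) has_integral e' * ?A t + 2 * (2 * M * t / d\<^sup>2)) {-1..1}"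
          using has_integral_const_real[of "2 * M * t / d\<^sup>2" "-1" 1]
          by (intro has_integral_add has_integral_mult_right poisson_integral elim) auto
        then show ?thesis by (simp add: integral_unique)
      qed
      also have "\<dots> < e"
      proof -
        have "?A t \<le> pi" using arctan_bounded[of "(1 - x) / t"] arctan_bounded[of "(- 1 - x) / t"] by linarith
        then have "e' * ?A t \<le> e' * pi" using e' by (intro mult_left_mono) auto
        also have "e' * pi = e / 2" by (simp add: e'_def)
        finally show ?thesis using elim by linarith
      qed
      finally show ?case by simp
    qed
  qed
  have "((\<lambda>t. integral {-1..1} (\<lambda>s. (f s - f x) * ?P t s) + f x * ?A t) \<longlongrightarrow> 0 + f x * (if \<bar>x\<bar> < 1 then pi else 0)) (at_right 0)"
    by (intro tendsto_add small tendsto_mult_left A)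
  moreover have "\<forall>\<^sub>F t in at_right (0::real). t > 0" by (simp add: eventually_at_right_less)
  then have "\<forall>\<^sub>F t in at_right 0. integral {-1..1} (\<lambda>s. (f s - f x) * ?P t s) + f x * ?A t = integral {-1..1} (\<lambda>s. f s * ?P t s)"
  proof eventually_elim
    case (elim t)
    have i: "(\<lambda>s. (f s - f x) * ?P t s) integrable_on {-1..1}"
      by (intro integrable_continuous_interval continuous_intros continuous_on_subset[OF f(1)] cP elim) auto
    have "((\<lambda>s. (f s - f x) * ?P t s + f x * ?P t s) has_integral
        integral {-1..1} (\<lambda>s. (f s - f x) * ?P t s) + f x * ?A t) {-1..1}"
      by (intro has_integral_add has_integral_mult_right poisson_integral elim integrable_integral i)
    moreover have "(\<lambda>s. (f s - f x) * ?P t s + f x * ?P t s) = (\<lambda>s. f s * ?P t s)"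
      by (simp only: left_diff_distrib diff_add_cancel)
    ultimately show ?case by (simp add: integral_unique)
  qed
  ultimately have "((\<lambda>t. integral {-1..1} (\<lambda>s. f s * ?P t s)) \<longlongrightarrow> 0 + f x * (if \<bar>x\<bar> < 1 then pi else 0)) (at_right 0)"
    by (rule Lim_transform_eventually)
  then show ?thesis by (simp add: mult.commute split: if_splits)
qed

text \<open>For t > 0 the derivative in t is a Poisson integral, whose limit at 0 is known. The
  outward normal points downwards, whence the sign.\<close>

lemma has_normal_deriv_log_potential:
  assumes f: "bounded_cont f" and x: "\<bar>x\<bar> \<noteq> 1"
  shows "has_normal_deriv (\<lambda>y. C + log_potential f y) (- (if \<bar>x\<bar> < 1 then pi * f x else 0)) x"
proof -
  note f' = bounded_contD(1)[OF f]
  obtain M where M: "\<And>s. \<bar>f s\<bar> \<le> M" using bounded_contD(2)[OF f] by blast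
  have "((\<lambda>t. C + log_potential f (x, t)) has_real_derivative (if \<bar>x\<bar> < 1 then pi * f x else 0)) (at 0 within {0..})"
  proof (rule has_right_derivative_limit[OF _ _ poisson_limit[OF f' M x]])
    show "continuous_on {0..} (\<lambda>t. C + log_potential f (x, t))"
      by (intro continuous_intros continuous_on_compose2[OF continuous_log_potential[OF f' M]]) auto
    fix t :: real assume t: "t > 0"
    have xt: "(x, t) \<in> upper_half_plane" using t by (simp add: upper_half_plane_def)
    have "log_potential f differentiable (at (x, t))"
      and pd: "partial_deriv (0, 1) (log_potential f) (x, t) = Re (deriv (complex_potential f) (cpt (x, t)) * cpt (0, 1))"
      using partial_deriv_Re_holomorphic[OF complex_potential_holomorphic[OF f'] log_potential_eq_Re[OF f] xt] by blast+
    then have "((\<lambda>s. log_potential f ((x, 0) + s *\<^sub>R (0, 1))) has_real_derivative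
        partial_deriv (0, 1) (log_potential f) ((x, 0) + t *\<^sub>R (0, 1))) (at t)"
      by (intro has_real_derivative_line) simp
    moreover have "partial_deriv (0, 1) (log_potential f) (x, t) = integral {-1..1} (\<lambda>s. f s * (t / ((s - x)\<^sup>2 + t\<^sup>2)))"
      using pd Im_cauchy_transform[OF f' t, of x] deriv_complex_potential[OF f', of "cpt (x, t)"] t by simp
    ultimately have "((\<lambda>s. log_potential f (x, s)) has_real_derivative
        integral {-1..1} (\<lambda>s. f s * (t / ((s - x)\<^sup>2 + t\<^sup>2)))) (at t)" by simp
    then show "((\<lambda>s. C + log_potential f (x, s)) has_real_derivative
        integral {-1..1} (\<lambda>s. f s * (t / ((s - x)\<^sup>2 + t\<^sup>2)))) (at t)"
      by (auto intro!: derivative_eq_intros)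
  qed
  then show ?thesis unfolding has_normal_deriv_def by simp
qed

text \<open>For s in the segment the distance to (s, 0) differs from norm y by at most 1, so ln u
  \<le> u - 1, applied to both quotients, bounds the difference of the logarithms by 1 / (norm y -
  1).\<close>

lemma log_potential_at_infinity:
  assumes f: "bounded_cont f"
  shows "((\<lambda>y. log_potential f y - ln (norm y) * (\<integral>s. f s \<partial>seg)) \<longlongrightarrow> 0) at_infinity"
proof -
  note f' = bounded_contD(1)[OF f]
  obtain M where M: "\<And>s. \<bar>f s\<bar> \<le> M" using bounded_contD(2)[OF f] by blast
  have M0: "M \<ge> 0" using M[of 0] by linarith
  have bound: "\<bar>log_potential f y - ln (norm y) * (\<integral>s. f s \<partial>seg)\<bar> \<le> 2 * M / (norm y - 1)" if y: "norm y > 1" for y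
  proof -
    let ?r = "norm y"
    have 1: "\<bar>ln (norm (y - (s, 0))) - ln ?r\<bar> \<le> 1 / (?r - 1)" if s: "s \<in> {-1..1}" for s
    proof -
      have n: "norm (s, 0::real) \<le> 1" using s by (auto simp: norm_Pair)
      have lo: "?r - 1 \<le> norm (y - (s, 0))" and hi: "norm (y - (s, 0)) \<le> ?r + 1"
        using norm_triangle_ineq2[of y "(s, 0)"] norm_triangle_ineq4[of y "(s, 0)"] n by linarith+
      have p: "norm (y - (s, 0)) > 0" "?r > 0" using lo y by linarith+
      then have ld: "ln (norm (y - (s, 0)) / ?r) = ln (norm (y - (s, 0))) - ln ?r"
        "ln (?r / norm (y - (s, 0))) = ln ?r - ln (norm (y - (s, 0)))" by (simp_all add: ln_div)
      have "ln (norm (y - (s, 0)) / ?r) \<le> norm (y - (s, 0)) / ?r - 1"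
        using lo y by (intro ln_le_minus_one divide_pos_pos) auto
      also have "\<dots> \<le> (?r + 1) / ?r - 1" using hi y by (intro diff_right_mono divide_right_mono) auto
      also have "\<dots> = 1 / ?r" using y by (subst add_divide_distrib) auto
      also have "\<dots> \<le> 1 / (?r - 1)" using y by (intro divide_left_mono mult_pos_pos) auto
      finally have u: "ln (norm (y - (s, 0))) - ln ?r \<le> 1 / (?r - 1)"
        unfolding ld .
      have "ln (?r / norm (y - (s, 0))) \<le> ?r / norm (y - (s, 0)) - 1"
        using lo y by (intro ln_le_minus_one divide_pos_pos) auto
      also have "\<dots> = (?r - norm (y - (s, 0))) / norm (y - (s, 0))" using p by (simp add: diff_divide_distrib)
      also have "\<dots> \<le> 1 / norm (y - (s, 0))" using lo y by (intro divide_right_mono) auto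
      also have "\<dots> \<le> 1 / (?r - 1)" using lo y p by (intro divide_left_mono mult_pos_pos) linarith+
      finally have "ln ?r - ln (norm (y - (s, 0))) \<le> 1 / (?r - 1)"
        unfolding ld .
      then show ?thesis using u by linarith
    qed
    have i1: "integrable seg (\<lambda>s. ln (norm (y - (s, 0))) * f s)" by (rule integrable_log_potential(1)[OF f' M])
    have i2: "integrable seg (\<lambda>s. ln ?r * f s)" using bounded_cont_integrable[OF f] by simp
    have "log_potential f y - ln ?r * (\<integral>s. f s \<partial>seg) = (\<integral>s. ln (norm (y - (s, 0))) * f s - ln ?r * f s \<partial>seg)"
      using i1 i2 by (simp add: log_potential_def)
    also have "\<bar>\<dots>\<bar> \<le> (\<integral>s. norm (ln (norm (y - (s, 0))) * f s - ln ?r * f s) \<partial>seg)"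
      by (rule abs_integral_le_integral_norm)
    also have "\<dots> \<le> (\<integral>s. 1 / (?r - 1) * M \<partial>seg)"
    proof (rule integral_mono_AE)
      show "AE s in seg. norm (ln (norm (y - (s, 0))) * f s - ln ?r * f s) \<le> 1 / (?r - 1) * M"
        using AE_seg
      proof eventually_elim
        case (elim s)
        have "norm (ln (norm (y - (s, 0))) * f s - ln ?r * f s) = \<bar>ln (norm (y - (s, 0))) - ln ?r\<bar> * \<bar>f s\<bar>"
          by (simp add: abs_mult flip: left_diff_distrib)
        also have "\<dots> \<le> 1 / (?r - 1) * M" using 1[of s] elim M[of s] y by (intro mult_mono) auto
        finally show ?case .
      qed
    qed (use i1 i2 in auto)
    also have "\<dots> = 2 * M / (?r - 1)" by simp
    finally show ?thesis .
  qed
  have lim: "((\<lambda>y::real\<times>real. 2 * M / (norm y - 1)) \<longlongrightarrow> 0) at_infinity"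
  proof -
    have "((\<lambda>r::real. 2 * M / (r - 1)) \<longlongrightarrow> 0) at_top" by real_asymp
    then show ?thesis by (rule filterlim_compose[OF _ filterlim_norm_at_top])
  qed
  have "\<forall>\<^sub>F y in at_infinity. norm (log_potential f y - ln (norm y) * (\<integral>s. f s \<partial>seg)) \<le> 2 * M / (norm y - 1)"
    unfolding eventually_at_infinity
  proof (intro exI[of _ 2] allI impI)
    fix y :: "real \<times> real" assume "2 \<le> norm y"
    then show "norm (log_potential f y - ln (norm y) * (\<integral>s. f s \<partial>seg)) \<le> 2 * M / (norm y - 1)"
      using bound[of y] by simp
  qed
  then show ?thesis using lim by (rule Lim_null_comparison)
qed

text \<open>Mass 1 normalises the growth to ln (norm y), and \<open>eq\<close> is the Robin
  condition because the normal derivative is - pi f x on the open segment.\<close>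

theorem robin_green_log_potential:
  assumes f: "bounded_cont f" and int: "(\<integral>s. f s \<partial>seg) = 1"
    and eq: "\<And>x. x \<in> {-1..1} \<Longrightarrow> \<mu> * (C + log_potential f (x, 0)) = pi * f x"
  shows "robin_green \<mu> (\<lambda>y. C + log_potential f y)"
    and "((\<lambda>y. C + log_potential f y - ln (norm y)) \<longlongrightarrow> C) at_infinity_half_plane"
proof -
  note f' = bounded_contD(1)[OF f]
  obtain M where M: "\<And>s. \<bar>f s\<bar> \<le> M" using bounded_contD(2)[OF f] by blast
  let ?g = "\<lambda>y. C + log_potential f y"
  have hol: "(\<lambda>z. of_real C + complex_potential f z) holomorphic_on {z. Im z > 0}"
    by (intro holomorphic_intros complex_potential_holomorphic f')
  have g: "?g y = Re (of_real C + complex_potential f (cpt y))" if "y \<in> upper_half_plane" for y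
    using log_potential_eq_Re[OF f that] by simp
  have "((\<lambda>y. C + (log_potential f y - ln (norm y) * (\<integral>s. f s \<partial>seg))) \<longlongrightarrow> C + 0) at_infinity"
    by (intro tendsto_intros log_potential_at_infinity f)
  then have "((\<lambda>y. ?g y - ln (norm y)) \<longlongrightarrow> C) at_infinity" by (simp add: int algebra_simps)
  then show lim: "((\<lambda>y. ?g y - ln (norm y)) \<longlongrightarrow> C) at_infinity_half_plane"
    unfolding at_infinity_half_plane_def by (rule filterlim_mono) auto
  show "robin_green \<mu> ?g"
    unfolding robin_green_def
  proof (intro conjI allI impI ballI)
    show "continuous_on (closure upper_half_plane) ?g"
      by (intro continuous_intros continuous_on_subset[OF continuous_log_potential[OF f' M]]) auto
    show "locally_finite_energy ?g" by (rule locally_finite_energy_potential[OF f]) simp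
    show "C2_on upper_half_plane ?g" by (rule C2_on_Re_holomorphic(1)[OF hol g])
    show "laplacian ?g y = 0" if "y \<in> upper_half_plane" for y
      by (rule C2_on_Re_holomorphic(2)[OF hol g that])
    show "has_normal_deriv ?g 0 x" if "\<bar>x\<bar> > 1" for x
      using has_normal_deriv_log_potential[OF f, of x C] that by simp
    show "\<exists>d. has_normal_deriv ?g d x \<and> d + \<mu> * (C + log_potential f (x, 0)) = 0" if "\<bar>x\<bar> < 1" for x
      using has_normal_deriv_log_potential[OF f, of x C] that eq[of x] by (intro exI[of _ "- (pi * f x)"]) (auto simp: abs_less_iff)
    show "(\<lambda>y. ?g y - ln (norm y)) \<in> O[at_infinity_half_plane](\<lambda>_. 1)"
      using lim by (intro bigoI_tendsto[of _ _ C]) auto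
  qed
qed

section \<open>The equilibrium measure of the segment\<close>

text \<open>Follows from u cos u \<le> sin u at u = x / 2 together with the double-angle formula and
  cos x \<ge> 0. It bounds \<open>log_sine\<close> from below near its singularity.\<close>

lemma sin_ge_half:
  fixes x :: real
  assumes x: "0 \<le> x" "x \<le> pi / 2"
  shows "x / 2 \<le> sin x"
proof -
  have tan: "u * cos u \<le> sin u" if u: "0 \<le> u" "u \<le> pi" for u :: real
  proof -
    have "sin 0 - 0 * cos 0 \<le> sin u - u * cos u"
    proof (rule DERIV_nonneg_imp_nondecreasing[OF u(1)])
      fix v assume v: "0 \<le> v" "v \<le> u"
      show "\<exists>y. ((\<lambda>v. sin v - v * cos v) has_real_derivative y) (at v) \<and> 0 \<le> y"
        by (rule exI[of _ "v * sin v"])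
           (use v u in \<open>auto intro!: derivative_eq_intros mult_nonneg_nonneg sin_ge_zero\<close>)
    qed
    then show ?thesis by simp
  qed
  have c: "cos (x / 2) \<ge> 0" "cos x \<ge> 0" using x by (auto intro!: cos_ge_zero)
  have "x / 2 \<le> x * ((1 + cos x) / 2)" using x(1) c by (simp add: field_simps)
  also have "\<dots> = 2 * ((x / 2) * cos (x / 2)) * cos (x / 2)"
    using cos_double_cos[of "x / 2"] by (simp add: power2_eq_square field_simps)
  also have "\<dots> \<le> 2 * sin (x / 2) * cos (x / 2)"
    using tan[of "x / 2"] x c by (intro mult_right_mono mult_left_mono) auto
  also have "\<dots> = sin x" using sin_double[of "x / 2"] by simp
  finally show ?thesis .
qed

text \<open>The logarithm of a chord: \<bar>2 sin (t / 2)\<bar> is the distance from 1 to the point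
  of the unit circle at angle t.\<close>

definition log_sine :: "real \<Rightarrow> real" where "log_sine t = ln \<bar>2 * sin (t / 2)\<bar>"

lemma log_sine_periodic: "log_sine (t + 2 * pi) = log_sine t"
proof -
  have "sin ((t + 2 * pi) / 2) = - sin (t / 2)" by (simp add: add_divide_distrib)
  then show ?thesis by (simp add: log_sine_def)
qed

lemma log_sine_even: "log_sine (- t) = log_sine t"
  by (simp add: log_sine_def)

lemma log_sine_integrable: "log_sine integrable_on {-pi..pi}"
proof -
  have m: "(\<lambda>t. indicator {-pi..pi} t *\<^sub>R log_sine t) \<in> borel_measurable lborel"
    unfolding log_sine_def by measurable
  have i: "integrable lborel (\<lambda>t. log_cut 1 t + indicator {-pi..pi} t * (2 * ln 2 + ln pi))"
  proof (rule Bochner_Integration.integrable_add)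
    show "integrable lborel (log_cut 1)"
      using nn_integral_log_cut[of 1 0] by (intro integrableI_nonneg) (auto simp: log_cut_nonneg)
  qed simp
  have b: "AE t in lborel. norm (indicator {-pi..pi} t *\<^sub>R log_sine t) \<le>
      norm (log_cut 1 t + indicator {-pi..pi} t * (2 * ln 2 + ln pi))"
    using AE_lborel_singleton[of 0]
  proof eventually_elim
    case (elim t)
    have lnpi: "ln pi \<ge> 0" using pi_ge_two by (intro ln_ge_zero) auto
    show ?case
    proof (cases "t \<in> {-pi..pi}")
      case True
      then have "\<bar>t\<bar> \<le> pi" by auto
      then have "\<bar>t\<bar> / 2 / 2 \<le> sin (\<bar>t\<bar> / 2)" by (intro sin_ge_half) auto
      then have "\<bar>t\<bar> / 2 \<le> \<bar>2 * sin (t / 2)\<bar>" using elim by (cases "t \<ge> 0") auto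
      then have "ln (\<bar>t\<bar> / 2) \<le> log_sine t" unfolding log_sine_def using elim by (intro ln_mono) auto
      then have lo: "ln \<bar>t\<bar> - ln 2 \<le> log_sine t" using elim by (simp add: ln_div)
      have up: "log_sine t \<le> ln 2"
      proof (cases "sin (t / 2) = 0")
        case True then show ?thesis by (simp add: log_sine_def)
      next
        case False
        then show ?thesis unfolding log_sine_def using abs_sin_le_one[of "t / 2"] by (intro ln_mono) (auto simp: abs_mult)
      qed
      have "- ln \<bar>t\<bar> \<le> log_cut 1 t" using elim by (auto simp: log_cut_def)
      then have "\<bar>log_sine t\<bar> \<le> log_cut 1 t + (2 * ln 2 + ln pi)"
        using lo up lnpi log_cut_nonneg[of 1 t] ln_gt_zero[of "2::real"] by linarith
      then show ?thesis using True by simp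
    qed simp
  qed
  have "set_integrable lborel {-pi..pi} log_sine"
    unfolding set_integrable_def by (rule Bochner_Integration.integrable_bound[OF i m b])
  then show ?thesis by (rule set_borel_integral_eq_integral(1))
qed

text \<open>Cut the window at b and translate its first piece by one period.\<close>

lemma has_integral_periodic_shift:
  fixes f :: "real \<Rightarrow> real"
  assumes per: "\<And>t. f (t + T) = f t" and int: "(f has_integral I) {a..a + T}"
    and b: "a \<le> b" "b \<le> a + T"
  shows "(f has_integral I) {b..b + T}"
proof -
  have i: "f integrable_on {a..a + T}" using int by (rule has_integral_integrable)
  have i1: "f integrable_on {a..b}" "f integrable_on {b..a + T}"
    using integrable_on_subinterval[OF i, of a b] integrable_on_subinterval[OF i, of b "a + T"] b by auto
  have sh: "(f has_integral integral {a..b} f) {a + T..b + T}"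
  proof -
    have "f \<circ> (+) T = f" using per by (auto simp: fun_eq_iff add.commute)
    then show ?thesis
      using has_integral_shift_Icc_real[of f T "integral {a..b} f" a b] integrable_integral[OF i1(1)] by simp
  qed
  have "(f has_integral integral {b..a + T} f + integral {a..b} f) {b..b + T}"
    by (rule has_integral_combine[OF _ _ integrable_integral[OF i1(2)] sh]) (use b in auto)
  moreover have "integral {a..b} f + integral {b..a + T} f = I"
    using Henstock_Kurzweil_Integration.integral_combine[OF b i] int by (simp add: integral_unique)
  ultimately show ?thesis by (simp add: add.commute)
qed


text \<open>Euler's argument: by the double-angle formula the value at 2 t is the sum of the values
  at t and at pi + t. Over a period each of the three terms integrates to D, so D = D + D.\<close>

lemma log_sine_has_integral_0: "(log_sine has_integral 0) {-pi..pi}"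
proof -
  define D where "D = integral {-pi..pi} log_sine"
  have D: "(log_sine has_integral D) {-pi..-pi + 2 * pi}"
    using integrable_integral[OF log_sine_integrable] by (simp add: D_def)
  have D': "(log_sine has_integral D) {-pi..pi}" using D by simp
  have D0: "(log_sine has_integral D) {0..2 * pi}"
    using has_integral_periodic_shift[OF log_sine_periodic D, of 0] by simp
  have "(log_sine has_integral D) {-(2 * pi)..0}"
  proof -
    have "log_sine \<circ> (+) (2 * pi) = log_sine" using log_sine_periodic by (auto simp: fun_eq_iff add.commute)
    then show ?thesis
      using has_integral_shift_Icc_real[of log_sine "2 * pi" D "- (2 * pi)" 0] D0 by simp
  qed
  then have "(log_sine has_integral D + D) {-(2 * pi)..2 * pi}"
    using D0 by (intro has_integral_combine[of _ 0]) auto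
  from has_integral_affinity'[of log_sine "D + D" "- (2 * pi)" "2 * pi" 2 0] this
  have dbl: "((\<lambda>t. log_sine (2 * t)) has_integral D) {-pi..pi}" by simp
  have "(log_sine has_integral D) {- pi + pi..pi + pi}" using D0 by simp
  then have "(log_sine \<circ> (+) pi has_integral D) {-pi..pi}"
    unfolding has_integral_shift_Icc_real .
  from has_integral_add[OF D' this]
  have "((\<lambda>t. log_sine t + log_sine (pi + t)) has_integral D + D) {-pi..pi}" by (simp add: o_def)
  then have sum: "((\<lambda>t. log_sine t + log_sine (pi + t)) has_integral D + D) {-pi..pi}" .
  \<comment> \<open>At the three excluded points one of the chords vanishes, and \<open>ln 0\<close>
    = 0 breaks the identity.\<close>
  have eq: "log_sine (2 * t) = log_sine t + log_sine (pi + t)" if t: "t \<in> {-pi..pi} - {-pi, 0, pi}" for t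
  proof -
    have s: "sin (t / 2) \<noteq> 0"
    proof
      assume "sin (t / 2) = 0"
      then show False using t sin_gt_zero[of "t / 2"] sin_gt_zero[of "- t / 2"] by (cases "t > 0") auto
    qed
    have c: "cos (t / 2) > 0" using t by (intro cos_gt_zero_pi) auto
    have "sin ((pi + t) / 2) = cos (t / 2)" by (simp add: add_divide_distrib sin_add)
    moreover have "sin t = 2 * sin (t / 2) * cos (t / 2)" using sin_double[of "t / 2"] by simp
    moreover have "ln (4::real) = 2 * ln 2" using ln_mult[of 2 "2::real"] by simp
    ultimately show ?thesis
      using s c by (simp add: log_sine_def abs_mult ln_mult)
  qed
  have "((\<lambda>t. log_sine (2 * t)) has_integral D + D) {-pi..pi}"
    by (rule has_integral_spike_finite[where S = "{-pi, 0, pi}", OF _ eq sum]) auto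
  then have "D + D = D" using dbl by (rule has_integral_unique)
  then show ?thesis using D' by simp
qed

text \<open>The potential of the equilibrium measure of \<open>[-1, 1]\<close>, i.e. of the image of the uniform
  measure on \<open>[0, \<pi>]\<close> under the cosine, is constant.\<close>

lemma equilibrium_potential:
  assumes \<theta>: "0 < \<theta>" "\<theta> < pi"
  shows "((\<lambda>\<eta>. ln 2 - ln \<bar>cos \<eta> - cos \<theta>\<bar>) has_integral 2 * pi * ln 2) {0..pi}"
proof -
  have per: "(log_sine has_integral 0) {\<theta> - pi..\<theta> - pi + 2 * pi}"
    using has_integral_periodic_shift[where f = log_sine and T = "2 * pi" and I = 0 and a = "- pi" and b = "\<theta> - pi"] log_sine_periodic log_sine_has_integral_0 \<theta> by simp
  then have per': "log_sine integrable_on {\<theta> - pi..\<theta> + pi}" by (auto simp: integrable_on_def algebra_simps)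
  \<comment> \<open>For \<eta> in [0, pi] the angle \<theta> + \<eta> sweeps
    [\<theta>, \<theta> + pi], and \<theta> - \<eta>, interchangeable with \<eta> - \<theta> by
    evenness, sweeps [\<theta> - pi, \<theta>]. Together they fill one period, over which the
    integral is 0.\<close>
  define A B where "A = integral {\<theta> - pi..\<theta>} log_sine" and "B = integral {\<theta>..\<theta> + pi} log_sine"
  have iA: "(log_sine has_integral A) {\<theta> - pi..\<theta>}" and iB: "(log_sine has_integral B) {\<theta>..\<theta> + pi}"
    unfolding A_def B_def using \<theta> by (auto intro!: integrable_integral integrable_on_subinterval[OF per'])
  have AB: "A + B = 0"
  proof -
    have "(log_sine has_integral A + B) {\<theta> - pi..\<theta> + pi}"
      by (rule has_integral_combine[OF _ _ iA iB]) auto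
    then show ?thesis using per has_integral_unique by (simp add: algebra_simps) blast
  qed
  have 1: "((\<lambda>\<eta>. log_sine (\<theta> + \<eta>)) has_integral B) {0..pi}"
    using has_integral_shift_Icc_real[of log_sine \<theta> B 0 pi] iB by (simp add: o_def add.commute)
  have 2: "((\<lambda>\<eta>. log_sine (- \<theta> + \<eta>)) has_integral A) {0..pi}"
  proof -
    have "((\<lambda>t. log_sine (- t)) has_integral A) {- \<theta>..- (\<theta> - pi)}"
      using iA by (subst has_integral_reflect_real)
    then have "(log_sine has_integral A) {0 + - \<theta>..pi + - \<theta>}"
      by (simp add: log_sine_even)
    then show ?thesis unfolding has_integral_shift_Icc_real[symmetric] by (simp add: o_def)
  qed
  have "((\<lambda>\<eta>. log_sine (\<theta> + \<eta>) + log_sine (- \<theta> + \<eta>)) has_integral 0) {0..pi}"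
    using has_integral_add[OF 1 2] AB by (simp add: add.commute)
  from has_integral_diff[OF has_integral_const_real[of "2 * ln 2" 0 pi] this]
  have int: "((\<lambda>\<eta>. 2 * ln 2 - (log_sine (\<theta> + \<eta>) + log_sine (- \<theta> + \<eta>))) has_integral 2 * pi * ln 2) {0..pi}"
    by (simp add: mult_ac)
  \<comment> \<open>\<bar>cos \<eta> - cos \<theta>\<bar> is half the product of two chords, which
    accounts for the second ln 2.\<close>
  have eq: "ln 2 - ln \<bar>cos \<eta> - cos \<theta>\<bar> = 2 * ln 2 - (log_sine (\<theta> + \<eta>) + log_sine (- \<theta> + \<eta>))"
    if \<eta>: "\<eta> \<in> {0..pi} - {\<theta>}" for \<eta>
  proof -
    have s1: "sin ((\<theta> + \<eta>) / 2) \<noteq> 0"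
      using \<eta> \<theta> sin_gt_zero[of "(\<theta> + \<eta>) / 2"] by auto
    have s2: "sin ((\<eta> - \<theta>) / 2) \<noteq> 0"
      using \<eta> \<theta> sin_gt_zero[of "(\<eta> - \<theta>) / 2"] sin_gt_zero[of "(\<theta> - \<eta>) / 2"] sin_minus[of "(\<eta> - \<theta>) / 2"]
      by (cases "\<eta> > \<theta>") (auto simp: minus_divide_left)
    have "cos \<eta> - cos \<theta> = 2 * sin ((\<eta> + \<theta>) / 2) * sin ((\<theta> - \<eta>) / 2)" by (rule cos_diff_cos)
    moreover have "sin ((\<theta> - \<eta>) / 2) = - sin ((\<eta> - \<theta>) / 2)" using sin_minus[of "(\<eta> - \<theta>) / 2"] by (simp add: minus_divide_left)
    ultimately have "\<bar>cos \<eta> - cos \<theta>\<bar> = 2 * \<bar>sin ((\<theta> + \<eta>) / 2)\<bar> * \<bar>sin ((\<eta> - \<theta>) / 2)\<bar>"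
      by (simp add: abs_mult add.commute)
    then show ?thesis using s1 s2 by (simp add: log_sine_def abs_mult ln_mult)
  qed
  show ?thesis
    by (rule has_integral_spike_finite[where S = "{\<theta>}", OF _ eq int]) auto
qed

section \<open>Uniqueness and monotonicity\<close>

lemma at_infinity_half_plane_neq_bot: "at_infinity_half_plane \<noteq> bot"
proof
  assume "at_infinity_half_plane = bot"
  then have "\<forall>\<^sub>F y in at_infinity_half_plane. False" by simp
  then obtain b where b: "\<And>y. norm y \<ge> b \<Longrightarrow> y \<in> closure upper_half_plane \<Longrightarrow> False"
    unfolding at_infinity_half_plane_def eventually_inf_principal eventually_at_infinity by auto
  show False using b[of "(0, \<bar>b\<bar>)"] abs_ge_self[of b] by (simp add: norm_Pair closure_upper_half_plane)
qed

lemma eventually_in_closure_half_plane: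
  "\<forall>\<^sub>F y in at_infinity_half_plane. y \<in> closure upper_half_plane"
  unfolding at_infinity_half_plane_def eventually_inf_principal by simp

text \<open>The logarithms cancel in g - h, so it is bounded at infinity and solves the homogeneous
  problem; the maximum principle gives g \<le> h. With the roles exchanged this yields uniqueness of
  the constant.\<close>

lemma robin_green_const_le:
  assumes mu: "\<mu> > 0" and g: "robin_green \<mu> g" and h: "robin_green \<mu> h"
    and c: "((\<lambda>y. g y - ln (norm y)) \<longlongrightarrow> c) at_infinity_half_plane"
    and d: "((\<lambda>y. h y - ln (norm y)) \<longlongrightarrow> d) at_infinity_half_plane"
  shows "c \<le> d"
proof -
  define w where "w y = g y + (-1) * h y" for y
  have lim: "(w \<longlongrightarrow> c - d) at_infinity_half_plane"
    using tendsto_diff[OF c d] by (simp add: w_def[abs_def])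
  have bd: "\<forall>\<^sub>F y in at_infinity_half_plane. w y \<le> c - d + 1"
    using order_tendstoD(2)[OF lim, of "c - d + 1"] by (auto elim: eventually_mono)
  have w0: "w y \<le> 0" if y: "y \<in> closure upper_half_plane" for y
  proof (rule robin_maximum_principle[OF _ _ _ _ mu bd y])
    show "continuous_on (closure upper_half_plane) w"
      using g h unfolding w_def robin_green_def by (intro continuous_intros) auto
    show "laplacian_at w y 0" if y: "y \<in> upper_half_plane" for y
    proof -
      have "laplacian_at g y 0" "laplacian_at h y 0"
        using laplacian_at_C2_on[OF _ open_upper_half_plane y] g h y unfolding robin_green_def by metis+
      from laplacian_at_add[OF this(1) laplacian_at_cmult[OF this(2), of "-1"]]
      show ?thesis unfolding w_def[abs_def] by simp
    qed
    show "has_normal_deriv w 0 x" if "\<bar>x\<bar> > 1" for x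
    proof -
      have "has_normal_deriv g 0 x" "has_normal_deriv h 0 x" using g h that unfolding robin_green_def by auto
      from has_normal_deriv_add[OF this(1) has_normal_deriv_cmult[OF this(2), of "-1"]]
      show ?thesis unfolding w_def[abs_def] by simp
    qed
    show "\<exists>d. has_normal_deriv w d x \<and> d + \<mu> * w (x, 0) = 0" if x: "\<bar>x\<bar> < 1" for x
    proof -
      obtain a where a: "has_normal_deriv g a x" "a + \<mu> * g (x, 0) = 0"
        using g x unfolding robin_green_def by auto
      obtain b where b: "has_normal_deriv h b x" "b + \<mu> * h (x, 0) = 0"
        using h x unfolding robin_green_def by auto
      have "has_normal_deriv w (a + (-1) * b) x"
        unfolding w_def[abs_def] by (rule has_normal_deriv_add[OF a(1) has_normal_deriv_cmult[OF b(1)]])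
      moreover have "a + (-1) * b + \<mu> * w (x, 0) = 0" using a(2) b(2) by (simp add: w_def algebra_simps)
      ultimately show ?thesis by blast
    qed
  qed
  have "\<forall>\<^sub>F y in at_infinity_half_plane. w y \<le> 0"
    using eventually_in_closure_half_plane by eventually_elim (rule w0)
  from tendsto_upperbound[OF lim this at_infinity_half_plane_neq_bot] show ?thesis by simp
qed

lemma robin_const_eqI:
  assumes mu: "\<mu> > 0" and g: "robin_green \<mu> g"
    and c: "((\<lambda>y. g y - ln (norm y)) \<longlongrightarrow> c) at_infinity_half_plane"
  shows "robin_const \<mu> = c"
  unfolding robin_const_def
proof (rule the_equality)
  show "\<exists>g. robin_green \<mu> g \<and> ((\<lambda>y. g y - ln (norm y)) \<longlongrightarrow> c) at_infinity_half_plane"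
    using g c by blast
  fix d assume "\<exists>g. robin_green \<mu> g \<and> ((\<lambda>y. g y - ln (norm y)) \<longlongrightarrow> d) at_infinity_half_plane"
  then obtain h where "robin_green \<mu> h" "((\<lambda>y. h y - ln (norm y)) \<longlongrightarrow> d) at_infinity_half_plane" by blast
  then show "d = c" using robin_green_const_le[OF mu] g c by (meson order_antisym)
qed

text \<open>The logarithmic growth bounds - g from above at infinity, so the maximum principle
  applies to it. On the segment this will give the sign of the density.\<close>

lemma robin_green_nonneg:
  assumes mu: "\<mu> > 0" and g: "robin_green \<mu> g"
    and c: "((\<lambda>y. g y - ln (norm y)) \<longlongrightarrow> c) at_infinity_half_plane"
    and y: "y \<in> closure upper_half_plane"
  shows "g y \<ge> 0"
proof -
  define w where "w y = (-1) * g y" for y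
  have "\<forall>\<^sub>F y in at_infinity. norm (y::real\<times>real) \<ge> 1" unfolding eventually_at_infinity by auto
  then have "\<forall>\<^sub>F y in at_infinity_half_plane. norm (y::real\<times>real) \<ge> 1"
    unfolding at_infinity_half_plane_def by (auto simp: eventually_inf_principal elim: eventually_mono)
  moreover have "\<forall>\<^sub>F y in at_infinity_half_plane. c - 1 < g y - ln (norm y)"
    by (rule order_tendstoD(1)[OF c]) simp
  ultimately have bd: "\<forall>\<^sub>F y in at_infinity_half_plane. w y \<le> 1 - c"
  proof eventually_elim
    case (elim y)
    then have "ln (norm y) \<ge> 0" by simp
    then show ?case unfolding w_def using elim(2) by linarith
  qed
  have "w y \<le> 0"
  proof (rule robin_maximum_principle[OF _ _ _ _ mu bd y])
    show "continuous_on (closure upper_half_plane) w"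
      using g unfolding w_def robin_green_def by (intro continuous_intros) auto
    show "laplacian_at w y 0" if y: "y \<in> upper_half_plane" for y
    proof -
      have "laplacian_at g y 0"
        using laplacian_at_C2_on[OF _ open_upper_half_plane y] g y unfolding robin_green_def by metis
      from laplacian_at_cmult[OF this, of "-1"] show ?thesis unfolding w_def[abs_def] by simp
    qed
    show "has_normal_deriv w 0 x" if "\<bar>x\<bar> > 1" for x
    proof -
      have "has_normal_deriv g 0 x" using g that unfolding robin_green_def by auto
      from has_normal_deriv_cmult[OF this, of "-1"] show ?thesis unfolding w_def[abs_def] by simp
    qed
    show "\<exists>d. has_normal_deriv w d x \<and> d + \<mu> * w (x, 0) = 0" if x: "\<bar>x\<bar> < 1" for x
    proof -
      obtain a where a: "has_normal_deriv g a x" "a + \<mu> * g (x, 0) = 0"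
        using g x unfolding robin_green_def by auto
      have "has_normal_deriv w ((-1) * a) x"
        unfolding w_def[abs_def] by (rule has_normal_deriv_cmult[OF a(1)])
      moreover have "(-1) * a + \<mu> * w (x, 0) = 0" using a(2) by (simp add: w_def)
      ultimately show ?thesis by blast
    qed
  qed
  then show ?thesis by (simp add: w_def)
qed

section \<open>The solution of the integral equation and its mass as functions of l\<close>

definition robin_density :: "real \<Rightarrow> real \<Rightarrow> real" where
  "robin_density l = (SOME f. bounded_cont f \<and> (\<forall>x\<in>{-1..1}. f x + l * log_op f x = 1))"

definition robin_mass :: "real \<Rightarrow> real" where
  "robin_mass l = l * (\<integral>x. robin_density l x \<partial>seg)"

lemma robin_density:
  assumes "l \<ge> 0"
  shows "bounded_cont (robin_density l)"
    and "x \<in> {-1..1} \<Longrightarrow> robin_density l x + l * log_op (robin_density l) x = 1"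
  using someI_ex[OF log_equation_solvable[OF assms]] unfolding robin_density_def[symmetric] by auto

lemma log_op_diff:
  assumes p: "bounded_cont p" and q: "bounded_cont q"
  shows "log_op (\<lambda>x. p x - q x) x = log_op p x - log_op q x"
proof -
  have "integrable seg (\<lambda>s. (ln 2 - ln \<bar>x - s\<bar>) * f s)" if "bounded_cont f" for f
    using bounded_contD[OF that] integrable_log_op by blast
  then show ?thesis using p q by (simp add: log_op_def right_diff_distrib)
qed

text \<open>The integral equation in weak form, from which the energy identities below are
  drawn.\<close>

lemma robin_density_test:
  assumes l: "l \<ge> 0" and q: "bounded_cont q"
  shows "(\<integral>x. q x * robin_density l x \<partial>seg) + l * (\<integral>x. q x * log_op (robin_density l) x \<partial>seg) = (\<integral>x. q x \<partial>seg)"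
proof -
  note f = robin_density[OF l]
  have i: "integrable seg (\<lambda>x. q x * robin_density l x)" "integrable seg (\<lambda>x. q x * log_op (robin_density l) x)"
    using bounded_cont_integrable[OF bounded_cont_mult[OF q f(1)]] integrable_mult_log_op[OF q f(1)] by auto
  have "(\<integral>x. q x * robin_density l x \<partial>seg) + l * (\<integral>x. q x * log_op (robin_density l) x \<partial>seg) =
      (\<integral>x. q x * robin_density l x + l * (q x * log_op (robin_density l) x) \<partial>seg)"
    using i by simp
  also have "\<dots> = (\<integral>x. q x \<partial>seg)"
  proof (rule integral_cong_AE)
    show "AE x in seg. q x * robin_density l x + l * (q x * log_op (robin_density l) x) = q x"
      using AE_seg
    proof eventually_elim
      case (elim x)
      have "q x * robin_density l x + l * (q x * log_op (robin_density l) x) =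
          q x * (robin_density l x + l * log_op (robin_density l) x)" by (simp add: algebra_simps)
      then show ?case using f(2)[of x] elim by simp
    qed
  qed (use i borel_measurable_integrable bounded_cont_integrable[OF q] in auto)
  finally show ?thesis .
qed

text \<open>Test the equation with its own solution and drop the nonnegative quadratic form.\<close>

lemma robin_density_L2_le:
  assumes l: "l \<ge> 0"
  shows "(\<integral>x. (robin_density l x)\<^sup>2 \<partial>seg) \<le> (\<integral>x. robin_density l x \<partial>seg)"
  using robin_density_test[OF l robin_density(1)[OF l]]
    mult_nonneg_nonneg[OF l log_op_nonneg[OF robin_density(1)[OF l]]]
  unfolding power2_eq_square by linarith

text \<open>If f vanished almost everywhere, so would the integral in the equation at every point,
  and the equation would force f = 1 on the segment.\<close>

lemma robin_density_L2_pos: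
  assumes l: "l \<ge> 0"
  shows "(\<integral>x. (robin_density l x)\<^sup>2 \<partial>seg) > 0"
proof (rule ccontr)
  let ?f = "robin_density l"
  note f = robin_density[OF l]
  have i: "integrable seg (\<lambda>x. (?f x)\<^sup>2)"
    using bounded_cont_integrable[OF bounded_cont_mult[OF f(1) f(1)]] by (simp add: power2_eq_square)
  assume "\<not> ?thesis"
  moreover have "(\<integral>x. (?f x)\<^sup>2 \<partial>seg) \<ge> 0" by simp
  ultimately have "(\<integral>x. (?f x)\<^sup>2 \<partial>seg) = 0" by linarith
  then have "AE x in seg. (?f x)\<^sup>2 = 0"
    using integral_nonneg_eq_0_iff_AE[OF i] by simp
  then have ae: "AE x in seg. ?f x = 0" by simp
  note [measurable] = bounded_cont_measurable[OF f(1)]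
  have "log_op ?f x = (\<integral>s. 0 \<partial>seg)" for x
    unfolding log_op_def
  proof (rule integral_cong_AE)
    show "AE s in seg. (ln 2 - ln \<bar>x - s\<bar>) * ?f s = 0" using ae by eventually_elim simp
  qed measurable
  then have one: "?f x = 1" if "x \<in> {-1..1}" for x using f(2)[OF that] by simp
  have "AE x in seg. False" using ae AE_seg
  proof eventually_elim
    case (elim x)
    then show ?case using one[of x] by simp
  qed
  then show False using AE_iff_measurable[of UNIV seg "\<lambda>_. False"] emeasure_seg_UNIV by simp
qed

text \<open>For the upper bound, Cauchy-Schwarz over length 2 and \<open>robin_density_L2_le\<close>
  bound the square of the integral by twice the integral.\<close>

lemma robin_density_integral_bounds:
  assumes l: "l \<ge> 0"
  shows "0 < (\<integral>x. robin_density l x \<partial>seg)" "(\<integral>x. robin_density l x \<partial>seg) \<le> 2"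
proof -
  let ?I = "\<integral>x. robin_density l x \<partial>seg"
  show pos: "0 < ?I" using robin_density_L2_le[OF l] robin_density_L2_pos[OF l] by linarith
  have "\<bar>?I\<bar> \<le> (\<integral>x. \<bar>robin_density l x\<bar> \<partial>seg)" by (rule integral_abs_bound)
  then have "?I\<^sup>2 \<le> (\<integral>x. \<bar>robin_density l x\<bar> \<partial>seg)\<^sup>2" using pos by (intro power_mono) auto
  also have "\<dots> \<le> 2 * ?I"
    using seg_L1_power2_le_L2[OF robin_density(1)[OF l]] robin_density_L2_le[OF l] by linarith
  finally have "?I * ?I \<le> 2 * ?I" by (simp add: power2_eq_square)
  then show "?I \<le> 2" using pos by simp
qed

lemma robin_mass_pos: "l > 0 \<Longrightarrow> robin_mass l > 0"
  using robin_density_integral_bounds(1)[of l] by (simp add: robin_mass_def)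

lemma robin_mass_le: "l > 0 \<Longrightarrow> robin_mass l \<le> 2 * l"
  using robin_density_integral_bounds(2)[of l] by (simp add: robin_mass_def mult.commute)

text \<open>Dirichlet-type principle: \<open>robin_mass l\<close> is the maximum of the right-hand side over \<open>q\<close>,
  attained at \<open>l * robin_density l\<close>.\<close>

lemma robin_mass_variational:
  assumes l: "l > 0" and q: "bounded_cont q"
  shows "robin_mass l \<ge> 2 * (\<integral>x. q x \<partial>seg) - (\<integral>x. (q x)\<^sup>2 \<partial>seg) / l - (\<integral>x. q x * log_op q x \<partial>seg)"
proof -
  have l0: "l \<ge> 0" using l by simp
  let ?f = "robin_density l"
  note f = robin_density[OF l0]
  let ?p = "\<lambda>x. l * ?f x"
  have p: "bounded_cont ?p" by (rule bounded_cont_cmult[OF f(1)])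
  let ?d = "\<lambda>x. q x - ?p x"
  have d: "bounded_cont ?d" by (rule bounded_cont_diff[OF q p])
  have lp: "log_op ?p x = l * log_op ?f x" for x
    unfolding log_op_def by (simp add: mult.left_commute)
  have i: "integrable seg (\<lambda>x. (q x)\<^sup>2)" "integrable seg (\<lambda>x. q x * ?f x)" "integrable seg (\<lambda>x. (?f x)\<^sup>2)"
    using bounded_cont_integrable[OF bounded_cont_mult[OF q q]] bounded_cont_integrable[OF bounded_cont_mult[OF q f(1)]]
      bounded_cont_integrable[OF bounded_cont_mult[OF f(1) f(1)]] by (auto simp: power2_eq_square)
  note j = integrable_mult_log_op[OF q q] integrable_mult_log_op[OF q f(1)]
    integrable_mult_log_op[OF f(1) q] integrable_mult_log_op[OF f(1) f(1)]
  \<comment> \<open>The gap between the two sides of the claim is this quadratic form at q - l f,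
    which is nonnegative by positive definiteness.\<close>
  have "0 \<le> (\<integral>x. (?d x)\<^sup>2 \<partial>seg) / l + (\<integral>x. ?d x * log_op ?d x \<partial>seg)"
    using log_op_nonneg[OF d] l by (intro add_nonneg_nonneg divide_nonneg_nonneg) auto
  also have "(\<integral>x. (?d x)\<^sup>2 \<partial>seg) = (\<integral>x. (q x)\<^sup>2 - 2 * l * (q x * ?f x) + l\<^sup>2 * (?f x)\<^sup>2 \<partial>seg)"
    by (rule Bochner_Integration.integral_cong) (auto simp: power2_eq_square algebra_simps)
  also have "\<dots> = (\<integral>x. (q x)\<^sup>2 \<partial>seg) - 2 * l * (\<integral>x. q x * ?f x \<partial>seg) + l\<^sup>2 * (\<integral>x. (?f x)\<^sup>2 \<partial>seg)"
    using i by simp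
  also have "(\<integral>x. ?d x * log_op ?d x \<partial>seg) = (\<integral>x. q x * log_op q x - l * (q x * log_op ?f x)
      - l * (?f x * log_op q x) + l\<^sup>2 * (?f x * log_op ?f x) \<partial>seg)"
    unfolding log_op_diff[OF q p] lp
    by (rule Bochner_Integration.integral_cong) (auto simp: power2_eq_square algebra_simps)
  also have "\<dots> = (\<integral>x. q x * log_op q x \<partial>seg) - l * (\<integral>x. q x * log_op ?f x \<partial>seg)
      - l * (\<integral>x. ?f x * log_op q x \<partial>seg) + l\<^sup>2 * (\<integral>x. ?f x * log_op ?f x \<partial>seg)"
    using j by simp
  also have "(\<integral>x. ?f x * log_op q x \<partial>seg) = (\<integral>x. q x * log_op ?f x \<partial>seg)"
    by (rule log_op_symmetric[OF f(1) q])
  finally have main: "0 \<le> ((\<integral>x. (q x)\<^sup>2 \<partial>seg) - 2 * l * (\<integral>x. q x * ?f x \<partial>seg) + l\<^sup>2 * (\<integral>x. (?f x)\<^sup>2 \<partial>seg)) / l +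
      ((\<integral>x. q x * log_op q x \<partial>seg) - l * (\<integral>x. q x * log_op ?f x \<partial>seg)
      - l * (\<integral>x. q x * log_op ?f x \<partial>seg) + l\<^sup>2 * (\<integral>x. ?f x * log_op ?f x \<partial>seg))" .
  \<comment> \<open>The weak equation, tested with q and with f, turns the mixed terms into the
    linear term in q and the mass.\<close>
  have t1: "(\<integral>x. q x * ?f x \<partial>seg) = (\<integral>x. q x \<partial>seg) - l * (\<integral>x. q x * log_op ?f x \<partial>seg)"
    using robin_density_test[OF l0 q] by simp
  have t2: "(\<integral>x. (?f x)\<^sup>2 \<partial>seg) = (\<integral>x. ?f x \<partial>seg) - l * (\<integral>x. ?f x * log_op ?f x \<partial>seg)"
    using robin_density_test[OF l0 f(1)] by (simp add: power2_eq_square)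
  show ?thesis
    using main l unfolding t1 t2 robin_mass_def by (simp add: field_simps power2_eq_square)
qed

text \<open>The maximiser for l is a competitor for l'. Only its L2 term changes, being divided by
  l' instead of l, and the gain is strict because the solution is not zero almost
  everywhere.\<close>

lemma robin_mass_strict_mono:
  assumes l: "0 < l" "l < l'"
  shows "robin_mass l < robin_mass l'"
proof -
  have l0: "l \<ge> 0" using l by simp
  let ?f = "robin_density l"
  note f = robin_density[OF l0]
  have p: "bounded_cont (\<lambda>x. l * ?f x)" by (rule bounded_cont_cmult[OF f(1)])
  have lp: "log_op (\<lambda>x. l * ?f x) x = l * log_op ?f x" for x
    unfolding log_op_def by (simp add: mult.left_commute)
  let ?Q = "\<integral>x. (?f x)\<^sup>2 \<partial>seg"
  have t2: "?Q + l * (\<integral>x. ?f x * log_op ?f x \<partial>seg) = (\<integral>x. ?f x \<partial>seg)"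
    using robin_density_test[OF l0 f(1)] by (simp add: power2_eq_square)
  have "robin_mass l' \<ge> 2 * (\<integral>x. l * ?f x \<partial>seg) - (\<integral>x. (l * ?f x)\<^sup>2 \<partial>seg) / l'
      - (\<integral>x. (l * ?f x) * log_op (\<lambda>x. l * ?f x) x \<partial>seg)"
    using l by (intro robin_mass_variational p) auto
  also have "(\<integral>x. (l * ?f x)\<^sup>2 \<partial>seg) = l\<^sup>2 * ?Q" by (simp add: power_mult_distrib)
  also have "(\<integral>x. (l * ?f x) * log_op (\<lambda>x. l * ?f x) x \<partial>seg) = l\<^sup>2 * (\<integral>x. ?f x * log_op ?f x \<partial>seg)"
  proof -
    have "(\<lambda>x. (l * ?f x) * (l * log_op ?f x)) = (\<lambda>x. l\<^sup>2 * (?f x * log_op ?f x))"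
      by (simp add: fun_eq_iff power2_eq_square)
    then show ?thesis unfolding lp by simp
  qed
  also have "l\<^sup>2 * (\<integral>x. ?f x * log_op ?f x \<partial>seg) = l * ((\<integral>x. ?f x \<partial>seg) - ?Q)"
    unfolding t2[symmetric] by (simp add: power2_eq_square)
  finally have "robin_mass l' \<ge> robin_mass l + (l * ?Q - l\<^sup>2 * ?Q / l')"
    by (simp add: robin_mass_def algebra_simps)
  moreover have "l * ?Q - l\<^sup>2 * ?Q / l' = l * ?Q * (1 - l / l')"
    by (simp add: power2_eq_square algebra_simps)
  moreover have "l * ?Q * (1 - l / l') > 0"
    using l robin_density_L2_pos[OF l0] by simp
  ultimately show ?thesis by linarith
qed

text \<open>Dividing f by its integral I gives a density of mass 1 whose Green's function equals f /
  (l I) on the segment. The constant is read off from this, and the sign of f from the sign of the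
  Green's function.\<close>

lemma robin_const_eq:
  assumes l: "l > 0"
  shows "robin_const (pi * l) = 1 / robin_mass l - ln 2"
    and "x \<in> {-1..1} \<Longrightarrow> robin_density l x \<ge> 0"
proof -
  have l0: "l \<ge> 0" using l by simp
  let ?f = "robin_density l"
  note f = robin_density[OF l0]
  define I where "I = (\<integral>x. ?f x \<partial>seg)"
  have I: "I > 0" using robin_density_integral_bounds(1)[OF l0] by (simp add: I_def)
  define h where "h x = (1 / I) * ?f x" for x
  have h: "bounded_cont h" unfolding h_def[abs_def] by (rule bounded_cont_cmult[OF f(1)])
  have hI: "(\<integral>x. h x \<partial>seg) = 1" using I by (simp add: h_def I_def)
  \<comment> \<open>The value for which the constants in C + ln 2 - \<open>log_op h\<close> cancel
    on the segment, leaving a multiple of f.\<close>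
  define C where "C = 1 / (l * I) - ln 2"
  have val: "C + log_potential h (x, 0) = ?f x / (l * I)" if x: "x \<in> {-1..1}" for x
  proof -
    obtain M where M: "\<And>s. \<bar>h s\<bar> \<le> M" using bounded_contD(2)[OF h] by blast
    have "log_op h x = log_op ?f x / I" by (simp add: log_op_def h_def)
    also have "log_op ?f x = (1 - ?f x) / l" using f(2)[OF x] l by (simp add: field_simps)
    finally have "log_op h x = (1 - ?f x) / (l * I)" by simp
    moreover have "log_op h x = ln 2 - log_potential h (x, 0)"
      using log_op_eq[OF bounded_contD(1)[OF h] M, of x] hI by simp
    ultimately show ?thesis by (simp add: C_def diff_divide_distrib)
  qed
  have mu: "pi * l > 0" using l by simp
  have eq: "(pi * l) * (C + log_potential h (x, 0)) = pi * h x" if "x \<in> {-1..1}" for x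
    unfolding val[OF that] using l by (simp add: h_def)
  note g = robin_green_log_potential[OF h hI eq]
  have "robin_const (pi * l) = C" by (rule robin_const_eqI[OF mu g])
  then show "robin_const (pi * l) = 1 / robin_mass l - ln 2" by (simp add: C_def robin_mass_def I_def)
  assume x: "x \<in> {-1..1}"
  have "(x, 0) \<in> closure upper_half_plane" by (simp add: closure_upper_half_plane)
  from robin_green_nonneg[OF mu g this] have "C + log_potential h (x, 0) \<ge> 0" .
  then show "?f x \<ge> 0" unfolding val[OF x] using mult_pos_pos[OF l I] by (auto simp: zero_le_divide_iff)
qed

section \<open>Limits of the constant term\<close>

text \<open>Kernel and density are nonnegative on the segment, so the integral term can only push
  the solution below 1.\<close>

lemma robin_density_le_1:
  assumes l: "l > 0" and x: "x \<in> {-1..1}"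
  shows "robin_density l x \<le> 1"
proof -
  have l0: "l \<ge> 0" using l by simp
  have "log_op (robin_density l) x \<ge> 0"
    unfolding log_op_def
  proof (rule integral_nonneg_AE)
    show "AE s in seg. 0 \<le> (ln 2 - ln \<bar>x - s\<bar>) * robin_density l s"
      using AE_seg AE_seg_neq[of x]
    proof eventually_elim
      case (elim s)
      then have "s \<in> {-1..1}" by simp
      then show ?case
        using log_kernel_bounds(1)[OF x _ elim(2)] robin_const_eq(2)[OF l] by (intro mult_nonneg_nonneg) auto
    qed
  qed
  then have "l * log_op (robin_density l) x \<ge> 0" using l by simp
  then show ?thesis using robin_density(2)[OF l0 x] by linarith
qed

text \<open>Pairing the integral equation with the equilibrium measure, whose potential is constant.\<close>

lemma robin_mass_eq:
  assumes l: "l > 0"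
  shows "2 * ln 2 * robin_mass l = 1 - integral {0..pi} (\<lambda>\<eta>. robin_density l (cos \<eta>)) / pi"
proof -
  let ?f = "robin_density l"
  have l0: "l \<ge> 0" using l by simp
  note f = robin_density[OF l0]
  note fc = bounded_contD(1)[OF f(1)]
  obtain M where M: "\<And>s. \<bar>?f s\<bar> \<le> M" using bounded_contD(2)[OF f(1)] by blast
  note [measurable] = bounded_cont_measurable[OF f(1)]
  note f0 = robin_const_eq(2)[OF l] and f1 = robin_density_le_1[OF l]
  have cosr: "cos \<eta> \<in> {-1..1}" for \<eta> :: real by simp
  have cc: "continuous_on A (\<lambda>\<eta>. ?f (cos \<eta>))" for A
    by (rule continuous_on_compose2[OF fc]) (auto intro!: continuous_intros)
  let ?k = "\<lambda>\<eta> s::real. ln 2 - ln \<bar>cos \<eta> - s\<bar>"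
  let ?J = "integral {0..pi} (\<lambda>\<eta>. ?f (cos \<eta>))"
  let ?I = "\<integral>s. ?f s \<partial>seg"
  \<comment> \<open>When cos \<eta> = s, the convention \<open>ln 0\<close> = 0 leaves ln 2, which
    is still nonnegative.\<close>
  have k0: "?k \<eta> s \<ge> 0" if "s \<in> {-1..1}" for \<eta> s
  proof (cases "cos \<eta> = s")
    case False
    then show ?thesis using log_kernel_bounds(1)[OF cosr that] by auto
  qed simp
  have inner: "(\<integral>\<^sup>+ s. ennreal (?k \<eta> s) * ennreal (?f s) \<partial>seg) = ennreal ((1 - ?f (cos \<eta>)) / l)" for \<eta>
  proof -
    have "(\<integral>\<^sup>+ s. ennreal (?k \<eta> s) * ennreal (?f s) \<partial>seg) = (\<integral>\<^sup>+ s. ennreal (?k \<eta> s * ?f s) \<partial>seg)"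
    proof (rule nn_integral_cong_AE)
      show "AE s in seg. ennreal (?k \<eta> s) * ennreal (?f s) = ennreal (?k \<eta> s * ?f s)"
        using AE_seg
      proof eventually_elim
        case (elim s)
        then have "s \<in> {-1..1}" by simp
        then show ?case using ennreal_mult[OF k0 f0] by simp
      qed
    qed
    also have "\<dots> = ennreal (\<integral>s. ?k \<eta> s * ?f s \<partial>seg)"
    proof (rule nn_integral_eq_integral)
      show "integrable seg (\<lambda>s. ?k \<eta> s * ?f s)" by (rule integrable_log_op[OF fc M])
      show "AE s in seg. 0 \<le> ?k \<eta> s * ?f s"
        using AE_seg
      proof eventually_elim
        case (elim s)
        then have "s \<in> {-1..1}" by simp
        then show ?case by (intro mult_nonneg_nonneg k0 f0)
      qed
    qed
    also have "(\<integral>s. ?k \<eta> s * ?f s \<partial>seg) = log_op ?f (cos \<eta>)" by (simp add: log_op_def)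
    also have "\<dots> = (1 - ?f (cos \<eta>)) / l" using f(2)[OF cosr, of \<eta>] l by (simp add: field_simps)
    finally show ?thesis .
  qed
  have outer: "(\<integral>\<^sup>+ \<eta>. ennreal (?k \<eta> s) * indicator {0..pi} \<eta> \<partial>lborel) = ennreal (2 * pi * ln 2)"
    if s: "-1 < s" "s < 1" for s
  proof (rule nn_integral_has_integral_lebesgue')
    have "0 < arccos s" "arccos s < pi" using s arccos_lt_bounded by auto
    from equilibrium_potential[OF this] show "((\<lambda>\<eta>. ?k \<eta> s) has_integral 2 * pi * ln 2) {0..pi}"
      using s by simp
    show "?k \<eta> s \<ge> 0" for \<eta> using k0 s by simp
  qed
  \<comment> \<open>Integrate the equation at x = cos \<eta> over [0, pi]. As kernel and density are
    nonnegative, Tonelli exchanges the integrals, and the one over \<eta> becomes the constant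
    equilibrium potential.\<close>
  have "ennreal ((pi - ?J) / l) = (\<integral>\<^sup>+ \<eta>. ennreal ((1 - ?f (cos \<eta>)) / l) * indicator {0..pi} \<eta> \<partial>lborel)"
  proof (rule nn_integral_has_integral_lebesgue'[symmetric])
    have "((\<lambda>\<eta>. (1 - ?f (cos \<eta>)) / l) has_integral (pi * 1 - ?J) / l) {0..pi}"
      using has_integral_const_real[of "1::real" 0 pi]
      by (intro has_integral_divide has_integral_diff integrable_integral integrable_continuous_interval cc) auto
    then show "((\<lambda>\<eta>. (1 - ?f (cos \<eta>)) / l) has_integral (pi - ?J) / l) {0..pi}" by simp
    show "0 \<le> (1 - ?f (cos \<eta>)) / l" for \<eta> using f1[OF cosr] l by simp
  qed
  also have "\<dots> = (\<integral>\<^sup>+ \<eta>. (\<integral>\<^sup>+ s. ennreal (?k \<eta> s) * ennreal (?f s) * indicator {0..pi} \<eta> \<partial>seg) \<partial>lborel)"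
    by (intro nn_integral_cong) (simp add: inner[symmetric] nn_integral_multc)
  also have "\<dots> = (\<integral>\<^sup>+ s. (\<integral>\<^sup>+ \<eta>. ennreal (?k \<eta> s) * ennreal (?f s) * indicator {0..pi} \<eta> \<partial>lborel) \<partial>seg)"
  proof (rule pair_sigma_finite.Fubini')
    show "pair_sigma_finite seg lborel" ..
    show "(\<lambda>(s, \<eta>). ennreal (?k \<eta> s) * ennreal (?f s) * indicator {0..pi} \<eta>) \<in> borel_measurable (seg \<Otimes>\<^sub>M lborel)"
      by measurable
  qed
  also have "\<dots> = (\<integral>\<^sup>+ s. ennreal (2 * pi * ln 2) * ennreal (?f s) \<partial>seg)"
  proof (rule nn_integral_cong_AE)
    show "AE s in seg. (\<integral>\<^sup>+ \<eta>. ennreal (?k \<eta> s) * ennreal (?f s) * indicator {0..pi} \<eta> \<partial>lborel) =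
        ennreal (2 * pi * ln 2) * ennreal (?f s)"
      \<comment> \<open>\<open>equilibrium_potential\<close> needs an angle strictly between 0 and
        pi, so the endpoints are discarded as a null set.\<close>
      using AE_seg AE_seg_neq[of 1] AE_seg_neq[of "-1"]
    proof eventually_elim
      case (elim s)
      then have s: "-1 < s" "s < 1" by auto
      have "(\<integral>\<^sup>+ \<eta>. ennreal (?k \<eta> s) * ennreal (?f s) * indicator {0..pi} \<eta> \<partial>lborel) =
          (\<integral>\<^sup>+ \<eta>. ennreal (?f s) * (ennreal (?k \<eta> s) * indicator {0..pi} \<eta>) \<partial>lborel)"
        by (intro nn_integral_cong) (simp add: mult_ac)
      also have "\<dots> = ennreal (?f s) * (\<integral>\<^sup>+ \<eta>. ennreal (?k \<eta> s) * indicator {0..pi} \<eta> \<partial>lborel)"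
        by (rule nn_integral_cmult) measurable
      finally show ?case unfolding outer[OF s] by (simp add: mult.commute)
    qed
  qed
  also have "\<dots> = ennreal (2 * pi * ln 2) * (\<integral>\<^sup>+ s. ennreal (?f s) \<partial>seg)"
    by (rule nn_integral_cmult) measurable
  also have "(\<integral>\<^sup>+ s. ennreal (?f s) \<partial>seg) = ennreal ?I"
  proof (intro nn_integral_eq_integral bounded_cont_integrable f(1))
    show "AE s in seg. 0 \<le> ?f s" using AE_seg by eventually_elim (rule f0, simp)
  qed
  also have "ennreal (2 * pi * ln 2) * ennreal ?I = ennreal (2 * pi * ln 2 * ?I)"
    using robin_density_integral_bounds(1)[OF l0] by (simp add: ennreal_mult)
  finally have e: "ennreal ((pi - ?J) / l) = ennreal (2 * pi * ln 2 * ?I)" .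
  have "?J \<le> pi"
  proof -
    have "?J \<le> integral {0..pi} (\<lambda>_. 1)"
      by (intro integral_le integrable_continuous_interval cc) (use f1[OF cosr] in auto)
    then show ?thesis by simp
  qed
  then have "(pi - ?J) / l \<ge> 0" using l by simp
  moreover have "2 * pi * ln 2 * ?I \<ge> 0" using robin_density_integral_bounds(1)[OF l0] by simp
  ultimately have "(pi - ?J) / l = 2 * pi * ln 2 * ?I" using e by simp
  then show ?thesis using l by (simp add: robin_mass_def field_simps)
qed

text \<open>The term 2 d comes from the end arcs, where f \<le> 1. In the middle, f is at most a
  plus f squared over 4 a; there the weight sin \<eta> is at least sin d, and the weighted integral
  of f squared is at most 1 / (2 ln 2 l).\<close>

lemma robin_density_cos_small:
  assumes l: "l > 0" and d: "0 < d" "d < pi / 2" and a: "a > 0"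
  shows "integral {0..pi} (\<lambda>\<eta>. robin_density l (cos \<eta>)) \<le> 2 * d + pi * a + 1 / (l * (8 * ln 2 * a * sin d))"
    and "0 \<le> integral {0..pi} (\<lambda>\<eta>. robin_density l (cos \<eta>))"
proof -
  let ?f = "robin_density l"
  let ?J = "integral {0..pi} (\<lambda>\<eta>. ?f (cos \<eta>))"
  have l0: "l \<ge> 0" using l by simp
  note f = robin_density[OF l0]
  note fc = bounded_contD(1)[OF f(1)]
  note f0 = robin_const_eq(2)[OF l] and f1 = robin_density_le_1[OF l]
  have cosr: "cos \<eta> \<in> {-1..1}" for \<eta> :: real by simp
  have cc: "continuous_on A (\<lambda>\<eta>. ?f (cos \<eta>))" for A
    by (rule continuous_on_compose2[OF fc]) (auto intro!: continuous_intros)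
  have ii: "(\<lambda>\<eta>. ?f (cos \<eta>)) integrable_on {u..v}" for u v
    by (rule integrable_continuous_interval[OF cc])
  show J0: "0 \<le> ?J" by (rule Henstock_Kurzweil_Integration.integral_nonneg[OF ii]) (use f0[OF cosr] in auto)
  have mass: "robin_mass l \<le> 1 / (2 * ln 2)"
  proof -
    have "?J / pi \<ge> 0" using J0 by simp
    then have "2 * ln 2 * robin_mass l \<le> 1" using robin_mass_eq[OF l] by linarith
    then show ?thesis by (simp add: pos_le_divide_eq mult.commute)
  qed
  have sind: "sin d > 0" using d by (intro sin_gt_zero) auto
  let ?g = "\<lambda>\<eta>. (?f (cos \<eta>))\<^sup>2 * sin \<eta>"
  have sub: "integral {0..pi} ?g \<le> 1 / (2 * ln 2 * l)"
  proof -
    \<comment> \<open>The cosine is decreasing, so the first integral on the right is over the empty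
      interval {1..-1}; negation then restores the sign.\<close>
    have "((\<lambda>\<eta>. (- sin \<eta>) *\<^sub>R (?f (cos \<eta>))\<^sup>2) has_integral
        integral {cos 0..cos pi} (\<lambda>x. (?f x)\<^sup>2) - integral {cos pi..cos 0} (\<lambda>x. (?f x)\<^sup>2)) {0..pi}"
    proof (rule has_integral_substitution_general[of "{}" _ _ _ "-1" 1])
      show "continuous_on {-1..1} (\<lambda>x. (?f x)\<^sup>2)"
        by (intro continuous_intros continuous_on_subset[OF fc]) auto
      show "(cos has_field_derivative - sin \<eta>) (at \<eta> within {0..pi})" for \<eta>
        by (auto intro!: derivative_eq_intros)
    qed (auto intro!: continuous_intros)
    from has_integral_neg[OF this]
    have "((\<lambda>\<eta>. sin \<eta> * (?f (cos \<eta>))\<^sup>2) has_integral integral {-1..1} (\<lambda>x. (?f x)\<^sup>2)) {0..pi}"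
      by simp
    then have "integral {0..pi} ?g = integral {-1..1} (\<lambda>x. (?f x)\<^sup>2)"
      by (simp add: integral_unique mult.commute)
    also have "\<dots> = (\<integral>x. (?f x)\<^sup>2 \<partial>seg)"
      by (rule integral_seg_continuous(2)[symmetric])
        (auto intro!: borel_measurable_continuous_onI continuous_intros continuous_on_subset[OF fc])
    also have "\<dots> \<le> (\<integral>x. ?f x \<partial>seg)" by (rule robin_density_L2_le[OF l0])
    also have "\<dots> = robin_mass l / l" using l by (simp add: robin_mass_def)
    also have "\<dots> \<le> 1 / (2 * ln 2) / l" using mass l by (intro divide_right_mono) auto
    finally show ?thesis by simp
  qed
  have cg: "continuous_on A ?g" for A by (intro continuous_intros cc)
  have ig: "?g integrable_on {u..v}" for u v by (rule integrable_continuous_interval[OF cg])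
  have "?J = integral {0..d} (\<lambda>\<eta>. ?f (cos \<eta>)) + integral {d..pi} (\<lambda>\<eta>. ?f (cos \<eta>))"
    using Henstock_Kurzweil_Integration.integral_combine[OF _ _ ii[of 0 pi], of d] d by simp
  also have "integral {d..pi} (\<lambda>\<eta>. ?f (cos \<eta>)) =
      integral {d..pi - d} (\<lambda>\<eta>. ?f (cos \<eta>)) + integral {pi - d..pi} (\<lambda>\<eta>. ?f (cos \<eta>))"
    using Henstock_Kurzweil_Integration.integral_combine[OF _ _ ii[of d pi], of "pi - d"] d by simp
  finally have J: "?J = integral {0..d} (\<lambda>\<eta>. ?f (cos \<eta>)) +
      (integral {d..pi - d} (\<lambda>\<eta>. ?f (cos \<eta>)) + integral {pi - d..pi} (\<lambda>\<eta>. ?f (cos \<eta>)))" .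
  have e1: "integral {u..v} (\<lambda>\<eta>. ?f (cos \<eta>)) \<le> v - u" if "u \<le> v" for u v
  proof -
    have "integral {u..v} (\<lambda>\<eta>. ?f (cos \<eta>)) \<le> integral {u..v} (\<lambda>_. 1)"
      by (intro integral_le ii) (use f1[OF cosr] in auto)
    then show ?thesis using that by simp
  qed
  have "integral {d..pi - d} (\<lambda>\<eta>. ?f (cos \<eta>)) \<le> integral {d..pi - d} (\<lambda>\<eta>. a + ?g \<eta> * (1 / (4 * a * sin d)))"
  proof (rule integral_le[OF ii])
    show "(\<lambda>\<eta>. a + ?g \<eta> * (1 / (4 * a * sin d))) integrable_on {d..pi - d}"
      by (intro integrable_continuous_interval continuous_intros cg)
    fix \<eta> assume \<eta>: "\<eta> \<in> {d..pi - d}"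
    have sin: "sin d \<le> sin \<eta>"
    proof (cases "\<eta> \<le> pi / 2")
      case True
      then show ?thesis using \<eta> d by (intro sin_monotone_2pi_le) auto
    next
      case False
      then have "sin d \<le> sin (pi - \<eta>)" using \<eta> d by (intro sin_monotone_2pi_le) auto
      then show ?thesis by simp
    qed
    let ?u = "?f (cos \<eta>)"
    have "2 * ?u * (2 * a) \<le> ?u\<^sup>2 + (2 * a)\<^sup>2" by (rule sum_squares_bound)
    then have "?u * (4 * a) \<le> a * (4 * a) + ?u\<^sup>2" by (simp add: power2_eq_square algebra_simps)
    then have "?u \<le> (a * (4 * a) + ?u\<^sup>2) / (4 * a)" using a by (subst pos_le_divide_eq) auto
    also have "\<dots> = a + ?u\<^sup>2 / (4 * a)" using a by (simp add: add_divide_distrib)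
    also have "?u\<^sup>2 / (4 * a) \<le> ?g \<eta> * (1 / (4 * a * sin d))"
    proof -
      have "?u\<^sup>2 * sin d \<le> ?g \<eta>" using sin by (intro mult_left_mono) auto
      then have "?u\<^sup>2 * sin d / (4 * a * sin d) \<le> ?g \<eta> / (4 * a * sin d)"
        using a sind by (intro divide_right_mono) auto
      then show ?thesis using sind by simp
    qed
    finally show "?u \<le> a + ?g \<eta> * (1 / (4 * a * sin d))" by simp
  qed
  also have "\<dots> = (pi - 2 * d) * a + integral {d..pi - d} ?g * (1 / (4 * a * sin d))"
  proof -
    have "((\<lambda>\<eta>. a + ?g \<eta> * (1 / (4 * a * sin d))) has_integral (pi - d - d) *\<^sub>R a + integral {d..pi - d} ?g * (1 / (4 * a * sin d))) {d..pi - d}"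
      using d has_integral_const_real[of a d "pi - d"]
      by (intro has_integral_add has_integral_mult_left integrable_integral ig) auto
    then show ?thesis by (simp add: integral_unique)
  qed
  also have "\<dots> \<le> pi * a + 1 / (2 * ln 2 * l) * (1 / (4 * a * sin d))"
  proof (rule add_mono)
    show "(pi - 2 * d) * a \<le> pi * a" using a d by (intro mult_right_mono) auto
    have "integral {d..pi - d} ?g \<le> integral {0..pi} ?g"
      by (rule integral_subset_le) (use d ig in \<open>auto intro!: mult_nonneg_nonneg sin_ge_zero\<close>)
    then have "integral {d..pi - d} ?g \<le> 1 / (2 * ln 2 * l)" using sub by linarith
    then show "integral {d..pi - d} ?g * (1 / (4 * a * sin d)) \<le> 1 / (2 * ln 2 * l) * (1 / (4 * a * sin d))"
      using a sind by (intro mult_right_mono) auto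
  qed
  also have "1 / (2 * ln 2 * l) * (1 / (4 * a * sin d)) = 1 / (l * (8 * ln 2 * a * sin d))" by simp
  finally show "?J \<le> 2 * d + pi * a + 1 / (l * (8 * ln 2 * a * sin d))"
    using J e1[of 0 d] e1[of "pi - d" pi] d by simp
qed

lemma robin_mass_at_top: "(robin_mass \<longlongrightarrow> 1 / (2 * ln 2)) at_top"
proof -
  let ?J = "\<lambda>l. integral {0..pi} (\<lambda>\<eta>. robin_density l (cos \<eta>))"
  have "(?J \<longlongrightarrow> 0) at_top"
  proof (rule tendstoI)
    fix e :: real assume e: "e > 0"
    \<comment> \<open>Each of the three terms of \<open>robin_density_cos_small\<close> is allotted
      e / 4; the cap pi / 4 keeps d below pi / 2.\<close>
    define d where "d = min (pi / 4) (e / 8)"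
    define a where "a = e / (4 * pi)"
    have d: "0 < d" "d < pi / 2" "2 * d \<le> e / 4" using e pi_gt_zero by (auto simp: d_def min_def)
    have a: "a > 0" "pi * a = e / 4" using e by (auto simp: a_def)
    define K where "K = 8 * ln 2 * a * sin d"
    have K: "K > 0" using a d by (simp add: K_def sin_gt_zero)
    have "((\<lambda>l. 1 / (l * K)) \<longlongrightarrow> 0) at_top" using K by real_asymp
    then have "\<forall>\<^sub>F l in at_top. 1 / (l * K) < e / 4" using e by (intro order_tendstoD(2)) auto
    then show "\<forall>\<^sub>F l in at_top. dist (?J l) 0 < e"
      using eventually_gt_at_top[of 0]
    proof eventually_elim
      case (elim l)
      have "?J l \<le> 2 * d + pi * a + 1 / (l * K)" "0 \<le> ?J l"
        unfolding K_def by (rule robin_density_cos_small[OF elim(2) d(1,2) a(1)])+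
      then show ?case unfolding dist_real_def using elim(1) a(2) d(3) e by linarith
    qed
  qed
  then have "((\<lambda>l. (1 - ?J l / pi) / (2 * ln 2)) \<longlongrightarrow> (1 - 0 / pi) / (2 * ln 2)) at_top"
    by (intro tendsto_intros) auto
  moreover have "\<forall>\<^sub>F l in at_top. (1 - ?J l / pi) / (2 * ln 2) = robin_mass l"
    using eventually_gt_at_top[of 0]
  proof eventually_elim
    case (elim l)
    then show ?case using robin_mass_eq[OF elim] by (simp add: field_simps)
  qed
  ultimately show ?thesis by (simp add: Lim_transform_eventually)
qed

section \<open>From the mass back to the constant term\<close>

lemma robin_const_robin_mass: "\<mu> > 0 \<Longrightarrow> robin_const \<mu> = 1 / robin_mass (\<mu> / pi) - ln 2"
  using robin_const_eq(1)[of "\<mu> / pi"] by simp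

lemma robin_const_strict_antimono: "0 < \<mu> \<Longrightarrow> \<mu> < \<nu> \<Longrightarrow> robin_const \<nu> < robin_const \<mu>"
  using robin_mass_strict_mono[of "\<mu> / pi" "\<nu> / pi"] robin_mass_pos[of "\<mu> / pi"]
  by (simp add: robin_const_robin_mass divide_strict_right_mono frac_less2)

text \<open>The bound m \<le> 2 l at l = \<mu> / pi gives the explicit minorant pi / (2 \<mu>) - ln
  2.\<close>

lemma robin_const_at_right_0: "filterlim robin_const at_top (at_right 0)"
proof (rule filterlim_at_top_mono)
  show "filterlim (\<lambda>\<mu>. pi / (2 * \<mu>) - ln 2) at_top (at_right (0::real))" by real_asymp
  show "\<forall>\<^sub>F \<mu> in at_right 0. pi / (2 * \<mu>) - ln 2 \<le> robin_const \<mu>"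
    using eventually_at_right_less[of 0]
  proof eventually_elim
    case (elim \<mu>)
    have "1 / (2 * (\<mu> / pi)) \<le> 1 / robin_mass (\<mu> / pi)"
      using robin_mass_le[of "\<mu> / pi"] robin_mass_pos[of "\<mu> / pi"] elim by (intro divide_left_mono) auto
    then show ?case using elim by (simp add: robin_const_robin_mass)
  qed
qed

lemma robin_const_at_top: "(robin_const \<longlongrightarrow> ln 2) at_top"
proof -
  have "filterlim (\<lambda>\<mu>. \<mu> / pi) at_top at_top" by real_asymp
  from filterlim_compose[OF robin_mass_at_top this]
  have "((\<lambda>\<mu>. 1 / robin_mass (\<mu> / pi) - ln 2) \<longlongrightarrow> 1 / (1 / (2 * ln 2)) - ln 2) at_top"
    by (intro tendsto_intros) auto
  moreover have "\<forall>\<^sub>F \<mu> in at_top. 1 / robin_mass (\<mu> / pi) - ln 2 = robin_const \<mu>"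
    using eventually_gt_at_top[of 0] by eventually_elim (simp add: robin_const_robin_mass)
  ultimately show ?thesis by (simp add: Lim_transform_eventually)
qed

theorem mainTheorem3:
  "strict_antimono_on {0<..} robin_const \<and>
   filterlim robin_const at_top (at_right 0) \<and>
   (robin_const \<longlongrightarrow> ln 2) at_top \<and>
   (\<forall>\<epsilon>>0. strict_mono_on {0<..} (eff_half_length \<epsilon>) \<and>
      (eff_half_length \<epsilon> \<longlongrightarrow> \<epsilon>) at_top \<and>
      (eff_half_length \<epsilon> \<longlongrightarrow> 0) (at_right 0))"
proof (intro conjI allI impI)
  show "strict_antimono_on {0<..} robin_const"
    by (rule monotone_onI) (auto intro: robin_const_strict_antimono)
  show "filterlim robin_const at_top (at_right 0)" by (rule robin_const_at_right_0)
  show "(robin_const \<longlongrightarrow> ln 2) at_top" by (rule robin_const_at_top)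
  fix \<epsilon> :: real assume \<epsilon>: "\<epsilon> > 0"
  show "strict_mono_on {0<..} (eff_half_length \<epsilon>)"
    by (rule strict_mono_onI) (use \<epsilon> in \<open>auto simp: eff_half_length_def intro!: robin_const_strict_antimono\<close>)
  have "filterlim (\<lambda>q. \<epsilon> * q) at_top at_top" using \<epsilon> by real_asymp
  from filterlim_compose[OF robin_const_at_top this]
  have "((\<lambda>q. \<epsilon> * exp (ln 2 - robin_const (\<epsilon> * q))) \<longlongrightarrow> \<epsilon> * exp (ln 2 - ln 2)) at_top"
    by (intro tendsto_intros)
  then show "(eff_half_length \<epsilon> \<longlongrightarrow> \<epsilon>) at_top"
    by (simp add: eff_half_length_def[abs_def])
  have "filterlim (\<lambda>q. \<epsilon> * q) (at_right 0) (at_right 0)" using \<epsilon> by real_asymp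
  from filterlim_compose[OF robin_const_at_right_0 this]
  have "filterlim (\<lambda>q. robin_const (\<epsilon> * q)) at_top (at_right 0)" .
  moreover have "((\<lambda>c::real. \<epsilon> * exp (ln 2 - c)) \<longlongrightarrow> 0) at_top" using \<epsilon> by real_asymp
  ultimately have "((\<lambda>q. \<epsilon> * exp (ln 2 - robin_const (\<epsilon> * q))) \<longlongrightarrow> 0) (at_right 0)"
    by (rule filterlim_compose[rotated])
  then show "(eff_half_length \<epsilon> \<longlongrightarrow> 0) (at_right 0)"
    by (simp add: eff_half_length_def[abs_def])
qed

end
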